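(* Let $H$ be a separable complex Hilbert space, $D=D^*$ with compact resolvent, $\{h_m\}_{m\ge1}$ an orthonormal basis of eigenvectors, $Dh_m=\lambda_mh_m$, $G$ a positive bounded Borel function with $0<G(D)\in\mathcal{L}^{1,\infty}(H)$, and $U:H\to L^2(F,\mu)$ a joint spectral representation of commuting bounded selfadjoint operators $A_1,\dots,A_n$ acting non-degenerately on $H$. For $\omega\in DL_2$ and Borel $J\subset F$ put $\nu_{G,\omega}(J):=\mathrm{Tr}_\omega(T_{\chi_J}G(D)T_{\chi_J})$, where $T_f=U^*M_fU$. Suppose $G(D)$ is spectrally measurable with respect to $A_1,\dots,A_n$ and $U$. Then the following statements are equivalent: (ii) for all sequences of disjoint Borel sets $F_j\subset F$, $$\lim_{N\to\infty}\limsup_{k\to\infty}\Big(\frac1k\sum_mG(\lambda_m)^{1+\frac1k}\int_{\bigcup_{j=N}^\infty F_j}|(Uh_m)(x)|^2\,d\mu(x)\Big)=0;$$ (iii) for any sequence $Q_j$ of mutually orthogonal projections belonging to $U^*L^\infty(F,\mu)U$, $\|P_NG(D)P_N\|_0\to0$ as $N\to\infty$, where $P_N=\sum_{j=N}^\infty Q_j$; (iv) $\nu_{G,\omega}$ is a finite Borel measure on $F$, absolutely continuous with respect to $\mu$, for all $\omega\in DL_2$.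
   Context: $\mu_n(T)$ are the singular values of a compact operator $T$; $\mathcal{L}^{1,\infty}(H)$ is the ideal of compact $T$ with $\|T\|_{1,\infty}=\sup_{k}\frac{1}{\log(1+k)}\sum_{n=1}^k\mu_n(T)<\infty$; $\|T\|_0:=\limsup_k\frac{1}{\log(1+k)}\sum_{n=1}^k\mu_n(T)$. For $0<T\in\mathcal{L}^{1,\infty}$, $\gamma(T)=\{\frac{1}{\log(1+k)}\sum_{n=1}^k\mu_n(T)\}_{k}$. With $D_2(\{a_k\})=\{a_{\lceil k/2\rceil}\}_{k}$ on $\ell^\infty$, $DL_2$ is the set of positive functionals $\omega\in(\ell^\infty)^*$ with $\omega(1)=1$, $\liminf_k a_k\le\omega(\{a_k\})\le\limsup_k a_k$ for bounded $a_k\ge0$, and $\omega(D_2(\gamma(T)))=\omega(\gamma(T))$ for all $0<T\in\mathcal{L}^{1,\infty}$. $\mathrm{Tr}_\omega$ is the linear extension to $\mathcal{L}^{1,\infty}$ of $T\mapsto\omega(\gamma(T))$, $T>0$. $T\in\mathcal{L}^{1,\infty}$ is measurable if $\mathrm{Tr}_\omega(T)$ is independent of $\omega\in DL_2$; $G(D)$ is spectrally measurable if $T_{\chi_J}G(D)T_{\chi_J}$ is measurable for every Borel set $J\subset F$ (equivalently $PG(D)P$ is measurable for all projections $P\in U^*L^\infty(F,\mu)U$). A joint spectral representation is a unitary $U:H\to L^2(F,\mu)$, $(F,\mu)$ a finite Borel measure space, with $UA_iU^*=M_{e_i}$, $e_i$ bounded; it is assumed that there is a normal $^*$-homomorphism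 $f\mapsto f\circ e$, $e=(e_1,\dots,e_n)$, from the von Neumann algebra $\mathcal{M}\cong L^\infty(E,\mu_\eta)$ generated by the $A_i$ ($E$ the joint spectrum) into $L^\infty(F,\mu)$ with $Uf(A_1,\dots,A_n)U^*=M_{f\circ e}$. $M_f$ is multiplication by $f$, $\chi_J$ the characteristic function of $J$; $L^\infty(F,\mu)$ is identified with multiplication operators. *)

theory Defs
  imports "HOL-Analysis.Analysis"
begin

section \<open>Complex Hilbert spaces and operators\<close>

text \<open>Inner products are conjugate-linear in the first argument. Since the norm of a
  \<^class>\<open>real_normed_vector\<close> is definite, the last axiom makes \<open>cinner\<close> positive definite.\<close>

class complex_inner = real_normed_vector +
  fixes scaleC :: "complex \<Rightarrow> 'a \<Rightarrow> 'a"  (infixr \<open>*\<^sub>C\<close> 75)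
    and cinner :: "'a \<Rightarrow> 'a \<Rightarrow> complex"
  assumes scaleC_add_right: "a *\<^sub>C (x + y) = a *\<^sub>C x + a *\<^sub>C y"
    and scaleC_add_left: "(a + b) *\<^sub>C x = a *\<^sub>C x + b *\<^sub>C x"
    and scaleC_scaleC: "a *\<^sub>C b *\<^sub>C x = (a * b) *\<^sub>C x"
    and scaleR_scaleC: "r *\<^sub>R x = complex_of_real r *\<^sub>C x"
    and cinner_commute: "cinner x y = cnj (cinner y x)"
    and cinner_add_right: "cinner x (y + z) = cinner x y + cinner x z"
    and cinner_scaleC_right: "cinner x (a *\<^sub>C y) = a * cinner x y"
    and cinner_self: "cinner x x = complex_of_real ((norm x)\<^sup>2)"

class chilbert_space = complex_inner + complete_space

definition orthonormal_basis :: "(nat \<Rightarrow> 'h::chilbert_space) \<Rightarrow> bool" where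
  "orthonormal_basis h \<longleftrightarrow>
     (\<forall>i j. cinner (h i) (h j) = (if i = j then 1 else 0)) \<and>
     (\<forall>x. (\<lambda>m. cinner (h m) x *\<^sub>C h m) sums x)"

definition bounded_clinear :: "('h::chilbert_space \<Rightarrow> 'h) \<Rightarrow> bool" where
  "bounded_clinear T \<longleftrightarrow> bounded_linear T \<and> (\<forall>c x. T (c *\<^sub>C x) = c *\<^sub>C T x)"

definition selfadjoint_op :: "('h::chilbert_space \<Rightarrow> 'h) \<Rightarrow> bool" where
  "selfadjoint_op T \<longleftrightarrow> bounded_clinear T \<and> (\<forall>x y. cinner (T x) y = cinner x (T y))"

definition adjoint_op :: "('h::chilbert_space \<Rightarrow> 'h) \<Rightarrow> 'h \<Rightarrow> 'h" where
  "adjoint_op T = (THE S. bounded_clinear S \<and> (\<forall>x y. cinner (T x) y = cinner x (S y)))"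

definition op_le :: "('h::chilbert_space \<Rightarrow> 'h) \<Rightarrow> ('h \<Rightarrow> 'h) \<Rightarrow> bool" where
  "op_le S T \<longleftrightarrow>
     (\<forall>x. Im (cinner x (T x - S x)) = 0 \<and> Re (cinner x (T x - S x)) \<ge> 0)"

text \<open>The relation \<open>0 < T\<close>: positive semidefinite and nonzero (not: injective).\<close>

definition positive_op :: "('h::chilbert_space \<Rightarrow> 'h) \<Rightarrow> bool" where
  "positive_op T \<longleftrightarrow> bounded_clinear T \<and> op_le (\<lambda>_. 0) T \<and> T \<noteq> (\<lambda>_. 0)"

definition is_projection :: "('h::chilbert_space \<Rightarrow> 'h) \<Rightarrow> bool" where
  "is_projection P \<longleftrightarrow> selfadjoint_op P \<and> P \<circ> P = P"

definition compact_op :: "('h::chilbert_space \<Rightarrow> 'h) \<Rightarrow> bool" where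
  "compact_op T \<longleftrightarrow> bounded_clinear T \<and> compact (closure (T ` cball 0 1))"

text \<open>Real and complex linear span coincide for a union of ranges of complex-linear maps, and this
  span is dense iff the algebra generated by the \<open>A i\<close> acts non-degenerately.\<close>

definition acts_nondegenerately :: "('n \<Rightarrow> 'h::chilbert_space \<Rightarrow> 'h) \<Rightarrow> bool" where
  "acts_nondegenerately A \<longleftrightarrow> closure (span (\<Union>i. range (A i))) = UNIV"


section \<open>Unbounded operators\<close>

text \<open>An unbounded operator is given by its domain \<open>domD\<close> and a total function \<open>D\<close>, whose values
  outside \<open>domD\<close> are irrelevant. The last conjunct of \<open>selfadjoint_on\<close> says that the adjoint of
  \<open>D\<close> is contained in \<open>D\<close>.\<close>

definition selfadjoint_on :: "'h::chilbert_space set \<Rightarrow> ('h \<Rightarrow> 'h) \<Rightarrow> bool" where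
  "selfadjoint_on domD D \<longleftrightarrow>
     0 \<in> domD \<and> (\<forall>x\<in>domD. \<forall>y\<in>domD. x + y \<in> domD \<and> D (x + y) = D x + D y) \<and>
     (\<forall>c. \<forall>x\<in>domD. c *\<^sub>C x \<in> domD \<and> D (c *\<^sub>C x) = c *\<^sub>C D x) \<and>
     closure domD = UNIV \<and>
     (\<forall>x\<in>domD. \<forall>y\<in>domD. cinner (D x) y = cinner x (D y)) \<and>
     (\<forall>y z. (\<forall>x\<in>domD. cinner (D x) y = cinner x z) \<longrightarrow> y \<in> domD \<and> D y = z)"

text \<open>Compactness of the resolvent at one point of the resolvent set; by the resolvent identity
  this is the same as compactness at every point.\<close>

definition compact_resolvent :: "'h::chilbert_space set \<Rightarrow> ('h \<Rightarrow> 'h) \<Rightarrow> bool" where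
  "compact_resolvent domD D \<longleftrightarrow>
     (\<exists>z. bij_betw (\<lambda>x. D x - z *\<^sub>C x) domD UNIV \<and>
          compact_op (inv_into domD (\<lambda>x. D x - z *\<^sub>C x)))"


section \<open>Borel functional calculus\<close>

definition spectral_measure :: "('b::topological_space set \<Rightarrow> 'h::chilbert_space \<Rightarrow> 'h) \<Rightarrow> bool" where
  "spectral_measure E \<longleftrightarrow>
     (\<forall>B\<in>sets borel. is_projection (E B)) \<and> E UNIV = id \<and>
     (\<forall>B\<in>sets borel. \<forall>C\<in>sets borel. E (B \<inter> C) = E B \<circ> E C) \<and>
     (\<forall>B :: nat \<Rightarrow> 'b set. range B \<subseteq> sets borel \<and> disjoint_family B \<longrightarrow>
        (\<forall>x. (\<lambda>j. E (B j) x) sums E (\<Union>j. B j) x))"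

definition scalar_spectral_measure ::
    "('b::topological_space set \<Rightarrow> 'h::chilbert_space \<Rightarrow> 'h) \<Rightarrow> 'h \<Rightarrow> 'b measure" where
  "scalar_spectral_measure E x = measure_of UNIV (sets borel) (\<lambda>B. ennreal (Re (cinner x (E B x))))"

definition spectral_integral ::
    "('b::topological_space set \<Rightarrow> 'h::chilbert_space \<Rightarrow> 'h) \<Rightarrow> ('b \<Rightarrow> complex) \<Rightarrow> ('h \<Rightarrow> 'h) \<Rightarrow> bool" where
  "spectral_integral E f T \<longleftrightarrow> bounded_clinear T \<and>
     (\<forall>x. cinner x (T x) = (LINT t|scalar_spectral_measure E x. f t))"

definition spectral_resolution ::
    "'h::chilbert_space set \<Rightarrow> ('h \<Rightarrow> 'h) \<Rightarrow> (real set \<Rightarrow> 'h \<Rightarrow> 'h) \<Rightarrow> bool" where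
  "spectral_resolution domD D E \<longleftrightarrow> spectral_measure E \<and>
     domD = {x. integrable (scalar_spectral_measure E x) (\<lambda>t. t\<^sup>2)} \<and>
     (\<forall>x\<in>domD. cinner x (D x) = complex_of_real (LINT t|scalar_spectral_measure E x. t))"

text \<open>\<open>f(D)\<close> for selfadjoint \<open>D\<close> and bounded Borel \<open>f\<close>.\<close>

definition borel_calc ::
    "'h::chilbert_space set \<Rightarrow> ('h \<Rightarrow> 'h) \<Rightarrow> (real \<Rightarrow> complex) \<Rightarrow> 'h \<Rightarrow> 'h" where
  "borel_calc domD D f = (THE T. \<exists>E. spectral_resolution domD D E \<and> spectral_integral E f T)"

definition joint_spectral_resolution ::
    "('n::finite \<Rightarrow> 'h::chilbert_space \<Rightarrow> 'h) \<Rightarrow> ((real^'n) set \<Rightarrow> 'h \<Rightarrow> 'h) \<Rightarrow> bool" where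
  "joint_spectral_resolution A E \<longleftrightarrow> spectral_measure E \<and>
     (\<exists>K. compact K \<and> E K = id) \<and>
     (\<forall>i x. cinner x (A i x) = complex_of_real (LINT t|scalar_spectral_measure E x. t $ i))"

text \<open>\<open>f(A\<^sub>1, \<dots>, A\<^sub>n)\<close> for commuting bounded selfadjoint \<open>A i\<close> and bounded Borel \<open>f\<close>. The value only
  depends on the restriction of \<open>f\<close> to the joint spectrum, so \<open>f\<close> may be taken on all of
  \<open>\<real>\<^sup>n\<close>.\<close>

definition joint_calc ::
    "('n::finite \<Rightarrow> 'h::chilbert_space \<Rightarrow> 'h) \<Rightarrow> (real^'n \<Rightarrow> complex) \<Rightarrow> 'h \<Rightarrow> 'h" where
  "joint_calc A f = (THE T. \<exists>E. joint_spectral_resolution A E \<and> spectral_integral E f T)"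


section \<open>Joint spectral representations\<close>

text \<open>Elements of \<open>L\<^sup>2\<close> and \<open>L\<^sup>\<infinity>\<close> are represented by functions, and all identities between them
  hold almost everywhere. A unitary into \<open>L\<^sup>2\<close> thus sends a vector to a representative of its
  image.\<close>

definition L2_fun :: "'f measure \<Rightarrow> ('f \<Rightarrow> complex) set" where
  "L2_fun M = {f \<in> borel_measurable M. integrable M (\<lambda>t. (cmod (f t))\<^sup>2)}"

definition Linf_fun :: "'f measure \<Rightarrow> ('f \<Rightarrow> complex) set" where
  "Linf_fun M = {f \<in> borel_measurable M. \<exists>C. AE t in M. cmod (f t) \<le> C}"

definition unitary_to_L2 :: "'f measure \<Rightarrow> ('h::chilbert_space \<Rightarrow> 'f \<Rightarrow> complex) \<Rightarrow> bool" where
  "unitary_to_L2 M U \<longleftrightarrow>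
     (\<forall>x. U x \<in> L2_fun M) \<and>
     (\<forall>x y. AE t in M. U (x + y) t = U x t + U y t) \<and>
     (\<forall>c x. AE t in M. U (c *\<^sub>C x) t = c * U x t) \<and>
     (\<forall>x y. (LINT t|M. cnj (U x t) * U y t) = cinner x y) \<and>
     (\<forall>f\<in>L2_fun M. \<exists>x. AE t in M. U x t = f t)"

text \<open>\<open>U\<^sup>* M\<^sub>f U\<close> for \<open>f \<in> L\<^sup>\<infinity>\<close>.\<close>

definition mult_op ::
    "'f measure \<Rightarrow> ('h::chilbert_space \<Rightarrow> 'f \<Rightarrow> complex) \<Rightarrow> ('f \<Rightarrow> complex) \<Rightarrow> 'h \<Rightarrow> 'h" where
  "mult_op M U f x = (THE y. AE t in M. U y t = f t * U x t)"

definition mult_algebra :: "'f measure \<Rightarrow> ('h::chilbert_space \<Rightarrow> 'f \<Rightarrow> complex) \<Rightarrow> ('h \<Rightarrow> 'h) set" where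
  "mult_algebra M U = mult_op M U ` Linf_fun M"

definition commutant :: "('h::chilbert_space \<Rightarrow> 'h) set \<Rightarrow> ('h \<Rightarrow> 'h) set" where
  "commutant X = {S. bounded_clinear S \<and> (\<forall>T\<in>X. S \<circ> T = T \<circ> S)}"

text \<open>The von Neumann algebra generated by selfadjoint operators.\<close>

definition vN_algebra :: "('n \<Rightarrow> 'h::chilbert_space \<Rightarrow> 'h) \<Rightarrow> ('h \<Rightarrow> 'h) set" where
  "vN_algebra A = commutant (commutant (range A))"

text \<open>Normality: the supremum in \<open>N\<close> of an upward directed set of selfadjoint elements is mapped to
  the supremum of the images in \<open>L\<^sup>\<infinity>\<close>. Images of selfadjoint elements are real almost
  everywhere.\<close>

definition normal_star_hom ::
    "('h::chilbert_space \<Rightarrow> 'h) set \<Rightarrow> 'f measure \<Rightarrow> (('h \<Rightarrow> 'h) \<Rightarrow> 'f \<Rightarrow> complex) \<Rightarrow> bool" where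
  "normal_star_hom N M \<pi> \<longleftrightarrow>
     (\<forall>S\<in>N. \<pi> S \<in> Linf_fun M) \<and>
     (\<forall>S\<in>N. \<forall>T\<in>N. AE t in M. \<pi> (\<lambda>x. S x + T x) t = \<pi> S t + \<pi> T t) \<and>
     (\<forall>c. \<forall>S\<in>N. AE t in M. \<pi> (\<lambda>x. c *\<^sub>C S x) t = c * \<pi> S t) \<and>
     (\<forall>S\<in>N. \<forall>T\<in>N. AE t in M. \<pi> (S \<circ> T) t = \<pi> S t * \<pi> T t) \<and>
     (\<forall>S\<in>N. AE t in M. \<pi> (adjoint_op S) t = cnj (\<pi> S t)) \<and>
     (\<forall>X S. X \<noteq> {} \<and> X \<subseteq> {T\<in>N. selfadjoint_op T} \<and>
        (\<forall>T\<in>X. \<forall>T'\<in>X. \<exists>R\<in>X. op_le T R \<and> op_le T' R) \<and>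
        S \<in> N \<and> selfadjoint_op S \<and> (\<forall>T\<in>X. op_le T S) \<and>
        (\<forall>R\<in>N. selfadjoint_op R \<and> (\<forall>T\<in>X. op_le T R) \<longrightarrow> op_le S R) \<longrightarrow>
        (\<forall>T\<in>X. AE t in M. Re (\<pi> T t) \<le> Re (\<pi> S t)) \<and>
        (\<forall>g\<in>Linf_fun M. (\<forall>T\<in>X. AE t in M. Re (\<pi> T t) \<le> Re (g t)) \<longrightarrow>
           (AE t in M. Re (\<pi> S t) \<le> Re (g t))))"

text \<open>\<open>e\<close> collects the functions \<open>e\<^sub>1, \<dots>, e\<^sub>n\<close>. The homomorphism \<open>f \<mapsto> f \<circ> e\<close> is regarded as a map
  \<open>\<pi>\<close> on the von Neumann algebra via the identification of \<open>f\<close> with \<open>f(A\<^sub>1, \<dots>, A\<^sub>n)\<close>.\<close>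

definition joint_spectral_rep ::
    "('n::finite \<Rightarrow> 'h::chilbert_space \<Rightarrow> 'h) \<Rightarrow> 'f measure \<Rightarrow> ('h \<Rightarrow> 'f \<Rightarrow> complex) \<Rightarrow>
     ('f \<Rightarrow> real^'n) \<Rightarrow> bool" where
  "joint_spectral_rep A M U e \<longleftrightarrow>
     unitary_to_L2 M U \<and>
     e \<in> borel_measurable M \<and> bounded (range e) \<and>
     (\<forall>i x. AE t in M. U (A i x) t = complex_of_real (e t $ i) * U x t) \<and>
     (\<exists>\<pi>. normal_star_hom (vN_algebra A) M \<pi> \<and>
        (\<forall>f\<in>borel_measurable borel. bounded (range f) \<longrightarrow>
           (AE t in M. \<pi> (joint_calc A f) t = f (e t)) \<and>
           (\<forall>x. AE t in M. U (joint_calc A f x) t = f (e t) * U x t)))"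


section \<open>Singular values and the ideal of weak trace class operators\<close>

text \<open>\<open>singular_values T n\<close> is \<open>\<mu>\<^sub>n\<^sub>+\<^sub>1(T)\<close>: the square roots of the eigenvalues of \<open>T\<^sup>* T\<close> in decreasing
  order, repeated according to multiplicity, and continued by zeros if \<open>T\<close> has finite rank. The
  vectors \<open>u n\<close> form an orthonormal system of eigenvectors for the nonzero eigenvalues which
  exhausts the orthogonal complement of the kernel.\<close>

definition singular_values :: "('h::chilbert_space \<Rightarrow> 'h) \<Rightarrow> nat \<Rightarrow> real" where
  "singular_values T = (THE s. decseq s \<and> (\<forall>n. 0 \<le> s n) \<and>
     (\<exists>u. (\<forall>m n. 0 < s m \<and> 0 < s n \<longrightarrow> cinner (u m) (u n) = (if m = n then 1 else 0)) \<and>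
          (\<forall>n. 0 < s n \<longrightarrow> adjoint_op T (T (u n)) = complex_of_real ((s n)\<^sup>2) *\<^sub>C u n) \<and>
          (\<forall>x. (\<forall>n. 0 < s n \<longrightarrow> cinner (u n) x = 0) \<longrightarrow> T x = 0)))"

text \<open>The \<open>k\<close>-th term of the sequence \<open>\<gamma>(T)\<close>, for \<open>k \<ge> 1\<close>.\<close>

definition gamma_term :: "('h::chilbert_space \<Rightarrow> 'h) \<Rightarrow> nat \<Rightarrow> real" where
  "gamma_term T k = (\<Sum>n<k. singular_values T n) / ln (1 + real k)"

definition L1inf :: "('h::chilbert_space \<Rightarrow> 'h) set" where
  "L1inf = {T. compact_op T \<and> bdd_above (gamma_term T ` {1..})}"

definition norm0 :: "('h::chilbert_space \<Rightarrow> 'h) \<Rightarrow> ereal" where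
  "norm0 T = limsup (\<lambda>k. ereal (gamma_term T k))"


section \<open>Dixmier traces\<close>

text \<open>A sequence \<open>(a\<^sub>k)\<close>, \<open>k \<ge> 1\<close>, in \<open>\<ell>\<^sup>\<infinity>\<close> is represented by the bounded function \<open>j \<mapsto> a\<^sub>j\<^sub>+\<^sub>1\<close> on
  \<^typ>\<open>nat\<close>. In this indexing the map sending \<open>k\<close> to the ceiling of \<open>k / 2\<close> becomes
  \<open>j \<mapsto> j div 2\<close>.\<close>

type_synonym linf_seq = "nat \<Rightarrow>\<^sub>C real"

definition gamma_seq :: "('h::chilbert_space \<Rightarrow> 'h) \<Rightarrow> linf_seq" where
  "gamma_seq T = Bcontfun (\<lambda>j. gamma_term T (Suc j))"

definition D2 :: "linf_seq \<Rightarrow> linf_seq" where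
  "D2 a = Bcontfun (\<lambda>j. apply_bcontfun a (j div 2))"

lemma D2_index: "Suc (j div 2) = nat \<lceil>real (Suc j) / 2\<rceil>"
proof -
  have "\<lceil>real (Suc j) / 2\<rceil> = int (Suc (j div 2))"
    by (rule ceiling_unique) (cases "even j"; auto elim!: evenE oddE)+
  then show ?thesis by simp
qed

text \<open>Functionals are taken on real sequences; a positive functional on complex sequences is
  determined by its restriction to these. The dependence on \<open>'h\<close> stems from the last condition.\<close>

definition DL2 :: "'h::chilbert_space itself \<Rightarrow> (linf_seq \<Rightarrow>\<^sub>L real) set" where
  "DL2 (_ :: 'h itself) = {\<omega>.
     (\<forall>a. (\<forall>k. 0 \<le> apply_bcontfun a k) \<longrightarrow> 0 \<le> blinfun_apply \<omega> a) \<and>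
     blinfun_apply \<omega> (const_bcontfun 1) = 1 \<and>
     (\<forall>a. (\<forall>k. 0 \<le> apply_bcontfun a k) \<longrightarrow>
        liminf (\<lambda>k. ereal (apply_bcontfun a k)) \<le> ereal (blinfun_apply \<omega> a) \<and>
        ereal (blinfun_apply \<omega> a) \<le> limsup (\<lambda>k. ereal (apply_bcontfun a k))) \<and>
     (\<forall>T :: 'h \<Rightarrow> 'h. T \<in> L1inf \<and> positive_op T \<longrightarrow>
        blinfun_apply \<omega> (D2 (gamma_seq T)) = blinfun_apply \<omega> (gamma_seq T))}"

text \<open>Value at \<open>T\<close> of the (unique) linear functional on \<^term>\<open>L1inf\<close> that extends
  \<open>T \<mapsto> \<omega>(\<gamma>(T))\<close>, \<open>T > 0\<close>.\<close>

definition dixmier_trace :: "(linf_seq \<Rightarrow>\<^sub>L real) \<Rightarrow> ('h::chilbert_space \<Rightarrow> 'h) \<Rightarrow> complex" where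
  "dixmier_trace \<omega> T = (THE c. \<exists>\<phi> :: ('h \<Rightarrow> 'h) \<Rightarrow> complex.
     (\<forall>S\<in>L1inf. \<forall>R\<in>L1inf. \<phi> (\<lambda>x. S x + R x) = \<phi> S + \<phi> R) \<and>
     (\<forall>a. \<forall>S\<in>L1inf. \<phi> (\<lambda>x. a *\<^sub>C S x) = a * \<phi> S) \<and>
     (\<forall>S\<in>L1inf. positive_op S \<longrightarrow> \<phi> S = complex_of_real (blinfun_apply \<omega> (gamma_seq S))) \<and>
     c = \<phi> T)"

definition measurable_op :: "('h::chilbert_space \<Rightarrow> 'h) \<Rightarrow> bool" where
  "measurable_op T \<longleftrightarrow> T \<in> L1inf \<and>
     (\<forall>\<omega>\<in>DL2 TYPE('h). \<forall>\<omega>'\<in>DL2 TYPE('h). dixmier_trace \<omega> T = dixmier_trace \<omega>' T)"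

definition compress ::
    "'f measure \<Rightarrow> ('h::chilbert_space \<Rightarrow> 'f \<Rightarrow> complex) \<Rightarrow> ('h \<Rightarrow> 'h) \<Rightarrow> 'f set \<Rightarrow> 'h \<Rightarrow> 'h" where
  "compress M U T J = mult_op M U (indicator J) \<circ> T \<circ> mult_op M U (indicator J)"

definition spectrally_measurable ::
    "'f measure \<Rightarrow> ('h::chilbert_space \<Rightarrow> 'f \<Rightarrow> complex) \<Rightarrow> ('h \<Rightarrow> 'h) \<Rightarrow> bool" where
  "spectrally_measurable M U T \<longleftrightarrow> (\<forall>J\<in>sets M. measurable_op (compress M U T J))"

definition nu_measure ::
    "'f measure \<Rightarrow> ('h::chilbert_space \<Rightarrow> 'f \<Rightarrow> complex) \<Rightarrow> ('h \<Rightarrow> 'h) \<Rightarrow> (linf_seq \<Rightarrow>\<^sub>L real) \<Rightarrow>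
     'f set \<Rightarrow> complex" where
  "nu_measure M U GD \<omega> J = dixmier_trace \<omega> (compress M U GD J)"


section \<open>The equivalent conditions\<close>

definition residue_tail_condition ::
    "'f measure \<Rightarrow> ('h::chilbert_space \<Rightarrow> 'f \<Rightarrow> complex) \<Rightarrow> (nat \<Rightarrow> 'h) \<Rightarrow> (nat \<Rightarrow> real) \<Rightarrow>
     (real \<Rightarrow> real) \<Rightarrow> bool" where
  "residue_tail_condition M U h lam G \<longleftrightarrow>
     (\<forall>F :: nat \<Rightarrow> 'f set. range F \<subseteq> sets M \<and> disjoint_family F \<longrightarrow>
        (\<lambda>N. limsup (\<lambda>k. ereal (1 / real k *
           (\<Sum>m. G (lam m) powr (1 + 1 / real k) *
              (LINT t:(\<Union>j\<in>{N..}. F j)|M. (cmod (U (h m) t))\<^sup>2))))) \<longlonglongrightarrow> 0)"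

definition projection_tail_condition ::
    "'f measure \<Rightarrow> ('h::chilbert_space \<Rightarrow> 'f \<Rightarrow> complex) \<Rightarrow> ('h \<Rightarrow> 'h) \<Rightarrow> bool" where
  "projection_tail_condition M U GD \<longleftrightarrow>
     (\<forall>Q :: nat \<Rightarrow> 'h \<Rightarrow> 'h.
        (\<forall>j. is_projection (Q j) \<and> Q j \<in> mult_algebra M U) \<and>
        (\<forall>i j. i \<noteq> j \<longrightarrow> Q i \<circ> Q j = (\<lambda>_. 0)) \<longrightarrow>
        (\<lambda>N. let P = (\<lambda>x. \<Sum>j. Q (j + N) x) in norm0 (P \<circ> GD \<circ> P)) \<longlonglongrightarrow> 0)"

definition nu_measure_condition ::
    "'f measure \<Rightarrow> ('h::chilbert_space \<Rightarrow> 'f \<Rightarrow> complex) \<Rightarrow> ('h \<Rightarrow> 'h) \<Rightarrow> bool" where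
  "nu_measure_condition M U GD \<longleftrightarrow>
     (\<forall>\<omega>\<in>DL2 TYPE('h). \<exists>\<nu> :: 'f measure.
        sets \<nu> = sets M \<and> finite_measure \<nu> \<and>
        (\<forall>J\<in>sets M. nu_measure M U GD \<omega> J = complex_of_real (measure \<nu> J)) \<and>
        absolutely_continuous M \<nu>)"

end

theory Submission
  imports Defs "HOL-Library.Function_Algebras" "HOL-Real_Asymp.Real_Asymp"
begin

text \<open>Write \<open>g\<^sub>m = G(\<lambda>\<^sub>m)\<close>, \<open>T = G(D)\<close>, which is diagonal with entries \<open>g\<^sub>m\<close> in the basis \<open>h\<close>, and
  \<open>P\<^sub>J = T\<^sub>\<chi>\<^sub>J\<close>. Projections in \<open>U\<^sup>* L\<^sup>\<infinity> U\<close> are the \<open>P\<^sub>J\<close>, so (ii) and (iii) both speak about the tails \<open>J\<close>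
  of a disjoint sequence of Borel sets. They are equivalent because the residue
  \<open>limsup 1/k \<Sum>\<^sub>m g\<^sub>m\<^sup>1\<^sup>+\<^sup>1\<^sup>/\<^sup>k \<parallel>P\<^sub>J h\<^sub>m\<parallel>\<^sup>2\<close> and \<open>\<parallel>P\<^sub>J T P\<^sub>J\<parallel>\<^sub>0\<close> bound each other up to absolute constants, by Ky Fan's
  maximum principle.

  For \<open>S \<ge> 0\<close> the functionals in \<open>DL\<^sub>2\<close> take values at most \<open>\<parallel>S\<parallel>\<^sub>0\<close> on \<open>\<gamma>(S)\<close>, and some functional attains
  \<open>\<parallel>S\<parallel>\<^sub>0\<close>: a limit of means over short dyadic orbits starting where \<open>\<gamma>(S)\<close> is close to its upper limit. For
  measurable \<open>P\<^sub>J T P\<^sub>J\<close> the common value of the Dixmier traces is therefore \<open>\<parallel>P\<^sub>J T P\<^sub>J\<parallel>\<^sub>0\<close>, and (iii) is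
  continuity at the empty set of the set function \<open>\<nu>\<close>. This function is finitely additive since
  \<open>P\<^sub>J T P\<^sub>J\<close> has the same singular values as \<open>T\<^sup>1\<^sup>/\<^sup>2 P\<^sub>J T\<^sup>1\<^sup>/\<^sup>2\<close>, and it vanishes on null sets since \<open>P\<^sub>J\<close> does.\<close>

section \<open>Complex inner products\<close>

text \<open>Singular values, the Dixmier trace and the Borel calculus are definite descriptions, so
  each needs an existence and a uniqueness proof before it can be computed. Existence comes from the
  spectral theorem for compact nonnegative operators, from a basis extension of a functional that is
  additive on the positive cone, and from the diagonal spectral measure. Uniqueness comes from Ky
  Fan's principle, from the prescribed values on positive operators, and from evaluating an
  arbitrary spectral resolution on the eigenvectors \<open>h m\<close>. The difficulty in comparing
  the residue with \<open>norm0\<close> is that the \<open>h m\<close> do not diagonalise the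
  compressions. One estimate tests the eigenvectors of the compression against the basis and picks
  the exponent \<open>1 + 1 / k\<close> with \<open>k\<close> close to \<open>ln N\<close>, which
  produces the constant e; the other counts the \<open>g m\<close> above \<open>exp (- j)\<close>,
  whose number has logarithm at most \<open>2 * j + c\<close>, which produces a factor 2. Constants
  are harmless there, as only convergence to zero is transferred. The link to the measures has to be
  exact, and measurability makes one functional stand for all of them.\<close>

lemma cinner_add_left: "cinner (x + y) z = cinner x z + cinner y z"
  by (metis cinner_add_right cinner_commute complex_cnj_add)

lemma cinner_scaleC_left: "cinner (a *\<^sub>C x) y = cnj a * cinner x y"
  by (metis cinner_scaleC_right cinner_commute complex_cnj_mult complex_cnj_cnj)

lemma cinner_scaleR_right: "cinner x (r *\<^sub>R y) = r *\<^sub>R cinner x y"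
  by (simp add: scaleR_scaleC cinner_scaleC_right scaleR_conv_of_real)

lemma cinner_scaleR_left: "cinner (r *\<^sub>R x) y = r *\<^sub>R cinner x y"
  by (simp add: scaleR_scaleC cinner_scaleC_left scaleR_conv_of_real)

lemma cinner_zero_right [simp]: "cinner x 0 = 0"
  using cinner_add_right[of x 0 0] by simp

lemma cinner_zero_left [simp]: "cinner 0 x = 0"
  using cinner_add_left[of 0 0 x] by simp

lemma cinner_minus_right: "cinner x (- y) = - cinner x y"
  using cinner_add_right[of x y "- y"] by (simp add: eq_neg_iff_add_eq_0 add.commute)

lemma cinner_minus_left: "cinner (- x) y = - cinner x y"
  using cinner_add_left[of x "- x" y] by (simp add: eq_neg_iff_add_eq_0 add.commute)

lemma cinner_diff_right: "cinner x (y - z) = cinner x y - cinner x z"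
  using cinner_add_right[of x y "- z"] by (simp add: cinner_minus_right)

lemma cinner_diff_left: "cinner (x - y) z = cinner x z - cinner y z"
  using cinner_add_left[of x "- y" z] by (simp add: cinner_minus_left)

lemma cinner_sum_right: "cinner x (\<Sum>i\<in>I. f i) = (\<Sum>i\<in>I. cinner x (f i))"
  by (induction I rule: infinite_finite_induct) (auto simp: cinner_add_right)

lemma cinner_sum_left: "cinner (\<Sum>i\<in>I. f i) x = (\<Sum>i\<in>I. cinner (f i) x)"
  by (induction I rule: infinite_finite_induct) (auto simp: cinner_add_left)

lemmas cinner_simps = cinner_add_left cinner_add_right cinner_diff_left cinner_diff_right
  cinner_minus_left cinner_minus_right cinner_scaleC_left cinner_scaleC_right

lemma scaleC_zero_left [simp]: "0 *\<^sub>C x = (0 :: 'a :: complex_inner)"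
  using scaleR_scaleC[of 0 x] by simp

lemma scaleC_one [simp]: "1 *\<^sub>C x = (x :: 'a :: complex_inner)"
  using scaleR_scaleC[of 1 x] by simp

lemma scaleC_zero_right [simp]: "a *\<^sub>C 0 = (0 :: 'a :: complex_inner)"
  using scaleC_add_right[of a 0 0] by simp

lemma scaleC_minus_right: "a *\<^sub>C (- x) = - (a *\<^sub>C (x :: 'a :: complex_inner))"
  using scaleC_add_right[of a x "- x"] by (simp add: eq_neg_iff_add_eq_0 add.commute)

lemma scaleC_minus_left: "(- a) *\<^sub>C x = - (a *\<^sub>C (x :: 'a :: complex_inner))"
  using scaleC_add_left[of a "- a" x] by (simp add: eq_neg_iff_add_eq_0 add.commute)

lemma scaleC_minus_one: "(- 1) *\<^sub>C x = - (x :: 'a :: complex_inner)"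
  by (simp add: scaleC_minus_left)

lemma scaleC_diff_right: "a *\<^sub>C (x - y) = a *\<^sub>C x - a *\<^sub>C (y :: 'a :: complex_inner)"
  using scaleC_add_right[of a x "- y"] by (simp add: scaleC_minus_right)

lemma norm_scaleC: "norm (a *\<^sub>C x) = cmod a * norm (x :: 'a :: complex_inner)"
proof -
  have "complex_of_real ((norm (a *\<^sub>C x))\<^sup>2) = cnj a * a * complex_of_real ((norm x)\<^sup>2)"
    by (simp flip: cinner_self add: cinner_simps del: of_real_power)
  also have "cnj a * a = complex_of_real ((cmod a)\<^sup>2)"
    by (metis complex_norm_square mult.commute)
  finally have "(norm (a *\<^sub>C x))\<^sup>2 = (cmod a * norm x)\<^sup>2"
    by (simp add: power_mult_distrib flip: of_real_mult of_real_power)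
  then show ?thesis by simp
qed

lemma Re_cinner_self: "Re (cinner x x) = (norm x)\<^sup>2"
  by (simp add: cinner_self)

lemma norm_sq_add: "(norm (x + y))\<^sup>2 = (norm x)\<^sup>2 + (norm y)\<^sup>2 + 2 * Re (cinner x y)"
proof -
  have "Re (cinner y x) = Re (cinner x y)"
    by (subst cinner_commute) simp
  then show ?thesis
    by (simp flip: Re_cinner_self add: cinner_simps)
qed

lemma norm_sq_diff: "(norm (x - y))\<^sup>2 = (norm x)\<^sup>2 + (norm y)\<^sup>2 - 2 * Re (cinner x y)"
  using norm_sq_add[of x "- y"] by (simp add: cinner_minus_right)

lemma norm_cinner_le: "cmod (cinner x y) \<le> norm x * norm y"
proof (cases "y = 0")
  case False
  define c where "c = cinner y x"
  define t where "t = c / complex_of_real ((norm y)\<^sup>2)"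
  have ny: "norm y > 0" using False by simp
  have "0 \<le> (norm (x - t *\<^sub>C y))\<^sup>2" by simp
  also have "\<dots> = (norm x)\<^sup>2 + (cmod t * norm y)\<^sup>2 - 2 * Re (cinner x (t *\<^sub>C y))"
    by (simp add: norm_sq_diff norm_scaleC)
  also have "cinner x (t *\<^sub>C y) = c * cnj c / complex_of_real ((norm y)\<^sup>2)"
    by (simp add: cinner_simps t_def c_def) (metis cinner_commute)
  also have "\<dots> = complex_of_real ((cmod c)\<^sup>2 / (norm y)\<^sup>2)"
    by (simp add: complex_norm_square[symmetric])
  also have "cmod t * norm y = cmod c / norm y"
    using ny by (simp add: t_def norm_divide norm_mult power2_eq_square)
  finally have "(cmod c)\<^sup>2 / (norm y)\<^sup>2 \<le> (norm x)\<^sup>2"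
    by (simp add: power_divide)
  then have "(cmod c)\<^sup>2 \<le> (norm x * norm y)\<^sup>2"
    using ny by (simp add: field_simps power_mult_distrib)
  then have "cmod c \<le> norm x * norm y"
    by (rule power2_le_imp_le) simp
  moreover have "cmod (cinner x y) = cmod c"
    unfolding c_def by (subst cinner_commute) simp
  ultimately show ?thesis by simp
qed simp

text \<open>Conjugate-linearity in the first argument is still linearity over the reals, so limits
  and series pass through the inner product by the general rules for bilinear maps.\<close>

lemma bounded_bilinear_cinner: "bounded_bilinear (cinner :: 'a::complex_inner \<Rightarrow> 'a \<Rightarrow> complex)"
  by standard (auto simp: cinner_simps cinner_scaleR_right cinner_scaleR_left
      intro!: exI[of _ 1] norm_cinner_le)

lemmas tendsto_cinner = bounded_bilinear.tendsto[OF bounded_bilinear_cinner]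
lemmas bounded_linear_cinner_right = bounded_bilinear.bounded_linear_right[OF bounded_bilinear_cinner]

lemma bounded_linear_scaleC: "bounded_linear (\<lambda>x :: 'a::complex_inner. a *\<^sub>C x)"
  by (rule bounded_linear_intro[of _ "cmod a"])
     (auto simp: scaleC_add_right scaleR_scaleC scaleC_scaleC norm_scaleC mult.commute)

lemma cinner_eq_0_imp: "(\<And>y. cinner y x = 0) \<Longrightarrow> x = 0"
  by (metis Re_cinner_self norm_eq_zero power2_eq_iff_nonneg zero_complex.sel(1) zero_eq_power2)

lemma cinner_ext: "(\<And>y. cinner y a = cinner y b) \<Longrightarrow> a = b"
  using cinner_eq_0_imp[of "a - b"] by (simp add: cinner_simps)

lemma cinner_norm_sq: "cinner x y * cinner y x = complex_of_real ((cmod (cinner x y))\<^sup>2)"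
  by (metis cinner_commute complex_norm_square)

lemma cmod_cinner_commute: "cmod (cinner x y) = cmod (cinner y x)"
  by (metis cinner_commute complex_mod_cnj)

instance chilbert_space \<subseteq> banach ..

section \<open>Orthonormal systems\<close>

text \<open>Zero vectors are allowed, so that the eigenvectors of an operator of finite rank can be
  indexed by all natural numbers.\<close>

definition orthonormal_sys :: "('i \<Rightarrow> 'h::complex_inner) \<Rightarrow> bool" where
  "orthonormal_sys u \<longleftrightarrow> (\<forall>i. u i = 0 \<or> norm (u i) = 1) \<and> (\<forall>i j. i \<noteq> j \<longrightarrow> cinner (u i) (u j) = 0)"

lemma orthonormal_sys_cinner:
  "orthonormal_sys u \<Longrightarrow> cinner (u i) (u j) = (if i = j then if u i = 0 then 0 else 1 else 0)"
  unfolding orthonormal_sys_def by (auto simp: cinner_self)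

lemma orthonormal_sys_norm_sq_le: "orthonormal_sys u \<Longrightarrow> (norm (u i))\<^sup>2 \<le> 1"
  unfolding orthonormal_sys_def by (metis norm_zero one_power2 order_refl zero_le_one zero_power2)

lemma norm_sq_orthonormal_sum:
  assumes u: "orthonormal_sys u" and F: "finite F"
  shows "(norm (\<Sum>i\<in>F. c i *\<^sub>C u i))\<^sup>2 = (\<Sum>i\<in>F. if u i = 0 then 0 else (cmod (c i))\<^sup>2)"
proof -
  have "cinner (\<Sum>i\<in>F. c i *\<^sub>C u i) (\<Sum>i\<in>F. c i *\<^sub>C u i) =
     (\<Sum>i\<in>F. \<Sum>j\<in>F. if i = j then (if u i = 0 then 0 else cnj (c i) * c i) else 0)"
    unfolding cinner_sum_left cinner_sum_right
    by (rule sum.cong[OF refl], rule sum.cong[OF refl])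
       (auto simp: cinner_simps orthonormal_sys_cinner[OF u])
  also have "\<dots> = (\<Sum>i\<in>F. if u i = 0 then 0 else cnj (c i) * c i)"
    using F by simp
  also have "\<dots> = complex_of_real (\<Sum>i\<in>F. if u i = 0 then 0 else (cmod (c i))\<^sup>2)"
    unfolding of_real_sum
    by (rule sum.cong[OF refl]) (simp add: complex_norm_square mult.commute del: of_real_power)
  finally show ?thesis
    by (simp flip: Re_cinner_self)
qed

lemma norm_sq_orthonormal_sum_le:
  assumes u: "orthonormal_sys u" and F: "finite F"
  shows "(norm (\<Sum>i\<in>F. c i *\<^sub>C u i))\<^sup>2 \<le> (\<Sum>i\<in>F. (cmod (c i))\<^sup>2)"
  unfolding norm_sq_orthonormal_sum[OF assms] by (rule sum_mono) auto

lemma cinner_orthonormal_sum: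
  assumes u: "orthonormal_sys u" and F: "finite F"
  shows "cinner (u j) (\<Sum>i\<in>F. cinner (u i) x *\<^sub>C u i) = (if j \<in> F then cinner (u j) x else 0)"
proof -
  have "cinner (u j) (\<Sum>i\<in>F. cinner (u i) x *\<^sub>C u i) =
      (\<Sum>i\<in>F. if j = i then cinner (u j) x else 0)"
    unfolding cinner_sum_right
    by (rule sum.cong[OF refl]) (auto simp: cinner_simps orthonormal_sys_cinner[OF u])
  then show ?thesis using F by simp
qed

lemma norm_sq_orthonormal_diff:
  assumes u: "orthonormal_sys u" and F: "finite F"
  shows "(norm (x - (\<Sum>i\<in>F. cinner (u i) x *\<^sub>C u i)))\<^sup>2 =
    (norm x)\<^sup>2 - (\<Sum>i\<in>F. (cmod (cinner (u i) x))\<^sup>2)"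
proof -
  have "cinner x (\<Sum>i\<in>F. cinner (u i) x *\<^sub>C u i) = complex_of_real (\<Sum>i\<in>F. (cmod (cinner (u i) x))\<^sup>2)"
    unfolding cinner_sum_right of_real_sum
    by (rule sum.cong[OF refl]) (simp add: cinner_simps cinner_norm_sq del: of_real_power)
  moreover have "(norm (\<Sum>i\<in>F. cinner (u i) x *\<^sub>C u i))\<^sup>2 = (\<Sum>i\<in>F. (cmod (cinner (u i) x))\<^sup>2)"
    unfolding norm_sq_orthonormal_sum[OF assms] by (rule sum.cong) auto
  ultimately show ?thesis by (simp add: norm_sq_diff)
qed

lemma bessel:
  assumes "orthonormal_sys u" "finite F"
  shows "(\<Sum>i\<in>F. (cmod (cinner (u i) x))\<^sup>2) \<le> (norm x)\<^sup>2"
  using norm_sq_orthonormal_diff[OF assms, of x] zero_le_power2[of "norm (x - (\<Sum>i\<in>F. cinner (u i) x *\<^sub>C u i))"]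
  by linarith

lemma summable_bessel:
  fixes u :: "nat \<Rightarrow> 'h::complex_inner"
  assumes "orthonormal_sys u"
  shows "summable (\<lambda>i. (cmod (cinner (u i) x))\<^sup>2)"
  by (rule summableI_nonneg_bounded[of _ "(norm x)\<^sup>2"]) (auto intro: bessel[OF assms])

text \<open>Riesz-Fischer: by Pythagoras a block of the series is dominated by the same block of the
  sum of squares, and completeness does the rest.\<close>

lemma summable_orthonormal:
  fixes u :: "nat \<Rightarrow> 'h::chilbert_space"
  assumes u: "orthonormal_sys u" and c: "summable (\<lambda>i. (cmod (c i))\<^sup>2)"
  shows "summable (\<lambda>i. c i *\<^sub>C u i)"
  unfolding summable_Cauchy
proof (intro allI impI)
  fix e :: real assume e: "e > 0"
  then obtain N where N: "\<And>m n. m \<ge> N \<Longrightarrow> norm (sum (\<lambda>i. (cmod (c i))\<^sup>2) {m..<n}) < e\<^sup>2"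
    using c unfolding summable_Cauchy by (metis zero_less_power)
  show "\<exists>N. \<forall>m\<ge>N. \<forall>n. norm (\<Sum>i = m..<n. c i *\<^sub>C u i) < e"
  proof (intro exI allI impI)
    fix m n assume "m \<ge> N"
    have "(norm (\<Sum>i = m..<n. c i *\<^sub>C u i))\<^sup>2 \<le> (\<Sum>i = m..<n. (cmod (c i))\<^sup>2)"
      by (rule norm_sq_orthonormal_sum_le[OF u]) simp
    also have "\<dots> < e\<^sup>2"
      using N[OF \<open>m \<ge> N\<close>, of n] by (simp add: sum_nonneg)
    finally show "norm (\<Sum>i = m..<n. c i *\<^sub>C u i) < e"
      using e by (simp add: power2_less_imp_less)
  qed
qed

lemma cinner_suminf_right:
  "summable f \<Longrightarrow> (\<lambda>i. cinner x (f i)) sums cinner x (suminf f)"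
  by (rule bounded_linear.sums[OF bounded_linear_cinner_right summable_sums])

lemma cinner_orthonormal_suminf:
  fixes u :: "nat \<Rightarrow> 'h::chilbert_space"
  assumes u: "orthonormal_sys u" and c: "summable (\<lambda>i. (cmod (c i))\<^sup>2)"
  shows "cinner (u j) (\<Sum>i. c i *\<^sub>C u i) = (if u j = 0 then 0 else c j)"
proof -
  have "(\<lambda>i. cinner (u j) (c i *\<^sub>C u i)) sums cinner (u j) (\<Sum>i. c i *\<^sub>C u i)"
    by (rule cinner_suminf_right[OF summable_orthonormal[OF assms]])
  moreover have "(\<lambda>i. cinner (u j) (c i *\<^sub>C u i)) = (\<lambda>i. if i = j then (if u j = 0 then 0 else c j) else 0)"
    by (rule ext) (auto simp: cinner_simps orthonormal_sys_cinner[OF u])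
  ultimately have "(\<lambda>i. if i = j then (if u j = 0 then 0 else c j) else 0) sums cinner (u j) (\<Sum>i. c i *\<^sub>C u i)"
    by simp
  then show ?thesis
    by (rule sums_unique2[OF _ sums_single[of j "\<lambda>_. if u j = 0 then 0 else c j"]])
qed

section \<open>Bounded operators\<close>

lemma bounded_clinear_linear: "bounded_clinear T \<Longrightarrow> linear T"
  by (simp add: bounded_clinear_def bounded_linear.linear)

lemma bounded_clinear_add: "bounded_clinear T \<Longrightarrow> T (x + y) = T x + T y"
  by (simp add: bounded_clinear_linear linear_add)

lemma bounded_clinear_diff: "bounded_clinear T \<Longrightarrow> T (x - y) = T x - T y"
  by (simp add: bounded_clinear_linear linear_diff)

lemma bounded_clinear_minus: "bounded_clinear T \<Longrightarrow> T (- x) = - T x"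
  by (simp add: bounded_clinear_linear linear_neg)

lemma bounded_clinear_zero: "bounded_clinear T \<Longrightarrow> T 0 = 0"
  by (simp add: bounded_clinear_linear linear_0)

lemma bounded_clinear_scaleC: "bounded_clinear T \<Longrightarrow> T (c *\<^sub>C x) = c *\<^sub>C T x"
  by (simp add: bounded_clinear_def)

lemmas bounded_clinear_simps = bounded_clinear_add bounded_clinear_diff bounded_clinear_minus
  bounded_clinear_zero bounded_clinear_scaleC

lemma bounded_clinear_compose: "bounded_clinear S \<Longrightarrow> bounded_clinear T \<Longrightarrow> bounded_clinear (S \<circ> T)"
  unfolding bounded_clinear_def comp_def by (simp add: bounded_linear_compose)

lemma bounded_clinear_plus:
  "bounded_clinear S \<Longrightarrow> bounded_clinear T \<Longrightarrow> bounded_clinear (\<lambda>x. S x + T x)"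
  unfolding bounded_clinear_def by (simp add: bounded_linear_add scaleC_add_right)

lemma bounded_clinear_scaleC_op: "bounded_clinear T \<Longrightarrow> bounded_clinear (\<lambda>x. c *\<^sub>C T x)"
  unfolding bounded_clinear_def
  by (simp add: bounded_linear_compose[OF bounded_linear_scaleC] scaleC_scaleC mult.commute)

lemma bounded_clinear_const0: "bounded_clinear (\<lambda>_. 0)"
  by (simp add: bounded_clinear_def)

lemma bounded_clinear_sums:
  "bounded_clinear T \<Longrightarrow> f sums x \<Longrightarrow> (\<lambda>i. T (f i)) sums T x"
  unfolding bounded_clinear_def by (blast intro: bounded_linear.sums)

lemma bounded_clinearI:
  assumes "\<And>x y. T (x + y) = T x + T y" "\<And>c x. T (c *\<^sub>C x) = c *\<^sub>C T x"
    "\<And>x. norm (T x) \<le> norm x * K"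
  shows "bounded_clinear T"
  using assms unfolding bounded_clinear_def
  by (auto intro!: bounded_linear_intro[of T K] simp: scaleR_scaleC)

text \<open>In contrast to \<^const>\<open>positive_op\<close>, the zero operator is included.\<close>

definition nonneg_op :: "('h::chilbert_space \<Rightarrow> 'h) \<Rightarrow> bool" where
  "nonneg_op T \<longleftrightarrow> bounded_clinear T \<and> op_le (\<lambda>_. 0) T"

lemma positive_op_iff: "positive_op T \<longleftrightarrow> nonneg_op T \<and> T \<noteq> (\<lambda>_. 0)"
  by (auto simp: positive_op_def nonneg_op_def)

lemma nonneg_opD:
  assumes "nonneg_op T"
  shows "bounded_clinear T" "Im (cinner x (T x)) = 0" "Re (cinner x (T x)) \<ge> 0"
  using assms by (auto simp: nonneg_op_def op_le_def)

lemma nonneg_opI: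
  "bounded_clinear T \<Longrightarrow> (\<And>x. Im (cinner x (T x)) = 0) \<Longrightarrow> (\<And>x. Re (cinner x (T x)) \<ge> 0) \<Longrightarrow> nonneg_op T"
  by (auto simp: nonneg_op_def op_le_def)

text \<open>Reality of the form at \<open>x + y\<close> settles the imaginary part of the symmetry
  relation; replacing \<open>y\<close> by i times \<open>y\<close> turns the real part into an
  imaginary one.\<close>

lemma polarization_symmetric:
  assumes T: "bounded_clinear T" and im: "\<And>x. Im (cinner x (T x)) = 0"
  shows "cinner (T x) y = cinner x (T y)"
proof -
  have 1: "Im (cinner x (T y) + cinner y (T x)) = 0" for x y
    using im[of "x + y"] im[of x] im[of y] by (simp add: bounded_clinear_simps[OF T] cinner_simps)
  have 2: "Re (cinner x (T y) - cinner y (T x)) = 0"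
    using 1[of x "\<i> *\<^sub>C y"] by (simp add: bounded_clinear_simps[OF T] cinner_simps)
  have "cinner (T x) y = cnj (cinner y (T x))"
    by (rule cinner_commute)
  also have "\<dots> = cinner x (T y)"
    using 1[of x y] 2 by (simp add: complex_eq_iff)
  finally show ?thesis .
qed

lemma nonneg_op_symmetric: "nonneg_op T \<Longrightarrow> cinner (T x) y = cinner x (T y)"
  by (rule polarization_symmetric) (auto dest: nonneg_opD)

lemma nonneg_op_selfadjoint: "nonneg_op T \<Longrightarrow> selfadjoint_op T"
  unfolding selfadjoint_op_def using nonneg_op_symmetric nonneg_opD(1) by blast

text \<open>Over the complex numbers a form determines its operator: polarization at
  \<open>y\<close> and at i times \<open>y\<close> isolates \<open>cinner x (R y)\<close>. It lets
  operator identities be checked on forms, in terms of which spectral integrals are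
  specified.\<close>

lemma quadratic_form_ext:
  assumes S: "bounded_clinear S" and T: "bounded_clinear T"
    and eq: "\<And>x. cinner x (S x) = cinner x (T x)"
  shows "S = T"
proof
  fix x
  define R where "R = (\<lambda>x. S x + (- 1) *\<^sub>C T x)"
  have R: "bounded_clinear R"
    unfolding R_def by (intro bounded_clinear_plus bounded_clinear_scaleC_op S T)
  have 0: "cinner x (R x) = 0" for x
    by (simp add: R_def cinner_simps eq)
  have 1: "cinner x (R y) + cinner y (R x) = 0" for x y
    using 0[of "x + y"] 0[of x] 0[of y] by (simp add: bounded_clinear_simps[OF R] cinner_simps add.commute)
  have "cinner x (R y) = 0" for x y
  proof -
    have "\<i> * (cinner x (R y) - cinner y (R x)) = 0"
      using 1[of x "\<i> *\<^sub>C y"] by (simp add: bounded_clinear_simps[OF R] cinner_simps algebra_simps)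
    then show ?thesis using 1[of x y] by simp
  qed
  then have "R x = 0" by (rule cinner_eq_0_imp)
  then show "S x = T x" by (simp add: R_def scaleC_minus_one)
qed

lemma adjoint_op_eqI:
  assumes S: "bounded_clinear S" and adj: "\<And>x y. cinner (T x) y = cinner x (S y)"
  shows "adjoint_op T = S"
  unfolding adjoint_op_def
proof (rule the_equality)
  fix R assume "bounded_clinear R \<and> (\<forall>x y. cinner (T x) y = cinner x (R y))"
  then have "cinner x (R y) = cinner x (S y)" for x y
    using adj by metis
  then show "R = S" by (intro ext cinner_ext)
qed (use assms in auto)

lemma adjoint_op_selfadjoint: "selfadjoint_op T \<Longrightarrow> adjoint_op T = T"
  by (rule adjoint_op_eqI) (auto simp: selfadjoint_op_def)

lemma nonneg_op_plus: "nonneg_op S \<Longrightarrow> nonneg_op T \<Longrightarrow> nonneg_op (\<lambda>x. S x + T x)"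
  by (intro nonneg_opI bounded_clinear_plus) (simp_all add: cinner_simps nonneg_opD)

lemma nonneg_op_scale: "nonneg_op T \<Longrightarrow> r \<ge> 0 \<Longrightarrow> nonneg_op (\<lambda>x. complex_of_real r *\<^sub>C T x)"
  by (intro nonneg_opI bounded_clinear_scaleC_op) (simp_all add: cinner_simps nonneg_opD)

lemma nonneg_op_const0: "nonneg_op (\<lambda>_. 0)"
  by (rule nonneg_opI) (auto simp: bounded_clinear_const0)

text \<open>The form at \<open>x\<close> minus \<open>t\<close> times \<open>T x\<close> is a
  nonnegative polynomial in the real number \<open>t\<close>; \<open>t = 1 / \<alpha>\<close> gives
  the claim. The bound is asked at the vector \<open>T x\<close> only, so that \<alpha> may be a
  supremum over an invariant subspace instead of the norm of \<open>T\<close>.\<close>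

lemma nonneg_cauchy_schwarz:
  assumes T: "nonneg_op T" and \<alpha>: "\<alpha> \<ge> 0"
    and le: "Re (cinner (T x) (T (T x))) \<le> \<alpha> * (norm (T x))\<^sup>2"
  shows "(norm (T x))\<^sup>2 \<le> \<alpha> * Re (cinner x (T x))"
proof -
  note B = nonneg_opD(1)[OF T]
  define q where "q = Re (cinner x (T x))"
  define n where "n = (norm (T x))\<^sup>2"
  have q0: "q \<ge> 0" unfolding q_def by (rule nonneg_opD(3)[OF T])
  have n0: "n \<ge> 0" by (simp add: n_def)
  have *: "0 \<le> q - 2 * t * n + t\<^sup>2 * (\<alpha> * n)" for t :: real
  proof -
    define y where "y = complex_of_real t *\<^sub>C T x"
    have a: "cinner (T x) (T x) = complex_of_real n" by (simp add: n_def cinner_self)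
    have b: "cinner x (T (T x)) = complex_of_real n"
      using a nonneg_op_symmetric[OF T, of x "T x"] by simp
    have "0 \<le> Re (cinner (x - y) (T (x - y)))" by (rule nonneg_opD(3)[OF T])
    also have "\<dots> = q - 2 * t * n + t\<^sup>2 * Re (cinner (T x) (T (T x)))"
      by (simp add: y_def bounded_clinear_simps[OF B] cinner_simps a b q_def power2_eq_square algebra_simps)
    also have "\<dots> \<le> q - 2 * t * n + t\<^sup>2 * (\<alpha> * n)"
      using le by (intro add_left_mono mult_left_mono) (auto simp: n_def)
    finally show ?thesis .
  qed
  show ?thesis
  proof (cases "\<alpha> = 0")
    case True
    have "n = 0"
    proof (rule ccontr)
      assume "n \<noteq> 0"
      then have "n > 0" using n0 by simp
      \<comment> \<open>With \<alpha> equal to 0 the polynomial is affine in \<open>t\<close>, and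
        this witness would give it the value -1.\<close>
      then show False using *[of "(q + 1) / (2 * n)"] True by (simp add: field_simps)
    qed
    then show ?thesis using True n_def by simp
  next
    case False
    then have "0 \<le> q - n / \<alpha>"
      using *[of "1 / \<alpha>"] \<alpha> by (simp add: field_simps power2_eq_square)
    then show ?thesis using False \<alpha> by (simp add: n_def q_def field_simps)
  qed
qed

section \<open>Eigenvalues of compact nonnegative operators\<close>

text \<open>Data for \<open>T\<close> itself, whereas \<open>singular_values\<close> speaks of
  eigenvectors of the adjoint times \<open>T\<close>. Letting \<open>u n\<close> vanish exactly at
  zero eigenvalues gives finite and infinite rank the same shape.\<close>

definition eigensystem :: "('h::chilbert_space \<Rightarrow> 'h) \<Rightarrow> (nat \<Rightarrow> real) \<Rightarrow> (nat \<Rightarrow> 'h) \<Rightarrow> bool" where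
  "eigensystem T s u \<longleftrightarrow> decseq s \<and> (\<forall>n. 0 \<le> s n) \<and> orthonormal_sys u \<and>
     (\<forall>n. u n = 0 \<longleftrightarrow> s n = 0) \<and> (\<forall>n. T (u n) = complex_of_real (s n) *\<^sub>C u n) \<and>
     (\<forall>x. (\<forall>n. cinner (u n) x = 0) \<longrightarrow> T x = 0)"

lemma eigensystemD:
  assumes "eigensystem T s u"
  shows "decseq s" "\<And>n. 0 \<le> s n" "orthonormal_sys u" "\<And>n. u n = 0 \<longleftrightarrow> s n = 0"
    "\<And>n. T (u n) = complex_of_real (s n) *\<^sub>C u n" "\<And>x. (\<And>n. cinner (u n) x = 0) \<Longrightarrow> T x = 0"
  using assms unfolding eigensystem_def by blast+

text \<open>The part of \<open>x\<close> orthogonal to all \<open>u n\<close> is killed by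
  \<open>T\<close>, so \<open>T\<close> only sees the Fourier series of \<open>x\<close>.\<close>

lemma eigensystem_expansion:
  assumes T: "bounded_clinear T" and e: "eigensystem T s u"
  shows "(\<lambda>n. (complex_of_real (s n) * cinner (u n) x) *\<^sub>C u n) sums T x"
proof -
  note E = eigensystemD[OF e]
  note c = summable_bessel[OF E(3), of x]
  define y where "y = (\<Sum>n. cinner (u n) x *\<^sub>C u n)"
  have y: "(\<lambda>n. cinner (u n) x *\<^sub>C u n) sums y"
    unfolding y_def by (intro summable_sums summable_orthonormal E c)
  have "cinner (u n) (x - y) = 0" for n
    using cinner_orthonormal_suminf[OF E(3) c, of n] by (auto simp: cinner_simps y_def)
  then have "T (x - y) = 0" by (rule E(6))
  then have "T x = T y" by (simp add: bounded_clinear_simps[OF T])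
  moreover have "(\<lambda>n. T (cinner (u n) x *\<^sub>C u n)) sums T y"
    by (rule bounded_clinear_sums[OF T y])
  ultimately show ?thesis
    by (simp add: bounded_clinear_simps[OF T] E(5) scaleC_scaleC mult.commute)
qed

lemma eigensystem_form:
  assumes T: "bounded_clinear T" and e: "eigensystem T s u"
  shows "(\<lambda>n. s n * (cmod (cinner (u n) x))\<^sup>2) sums Re (cinner x (T x))"
proof -
  have "(\<lambda>n. cinner x ((complex_of_real (s n) * cinner (u n) x) *\<^sub>C u n)) sums cinner x (T x)"
    by (rule bounded_linear.sums[OF bounded_linear_cinner_right eigensystem_expansion[OF assms]])
  then have "(\<lambda>n. Re (cinner x ((complex_of_real (s n) * cinner (u n) x) *\<^sub>C u n))) sums Re (cinner x (T x))"
    by (rule bounded_linear.sums[OF bounded_linear_Re])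
  moreover have "Re (cinner x ((complex_of_real (s n) * cinner (u n) x) *\<^sub>C u n)) = s n * (cmod (cinner (u n) x))\<^sup>2" for n
  proof -
    have "cinner x ((complex_of_real (s n) * cinner (u n) x) *\<^sub>C u n) =
        complex_of_real (s n) * (cinner (u n) x * cinner x (u n))"
      by (simp add: cinner_simps)
    also have "\<dots> = complex_of_real (s n * (cmod (cinner (u n) x))\<^sup>2)"
      by (simp only: cinner_norm_sq of_real_mult)
    finally show ?thesis by simp
  qed
  ultimately show ?thesis by simp
qed

text \<open>Rearrangement: weights in the unit interval of total mass at most \<open>k\<close> do
  best on the \<open>k\<close> largest values. Subtracting \<open>s k\<close> from the values makes
  them nonnegative before \<open>k\<close> and nonpositive from \<open>k\<close> on.\<close>

lemma decseq_weighted_sum_le: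
  fixes s c :: "nat \<Rightarrow> real"
  assumes s: "decseq s" "s k \<ge> 0" and c: "\<And>n. 0 \<le> c n" "\<And>n. c n \<le> 1" "(\<Sum>n<N. c n) \<le> real k"
  shows "(\<Sum>n<N. s n * c n) \<le> (\<Sum>n<k. s n)"
proof -
  have "(\<Sum>n<N. (s n - s k) * c n) \<le> (\<Sum>n<N. if n < k then s n - s k else 0)"
  proof (rule sum_mono)
    fix n
    show "(s n - s k) * c n \<le> (if n < k then s n - s k else 0)"
      using decseqD[OF s(1), of n k] decseqD[OF s(1), of k n] c(1,2)[of n]
      by (auto simp: mult_left_le mult_nonpos_nonneg)
  qed
  also have "\<dots> = (\<Sum>n\<in>{..<N} \<inter> {..<k}. s n - s k)"
    by (simp add: sum.inter_restrict)
  also have "\<dots> \<le> (\<Sum>n<k. s n - s k)"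
    by (rule sum_mono2) (auto intro!: decseqD[OF s(1)])
  finally have "(\<Sum>n<N. s n * c n) - s k * (\<Sum>n<N. c n) \<le> (\<Sum>n<k. s n) - real k * s k"
    by (simp add: algebra_simps sum_subtractf sum_distrib_left)
  moreover have "s k * (\<Sum>n<N. c n) \<le> s k * real k"
    using s c by (intro mult_left_mono)
  ultimately show ?thesis by (simp add: mult.commute)
qed

lemma eigensystem_trace_sums:
  assumes T: "bounded_clinear T" and e: "eigensystem T s u"
  shows "(\<lambda>n. s n * (\<Sum>i\<in>I. (cmod (cinner (w i) (u n)))\<^sup>2)) sums (\<Sum>i\<in>I. Re (cinner (w i) (T (w i))))"
proof -
  have "(\<lambda>n. \<Sum>i\<in>I. s n * (cmod (cinner (u n) (w i)))\<^sup>2) sums (\<Sum>i\<in>I. Re (cinner (w i) (T (w i))))"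
    by (intro sums_sum eigensystem_form[OF assms])
  then show ?thesis
    by (simp add: sum_distrib_left cmod_cinner_commute)
qed

text \<open>Ky Fan's maximum principle. The weight of \<open>s n\<close> is the mass of
  \<open>u n\<close> along the \<open>w i\<close>: Bessel for \<open>w\<close> bounds it by 1, and
  Bessel for \<open>u\<close> bounds the total by the number of test vectors.\<close>

lemma eigensystem_trace_le:
  assumes T: "bounded_clinear T" and e: "eigensystem T s u"
    and w: "orthonormal_sys w" "finite I" "card I \<le> k"
  shows "(\<Sum>i\<in>I. Re (cinner (w i) (T (w i)))) \<le> (\<Sum>n<k. s n)"
proof -
  note E = eigensystemD[OF e]
  let ?c = "\<lambda>n. \<Sum>i\<in>I. (cmod (cinner (w i) (u n)))\<^sup>2"
  have "(\<Sum>n<N. s n * ?c n) \<le> (\<Sum>n<k. s n)" for N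
  proof (rule decseq_weighted_sum_le)
    fix n
    have "?c n \<le> (norm (u n))\<^sup>2" by (rule bessel[OF w(1,2)])
    also have "\<dots> \<le> 1" by (rule orthonormal_sys_norm_sq_le[OF E(3)])
    finally show "?c n \<le> 1" .
  next
    have "(\<Sum>n<N. ?c n) = (\<Sum>i\<in>I. \<Sum>n<N. (cmod (cinner (u n) (w i)))\<^sup>2)"
      by (subst sum.swap) (simp add: cmod_cinner_commute)
    also have "\<dots> \<le> (\<Sum>i\<in>I. 1)"
    proof (rule sum_mono)
      fix i
      have "(\<Sum>n<N. (cmod (cinner (u n) (w i)))\<^sup>2) \<le> (norm (w i))\<^sup>2"
        by (rule bessel[OF E(3)]) simp
      also have "\<dots> \<le> 1" by (rule orthonormal_sys_norm_sq_le[OF w(1)])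
      finally show "(\<Sum>n<N. (cmod (cinner (u n) (w i)))\<^sup>2) \<le> 1" .
    qed
    also have "\<dots> \<le> real k" using w(3) by simp
    finally show "(\<Sum>n<N. ?c n) \<le> real k" .
  qed (use E in \<open>auto intro: sum_nonneg\<close>)
  then show ?thesis
    using eigensystem_trace_sums[OF T e, of w I] unfolding sums_def
    by (intro LIMSEQ_le_const2) auto
qed

text \<open>For orthonormal \<open>w\<close> the hypothesis \<open>span\<close> says that the first
  \<open>k\<close> eigenvectors lie in the span of the \<open>w i\<close>. Each \<open>s n\<close>
  with \<open>n < k\<close> then occurs with full weight, and the remaining terms are
  nonnegative.\<close>

lemma eigensystem_trace_ge:
  assumes T: "bounded_clinear T" and e: "eigensystem T s u"
    and span: "\<And>n. n < k \<Longrightarrow> (\<Sum>i\<in>I. (cmod (cinner (w i) (u n)))\<^sup>2) = (norm (u n))\<^sup>2"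
  shows "(\<Sum>n<k. s n) \<le> (\<Sum>i\<in>I. Re (cinner (w i) (T (w i))))"
proof -
  note E = eigensystemD[OF e]
  note S = eigensystem_trace_sums[OF T e, of w I]
  have "(\<Sum>n<k. s n) = (\<Sum>n<k. s n * (\<Sum>i\<in>I. (cmod (cinner (w i) (u n)))\<^sup>2))"
  proof (rule sum.cong[OF refl])
    fix n assume "n \<in> {..<k}"
    then have n: "n < k" by simp
    consider "u n = 0" | "norm (u n) = 1" using E(3) by (auto simp: orthonormal_sys_def)
    then show "s n = s n * (\<Sum>i\<in>I. (cmod (cinner (w i) (u n)))\<^sup>2)"
      unfolding span[OF n] by cases (use E(4)[of n] in auto)
  qed
  also have "\<dots> \<le> (\<Sum>i\<in>I. Re (cinner (w i) (T (w i))))"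
    unfolding sums_unique[OF S]
    by (rule sum_le_suminf[OF sums_summable[OF S]]) (auto intro!: mult_nonneg_nonneg sum_nonneg E)
  finally show ?thesis .
qed

lemma sum_eigensystem:
  assumes "eigensystem T s u"
  shows "(\<Sum>n<k. Re (cinner (u n) (T (u n)))) = (\<Sum>n<k. s n)"
proof (rule sum.cong[OF refl])
  fix n
  note E = eigensystemD[OF assms]
  consider "u n = 0" | "norm (u n) = 1" using E(3) by (auto simp: orthonormal_sys_def)
  then show "Re (cinner (u n) (T (u n))) = s n"
    by cases (use E(4)[of n] in \<open>auto simp: E(5) cinner_simps cinner_self\<close>)
qed

text \<open>Each system supplies test vectors for the maximum principle of the other, so all partial
  sums agree.\<close>

lemma eigensystem_unique:
  assumes T: "bounded_clinear T" and e: "eigensystem T s u" "eigensystem T s' u'"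
  shows "s = s'"
proof
  have le: "(\<Sum>n<k. s n) \<le> (\<Sum>n<k. s' n)" if "eigensystem T s u" "eigensystem T s' u'" for s s' u u' k
    unfolding sum_eigensystem[OF that(1), symmetric]
    by (rule eigensystem_trace_le[OF T that(2)]) (use eigensystemD(3)[OF that(1)] in auto)
  fix n
  have "(\<Sum>n<k. s n) = (\<Sum>n<k. s' n)" for k
    using le[OF e] le[OF e(2,1)] by (simp add: antisym)
  from this[of "Suc n"] this[of n] show "s n = s' n" by simp
qed

text \<open>A competitor in the definite description diagonalises only the square of
  \<open>T\<close>; nonnegativity is what makes its vectors eigenvectors of \<open>T\<close>
  itself.\<close>

lemma singular_values_eqI:
  assumes T: "nonneg_op T" and e: "eigensystem T s u"
  shows "singular_values T = s"
proof -
  note B = nonneg_opD(1)[OF T]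
  note adj = adjoint_op_selfadjoint[OF nonneg_op_selfadjoint[OF T]]
  note E = eigensystemD[OF e]
  show ?thesis
    unfolding singular_values_def adj
  proof (rule the_equality, intro conjI)
    show "\<exists>u. (\<forall>m n. 0 < s m \<and> 0 < s n \<longrightarrow> cinner (u m) (u n) = (if m = n then 1 else 0)) \<and>
          (\<forall>n. 0 < s n \<longrightarrow> T (T (u n)) = complex_of_real ((s n)\<^sup>2) *\<^sub>C u n) \<and>
          (\<forall>x. (\<forall>n. 0 < s n \<longrightarrow> cinner (u n) x = 0) \<longrightarrow> T x = 0)"
    proof (intro exI[of _ u] conjI allI impI)
      fix m n assume "0 < s m \<and> 0 < s n"
      then show "cinner (u m) (u n) = (if m = n then 1 else 0)"
        using E(4)[of m] E(4)[of n] by (simp add: orthonormal_sys_cinner[OF E(3)])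
    next
      fix n
      show "T (T (u n)) = complex_of_real ((s n)\<^sup>2) *\<^sub>C u n"
        by (simp add: E(5) bounded_clinear_scaleC[OF B] scaleC_scaleC power2_eq_square)
    next
      fix x assume *: "\<forall>n. 0 < s n \<longrightarrow> cinner (u n) x = 0"
      show "T x = 0"
      proof (rule E(6))
        fix n
        show "cinner (u n) x = 0"
          using * E(2)[of n] E(4)[of n] by (cases "s n = 0") auto
      qed
    qed
  next
    fix s'
    assume "decseq s' \<and> (\<forall>n. 0 \<le> s' n) \<and>
     (\<exists>u. (\<forall>m n. 0 < s' m \<and> 0 < s' n \<longrightarrow> cinner (u m) (u n) = (if m = n then 1 else 0)) \<and>
          (\<forall>n. 0 < s' n \<longrightarrow> T (T (u n)) = complex_of_real ((s' n)\<^sup>2) *\<^sub>C u n) \<and>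
          (\<forall>x. (\<forall>n. 0 < s' n \<longrightarrow> cinner (u n) x = 0) \<longrightarrow> T x = 0))"
    then obtain v where s': "decseq s'" "\<And>n. 0 \<le> s' n"
      and v: "\<And>m n. 0 < s' m \<Longrightarrow> 0 < s' n \<Longrightarrow> cinner (v m) (v n) = (if m = n then 1 else 0)"
        "\<And>n. 0 < s' n \<Longrightarrow> T (T (v n)) = complex_of_real ((s' n)\<^sup>2) *\<^sub>C v n"
        "\<And>x. (\<And>n. 0 < s' n \<Longrightarrow> cinner (v n) x = 0) \<Longrightarrow> T x = 0"
      by blast
    \<comment> \<open>The competitor's vectors are arbitrary where \<open>s' n = 0\<close>, while an
      eigensystem wants zero there.\<close>
    define v' where "v' = (\<lambda>n. if 0 < s' n then v n else 0)"
    have nv: "norm (v n) = 1" if "0 < s' n" for n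
    proof -
      have "(norm (v n))\<^sup>2 = 1" using v(1)[OF that that] by (simp flip: Re_cinner_self)
      then show ?thesis by (simp add: power2_eq_1_iff) (use norm_ge_zero[of "v n"] in linarith)
    qed
    have Tv: "T (v n) = complex_of_real (s' n) *\<^sub>C v n" if n: "0 < s' n" for n
    proof -
      \<comment> \<open>If nonzero, \<open>z\<close> would be an eigenvector of \<open>T\<close> for
        the negative number \<open>- s' n\<close>, contrary to nonnegativity.\<close>
      define z where "z = T (v n) - complex_of_real (s' n) *\<^sub>C v n"
      have "T z = - (complex_of_real (s' n) *\<^sub>C z)"
        by (simp add: z_def bounded_clinear_simps[OF B] v(2)[OF n] scaleC_diff_right scaleC_scaleC power2_eq_square)
      then have "Re (cinner z (T z)) = - s' n * (norm z)\<^sup>2"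
        by (simp add: cinner_simps cinner_self)
      then have "s' n * (norm z)\<^sup>2 \<le> 0"
        using nonneg_opD(3)[OF T, of z] by simp
      then have "z = 0" using n by (simp add: mult_le_0_iff)
      then show ?thesis by (simp add: z_def)
    qed
    have "eigensystem T s' v'"
      unfolding eigensystem_def
    proof (intro conjI allI impI)
      show "orthonormal_sys v'"
        unfolding orthonormal_sys_def v'_def using nv v(1) by auto
      show "v' n = 0 \<longleftrightarrow> s' n = 0" for n
        using s'(2)[of n] nv[of n] by (auto simp: v'_def)
      show "T (v' n) = complex_of_real (s' n) *\<^sub>C v' n" for n
        using Tv by (simp add: v'_def bounded_clinear_zero[OF B])
      show "T x = 0" if "\<forall>n. cinner (v' n) x = 0" for x
        by (rule v(3)) (use that in \<open>auto simp: v'_def split: if_splits\<close>)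
    qed (use s' in auto)
    then show "s' = s" using eigensystem_unique[OF B _ e] by blast
  qed (use E in auto)
qed

subsection \<open>The spectral theorem\<close>

lemma compact_opD: "compact_op T \<Longrightarrow> bounded_clinear T"
  by (simp add: compact_op_def)

lemma compact_op_subseq:
  assumes T: "compact_op T" and x: "\<And>n::nat. norm (x n) \<le> 1"
  obtains r y where "strict_mono r" "(\<lambda>n. T (x (r n))) \<longlonglongrightarrow> y"
proof -
  have "seq_compact (closure (T ` cball 0 1))"
    using T compact_imp_seq_compact unfolding compact_op_def by blast
  moreover have "T (x n) \<in> closure (T ` cball 0 1)" for n
    using x[of n] by (intro subsetD[OF closure_subset]) auto
  ultimately obtain l r where "strict_mono (r::nat\<Rightarrow>nat)" "((\<lambda>n. T (x n)) \<circ> r) \<longlonglongrightarrow> l"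
    by (auto elim!: seq_compactE[where f = "\<lambda>n. T (x n)"])
  then show ?thesis using that by (simp add: comp_def)
qed

text \<open>Maximise the form on the unit ball of the orthogonal complement of \<open>V\<close>,
  which \<open>T\<close> leaves invariant because \<open>V\<close> consists of eigenvectors. A
  maximising sequence is asymptotically an eigenvector, and compactness makes a subsequence
  converge. A vanishing supremum is reported by \<open>x = 0\<close>.\<close>

lemma compact_max_eigenvector:
  assumes T: "nonneg_op T" "compact_op T" and V: "\<And>v. v \<in> V \<Longrightarrow> \<exists>c. T v = c *\<^sub>C v"
  shows "\<exists>x. T x = complex_of_real (Re (cinner x (T x))) *\<^sub>C x \<and> (\<forall>v\<in>V. cinner v x = 0) \<and>
    (\<forall>y. (\<forall>v\<in>V. cinner v y = 0) \<longrightarrow> Re (cinner y (T y)) \<le> Re (cinner x (T x)) * (norm y)\<^sup>2) \<and>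
    (x = 0 \<or> norm x = 1 \<and> Re (cinner x (T x)) > 0)"
proof -
  note B = nonneg_opD(1)[OF T(1)]
  define S where "S = {y. norm y \<le> 1 \<and> (\<forall>v\<in>V. cinner v y = 0)}"
  define q where "q = (\<lambda>y. Re (cinner y (T y)))"
  define \<alpha> where "\<alpha> = Sup (q ` S)"
  obtain K where K: "\<And>x. norm (T x) \<le> norm x * K" "K > 0"
    using B bounded_linear.pos_bounded unfolding bounded_clinear_def by metis
  have qK: "q y \<le> K * (norm y)\<^sup>2" for y
  proof -
    have "q y \<le> cmod (cinner y (T y))" unfolding q_def by (rule complex_Re_le_cmod)
    also have "\<dots> \<le> norm y * (norm y * K)"
      by (rule order_trans[OF norm_cinner_le]) (intro mult_left_mono K norm_ge_zero)
    finally show ?thesis by (simp add: power2_eq_square mult_ac)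
  qed
  have bdd: "bdd_above (q ` S)"
  proof (rule bdd_aboveI2)
    fix y assume "y \<in> S"
    then have "(norm y)\<^sup>2 \<le> 1" by (simp add: S_def power_le_one)
    then show "q y \<le> K" using qK[of y] K(2) by (smt (verit) mult_left_le)
  qed
  have 0: "0 \<in> S" by (simp add: S_def)
  then have \<alpha>0: "\<alpha> \<ge> 0"
    unfolding \<alpha>_def by (intro cSup_upper2[OF _ _ bdd, of "q 0"] imageI) (auto simp: q_def)
  have q\<alpha>: "q y \<le> \<alpha> * (norm y)\<^sup>2" if y: "\<forall>v\<in>V. cinner v y = 0" for y
  proof (cases "y = 0")
    case False
    define z where "z = complex_of_real (1 / norm y) *\<^sub>C y"
    have "z \<in> S" using y False by (simp add: S_def z_def norm_scaleC norm_divide cinner_simps)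
    then have "q z \<le> \<alpha>" unfolding \<alpha>_def by (intro cSup_upper bdd) auto
    moreover have "q z = q y / (norm y)\<^sup>2"
      by (simp add: q_def z_def bounded_clinear_simps[OF B] cinner_simps power2_eq_square)
    ultimately show ?thesis using False by (simp add: field_simps)
  qed (simp add: q_def)
  have inv: "cinner v (T y) = 0" if "v \<in> V" "cinner v y = 0" for v y
  proof -
    obtain c where "T v = c *\<^sub>C v" using V \<open>v \<in> V\<close> by blast
    then show ?thesis
      using nonneg_op_symmetric[OF T(1), of v y] that(2) by (simp add: cinner_simps)
  qed
  show ?thesis
  proof (cases "\<alpha> = 0")
    case True
    then show ?thesis
      using q\<alpha> by (intro exI[of _ 0]) (auto simp: bounded_clinear_simps[OF B] q_def)
  next
    case False
    then have \<alpha>: "\<alpha> > 0" using \<alpha>0 by simp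
    have "\<exists>x\<in>S. \<alpha> - 1 / real (Suc n) < q x" for n
    proof -
      have "\<alpha> - 1 / real (Suc n) < Sup (q ` S)" by (simp add: \<alpha>_def)
      then show ?thesis using 0 by (subst (asm) less_cSup_iff[OF _ bdd]) auto
    qed
    then obtain x where xS: "\<And>n. x n \<in> S" and xq: "\<And>n. \<alpha> - 1 / real (Suc n) < q (x n)"
      by metis
    have xn: "norm (x n) \<le> 1" for n using xS[of n] by (simp add: S_def)
    obtain r y where r: "strict_mono r" and y: "(\<lambda>n. T (x (r n))) \<longlonglongrightarrow> y"
      by (rule compact_op_subseq[OF T(2), of x, OF xn])
    \<comment> \<open>Expanding the square gives a term at most \<alpha> \<open>q (x n)\<close>, one
      at most \<alpha> squared and a mixed term of minus twice \<alpha> \<open>q (x n)\<close>; what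
      remains is \<alpha> times the distance of \<open>q (x n)\<close> from the supremum.\<close>
    have "(norm (T (x n) - complex_of_real \<alpha> *\<^sub>C x n))\<^sup>2 \<le> \<alpha> * (1 / real (Suc n))" for n
    proof -
      have "(norm (T (x n)))\<^sup>2 \<le> \<alpha> * q (x n)"
        unfolding q_def
      proof (rule nonneg_cauchy_schwarz[OF T(1) \<alpha>0])
        have "\<forall>v\<in>V. cinner v (T (x n)) = 0" using xS[of n] inv by (auto simp: S_def)
        from q\<alpha>[OF this]
        show "Re (cinner (T (x n)) (T (T (x n)))) \<le> \<alpha> * (norm (T (x n)))\<^sup>2" by (simp add: q_def)
      qed
      moreover have "(norm (complex_of_real \<alpha> *\<^sub>C x n))\<^sup>2 \<le> \<alpha>\<^sup>2"
        using xn[of n] \<alpha>0 by (simp add: norm_scaleC power_mult_distrib power_le_one mult_left_le)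
      moreover have "Re (cinner (T (x n)) (complex_of_real \<alpha> *\<^sub>C x n)) = \<alpha> * q (x n)"
        by (simp add: q_def cinner_simps nonneg_op_symmetric[OF T(1)])
      moreover have "\<alpha> * (\<alpha> - q (x n)) = \<alpha>\<^sup>2 - \<alpha> * q (x n)"
        by (simp add: power2_eq_square algebra_simps)
      ultimately have "(norm (T (x n) - complex_of_real \<alpha> *\<^sub>C x n))\<^sup>2 \<le> \<alpha> * (\<alpha> - q (x n))"
        unfolding norm_sq_diff by linarith
      also have "\<dots> \<le> \<alpha> * (1 / real (Suc n))"
        using xq[of n] by (intro mult_left_mono \<alpha>0) simp
      finally show ?thesis .
    qed
    then have le: "norm (T (x n) - complex_of_real \<alpha> *\<^sub>C x n) \<le> sqrt (\<alpha> * (1 / real (Suc n)))" for n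
      by (simp add: real_le_rsqrt)
    have "(\<lambda>n. sqrt (\<alpha> * (1 / real (Suc n)))) \<longlonglongrightarrow> sqrt (\<alpha> * 0)"
      by (intro tendsto_intros LIMSEQ_Suc[OF lim_1_over_n])
    then have "(\<lambda>n. T (x n) - complex_of_real \<alpha> *\<^sub>C x n) \<longlonglongrightarrow> 0"
      by (intro Lim_null_comparison[OF always_eventually[OF allI[OF le]]]) simp
    from LIMSEQ_subseq_LIMSEQ[OF this r]
    have "(\<lambda>n. T (x (r n)) - complex_of_real \<alpha> *\<^sub>C x (r n)) \<longlonglongrightarrow> 0"
      by (simp add: comp_def)
    \<comment> \<open>Compactness controls the images only; as they differ from \<alpha> times the
      vectors by a null sequence and \<alpha> is positive, the vectors converge as well.\<close>
    from tendsto_diff[OF y this] have "(\<lambda>n. complex_of_real \<alpha> *\<^sub>C x (r n)) \<longlonglongrightarrow> y" by simp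
    from bounded_linear.tendsto[OF bounded_linear_scaleC[of "complex_of_real (1 / \<alpha>)"] this]
    have xl: "(\<lambda>n. x (r n)) \<longlonglongrightarrow> complex_of_real (1 / \<alpha>) *\<^sub>C y"
      using \<alpha> by (simp add: scaleC_scaleC)
    define z where "z = complex_of_real (1 / \<alpha>) *\<^sub>C y"
    have xz: "(\<lambda>n. x (r n)) \<longlonglongrightarrow> z" using xl by (simp add: z_def)
    have Bl: "bounded_linear T" using B by (simp add: bounded_clinear_def)
    have Txz: "(\<lambda>n. T (x (r n))) \<longlonglongrightarrow> T z" by (rule bounded_linear.tendsto[OF Bl xz])
    then have "T z = y" using y LIMSEQ_unique by blast
    then have Tz: "T z = complex_of_real \<alpha> *\<^sub>C z" using \<alpha> by (simp add: z_def scaleC_scaleC)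
    have zV: "\<forall>v\<in>V. cinner v z = 0"
    proof
      fix v assume v: "v \<in> V"
      have "(\<lambda>n. cinner v (x (r n))) \<longlonglongrightarrow> cinner v z"
        by (intro tendsto_cinner tendsto_const xz)
      moreover have "(\<lambda>n. cinner v (x (r n))) = (\<lambda>n. 0)" using xS v by (auto simp: S_def)
      ultimately show "cinner v z = 0" by (simp add: LIMSEQ_const_iff)
    qed
    have "(\<lambda>n. q (x (r n))) \<longlonglongrightarrow> q z"
      unfolding q_def by (intro tendsto_Re tendsto_cinner xz Txz)
    moreover have "(\<lambda>n. q (x (r n))) \<longlonglongrightarrow> \<alpha>"
    proof (rule tendsto_sandwich[OF _ _ _ tendsto_const])
      have "(\<lambda>n. \<alpha> - 1 / real (Suc n)) \<longlonglongrightarrow> \<alpha> - 0"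
        by (intro tendsto_intros LIMSEQ_Suc[OF lim_1_over_n])
      from LIMSEQ_subseq_LIMSEQ[OF this r]
      show "(\<lambda>n. \<alpha> - 1 / real (Suc (r n))) \<longlonglongrightarrow> \<alpha>" by (simp add: comp_def)
      show "\<forall>\<^sub>F n in sequentially. \<alpha> - 1 / real (Suc (r n)) \<le> q (x (r n))"
        using xq by (auto intro!: always_eventually less_imp_le)
      show "\<forall>\<^sub>F n in sequentially. q (x (r n)) \<le> \<alpha>"
        unfolding \<alpha>_def using xS by (auto intro!: always_eventually cSup_upper bdd)
    qed
    ultimately have qz: "q z = \<alpha>" using LIMSEQ_unique by blast
    have "q z = \<alpha> * (norm z)\<^sup>2" by (simp add: q_def Tz cinner_simps cinner_self)
    then have "(norm z)\<^sup>2 = 1" using qz \<alpha> by simp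
    then have nz: "norm z = 1" by (simp add: power2_eq_1_iff) (use norm_ge_zero[of z] in linarith)
    show ?thesis
      by (rule exI[of _ z]) (use nz qz Tz zV q\<alpha> \<alpha> in \<open>auto simp: q_def\<close>)
  qed
qed

text \<open>Greedy choice: \<open>u n\<close> maximises the form orthogonally to its predecessors,
  so the eigenvalues decrease. Compactness forces them to zero, which leaves no room for
  \<open>T\<close> on the complement of all \<open>u n\<close>.\<close>

lemma exists_eigensystem:
  assumes T: "nonneg_op T" "compact_op T"
  obtains s u where "eigensystem T s u"
proof -
  note B = nonneg_opD(1)[OF T(1)]
  define q where "q = (\<lambda>y. Re (cinner y (T y)))"
  define good where "good = (\<lambda>V x. T x = complex_of_real (q x) *\<^sub>C x \<and> (\<forall>v\<in>V. cinner v x = 0) \<and>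
    (\<forall>y. (\<forall>v\<in>V. cinner v y = 0) \<longrightarrow> q y \<le> q x * (norm y)\<^sup>2) \<and> (x = 0 \<or> norm x = 1 \<and> q x > 0))"
  define f where "f = (\<lambda>V. SOME x. good V x)"
  \<comment> \<open>Stage \<open>n\<close> remembers only the set of the vectors chosen so
    far.\<close>
  define H where "H = rec_nat {} (\<lambda>_ V. insert (f V) V)"
  have H: "H 0 = {}" "\<And>n. H (Suc n) = insert (f (H n)) (H n)" by (auto simp: H_def)
  define u where "u = (\<lambda>n. f (H n))"
  define s where "s = (\<lambda>n. q (u n))"
  have f: "good V (f V)" if "\<And>v. v \<in> V \<Longrightarrow> \<exists>c. T v = c *\<^sub>C v" for V
  proof -
    have "\<exists>x. good V x"
      unfolding good_def q_def by (rule compact_max_eigenvector[OF T that])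
    then show ?thesis unfolding f_def by (rule someI_ex)
  qed
  have inv: "\<forall>v\<in>H n. \<exists>c. T v = c *\<^sub>C v" for n
  proof (induction n)
    case (Suc n)
    then have "good (H n) (f (H n))" by (intro f) auto
    with Suc show ?case by (auto simp: H good_def)
  qed (simp add: H)
  have g: "good (H n) (u n)" for n
    unfolding u_def using inv by (intro f) auto
  have uH: "u i \<in> H n" if "i < n" for i n
    using that by (induction n) (auto simp: H u_def less_Suc_eq)
  have Hu: "\<exists>i<n. v = u i" if "v \<in> H n" for v n
    using that by (induction n) (auto simp: H u_def less_Suc_eq)
  have Tu: "T (u n) = complex_of_real (s n) *\<^sub>C u n" for n
    using g[of n] by (simp add: good_def s_def)
  have u01: "u n = 0 \<or> norm (u n) = 1 \<and> s n > 0" for n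
    using g[of n] by (simp add: good_def s_def)
  have s0: "s n = 0" if "u n = 0" for n using that by (simp add: s_def q_def)
  have snn: "s n \<ge> 0" for n unfolding s_def q_def by (rule nonneg_opD(3)[OF T(1)])
  have max: "q y \<le> s n * (norm y)\<^sup>2" if "\<And>i. i < n \<Longrightarrow> cinner (u i) y = 0" for y n
    using g[of n] that Hu unfolding good_def s_def by metis
  have orth0: "cinner (u i) (u n) = 0" if "i < n" for i n
    using g[of n] uH[OF that] by (auto simp: good_def)
  have orth: "cinner (u i) (u n) = 0" if "i \<noteq> n" for i n
    using orth0[of i n] orth0[of n i] that cinner_commute[of "u i" "u n"] by (cases "i < n") auto
  have os: "orthonormal_sys u"
    unfolding orthonormal_sys_def using u01 orth by blast
  have dec: "decseq s"
  proof (rule decseq_SucI)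
    fix n
    have "q (u (Suc n)) \<le> s n * (norm (u (Suc n)))\<^sup>2"
      by (rule max) (simp add: orth)
    also have "\<dots> \<le> s n * 1"
      using u01[of "Suc n"] snn by (intro mult_left_mono) auto
    finally show "s (Suc n) \<le> s n" by (simp add: s_def)
  qed
  \<comment> \<open>Otherwise the \<open>u n\<close> are orthonormal with mutually orthogonal images
    of norm at least \<open>e\<close>, and no subsequence of the images is Cauchy.\<close>
  have lim: "\<exists>n. s n < e" if e: "e > 0" for e
  proof (rule ccontr)
    assume "\<nexists>n. s n < e"
    then have ge: "s n \<ge> e" for n by (meson not_less)
    have n1: "norm (u n) = 1" for n using u01[of n] s0[of n] ge[of n] e by auto
    obtain r y where r: "strict_mono r" and y: "(\<lambda>n. T (u (r n))) \<longlonglongrightarrow> y"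
      using compact_op_subseq[OF T(2), of u] n1 by auto
    from LIMSEQ_imp_Cauchy[OF y] e have "\<exists>N. \<forall>m\<ge>N. \<forall>n\<ge>N. norm (T (u (r m)) - T (u (r n))) < e"
      unfolding Cauchy_iff by blast
    then obtain N where N: "\<And>m n. m \<ge> N \<Longrightarrow> n \<ge> N \<Longrightarrow> norm (T (u (r m)) - T (u (r n))) < e"
      by blast
    have ne: "r N \<noteq> r (Suc N)" using strict_monoD[OF r, of N "Suc N"] by auto
    have "(norm (T (u (r N)) - T (u (r (Suc N)))))\<^sup>2 = (s (r N))\<^sup>2 + (s (r (Suc N)))\<^sup>2"
      using n1 orth[OF ne] by (simp add: Tu norm_sq_diff norm_scaleC cinner_simps snn)
    also have "\<dots> \<ge> e\<^sup>2" using ge[of "r N"] e by (smt (verit) power_mono zero_le_power2)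
    finally show False using N[of N "Suc N"] e by (smt (verit) power_strict_mono norm_ge_zero pos2 le_Suc_eq order_refl)
  qed
  \<comment> \<open>The form at \<open>x\<close> is at most \<open>s n\<close> times the squared
    norm for every \<open>n\<close>, hence not positive; Cauchy-Schwarz for the form then gives
    \<open>T x = 0\<close>.\<close>
  have ker: "T x = 0" if x: "\<And>n. cinner (u n) x = 0" for x
  proof -
    have "q x \<le> 0"
    proof (rule field_le_epsilon)
      fix e :: real assume e: "e > 0"
      obtain n where n: "s n < e / ((norm x)\<^sup>2 + 1)" using lim[of "e / ((norm x)\<^sup>2 + 1)"] e
        by (auto simp: add_nonneg_pos)
      have "q x \<le> s n * (norm x)\<^sup>2" by (rule max) (rule x)
      also have "\<dots> \<le> s n * ((norm x)\<^sup>2 + 1)" using snn by (intro mult_left_mono) auto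
      also have "\<dots> \<le> e"
        using n by (simp add: pos_less_divide_eq[of "(norm x)\<^sup>2 + 1"] add_nonneg_pos)
      finally show "q x \<le> 0 + e" by simp
    qed
    obtain K where K: "\<And>x. norm (T x) \<le> norm x * K" "K > 0"
      using B bounded_linear.pos_bounded unfolding bounded_clinear_def by metis
    have "(norm (T x))\<^sup>2 \<le> K * q x"
      unfolding q_def
    proof (rule nonneg_cauchy_schwarz[OF T(1)])
      have "Re (cinner (T x) (T (T x))) \<le> norm (T x) * norm (T (T x))"
        using complex_Re_le_cmod norm_cinner_le order_trans by blast
      also have "\<dots> \<le> norm (T x) * (norm (T x) * K)"
        by (intro mult_left_mono K norm_ge_zero)
      finally show "Re (cinner (T x) (T (T x))) \<le> K * (norm (T x))\<^sup>2"
        by (simp add: power2_eq_square mult_ac)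
    qed (use K in simp)
    also have "\<dots> \<le> 0" using \<open>q x \<le> 0\<close> K(2) by (simp add: mult_nonneg_nonpos)
    finally show ?thesis by simp
  qed
  have "eigensystem T s u"
    unfolding eigensystem_def
    using dec snn os u01 s0 Tu ker by (metis less_irrefl)
  then show ?thesis by (rule that)
qed

section \<open>Ky Fan sums\<close>

definition kyfan :: "('h::chilbert_space \<Rightarrow> 'h) \<Rightarrow> nat \<Rightarrow> real" where
  "kyfan T k = (\<Sum>n<k. singular_values T n)"

lemma singular_values_eigensystem:
  assumes "nonneg_op T" "compact_op T"
  obtains u where "eigensystem T (singular_values T) u"
  using exists_eigensystem[OF assms] singular_values_eqI[OF assms(1)] by metis

lemma singular_values_nonneg: "nonneg_op T \<Longrightarrow> compact_op T \<Longrightarrow> 0 \<le> singular_values T n"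
  by (metis singular_values_eigensystem eigensystemD(2))

lemma singular_values_decseq: "nonneg_op T \<Longrightarrow> compact_op T \<Longrightarrow> decseq (singular_values T)"
  by (metis singular_values_eigensystem eigensystemD(1))

lemma kyfan_nonneg: "nonneg_op T \<Longrightarrow> compact_op T \<Longrightarrow> 0 \<le> kyfan T k"
  unfolding kyfan_def by (intro sum_nonneg singular_values_nonneg)

lemma kyfan_mono: "nonneg_op T \<Longrightarrow> compact_op T \<Longrightarrow> k \<le> l \<Longrightarrow> kyfan T k \<le> kyfan T l"
  unfolding kyfan_def by (intro sum_mono2) (auto intro: singular_values_nonneg)

lemma kyfan_upper:
  assumes "nonneg_op T" "compact_op T" "orthonormal_sys w" "finite I" "card I \<le> k"
  shows "(\<Sum>i\<in>I. Re (cinner (w i) (T (w i)))) \<le> kyfan T k"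
proof -
  obtain u where "eigensystem T (singular_values T) u"
    using singular_values_eigensystem[OF assms(1,2)] .
  then show ?thesis
    unfolding kyfan_def using assms by (intro eigensystem_trace_le) (auto dest: nonneg_opD(1))
qed

lemma kyfan_attained:
  assumes "nonneg_op T" "compact_op T"
  obtains u where "orthonormal_sys u" "\<And>n. T (u n) = complex_of_real (singular_values T n) *\<^sub>C u n"
    "\<And>n. u n = 0 \<longleftrightarrow> singular_values T n = 0"
    "\<And>k. kyfan T k = (\<Sum>n<k. Re (cinner (u n) (T (u n))))"
proof -
  obtain u where u: "eigensystem T (singular_values T) u"
    using singular_values_eigensystem[OF assms] .
  show ?thesis
    by (rule that[of u]) (use eigensystemD[OF u] sum_eigensystem[OF u] in \<open>auto simp: kyfan_def\<close>)
qed

lemma kyfan_0 [simp]: "kyfan T 0 = 0"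
  by (simp add: kyfan_def)

subsection \<open>Operations preserving compactness\<close>

lemma compact_closure_subset:
  fixes K :: "'a::metric_space set"
  assumes "compact K" "S \<subseteq> K"
  shows "compact (closure S)"
proof -
  have "closure S \<subseteq> K"
    using assms by (simp add: closure_minimal compact_imp_closed)
  then show ?thesis
    using compact_Int_closed[OF assms(1) closed_closure[of S]] by (simp add: Int_absorb1)
qed

lemma compact_op_plus:
  assumes S: "compact_op S" and T: "compact_op T"
  shows "compact_op (\<lambda>x. S x + T x)"
  unfolding compact_op_def
proof
  show "bounded_clinear (\<lambda>x. S x + T x)"
    by (intro bounded_clinear_plus compact_opD assms)
  let ?K = "{x + y | x y. x \<in> closure (S ` cball 0 1) \<and> y \<in> closure (T ` cball 0 1)}"
  have "compact ?K"
    using S T unfolding compact_op_def by (simp add: compact_sums)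
  moreover have "(\<lambda>x. S x + T x) ` cball 0 1 \<subseteq> ?K"
    using subsetD[OF closure_subset[of "S ` cball 0 1"]] subsetD[OF closure_subset[of "T ` cball 0 1"]]
    by blast
  ultimately show "compact (closure ((\<lambda>x. S x + T x) ` cball 0 1))"
    by (rule compact_closure_subset)
qed

lemma compact_op_compose_left:
  assumes S: "bounded_clinear S" and T: "compact_op T"
  shows "compact_op (S \<circ> T)"
  unfolding compact_op_def
proof
  show "bounded_clinear (S \<circ> T)"
    by (intro bounded_clinear_compose S compact_opD T)
  have "compact (S ` closure (T ` cball 0 1))"
    using S T unfolding compact_op_def bounded_clinear_def
    by (simp add: compact_continuous_image linear_continuous_on)
  moreover have "(S \<circ> T) ` cball 0 1 \<subseteq> S ` closure (T ` cball 0 1)"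
    unfolding image_comp[symmetric] by (intro image_mono closure_subset)
  ultimately show "compact (closure ((S \<circ> T) ` cball 0 1))"
    by (rule compact_closure_subset)
qed

lemma compact_op_scaleC: "compact_op T \<Longrightarrow> compact_op (\<lambda>x. c *\<^sub>C T x)"
  using compact_op_compose_left[OF bounded_clinear_scaleC_op[of "\<lambda>x. x" c], of T]
  by (simp add: comp_def bounded_clinear_def)

text \<open>\<open>S\<close> maps the unit ball into a ball of radius \<open>K\<close>, whose image
  under \<open>T\<close> lies in a dilate of a compact set.\<close>

lemma compact_op_compose_right:
  assumes S: "bounded_clinear S" and T: "compact_op T"
  shows "compact_op (T \<circ> S)"
  unfolding compact_op_def
proof
  note B = compact_opD[OF T]
  show "bounded_clinear (T \<circ> S)"
    by (intro bounded_clinear_compose S B)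
  obtain K where K: "\<And>x. norm (S x) \<le> norm x * K" "K > 0"
    using S bounded_linear.pos_bounded unfolding bounded_clinear_def by metis
  have "compact ((*\<^sub>C) (complex_of_real K) ` closure (T ` cball 0 1))"
    using T unfolding compact_op_def
    by (simp add: compact_continuous_image linear_continuous_on bounded_linear_scaleC)
  moreover have "(T \<circ> S) ` cball 0 1 \<subseteq> (*\<^sub>C) (complex_of_real K) ` closure (T ` cball 0 1)"
  proof clarify
    fix x :: 'a assume x: "x \<in> cball 0 1"
    define y where "y = complex_of_real (1 / K) *\<^sub>C S x"
    have "norm (S x) \<le> K" using K(1)[of x] K(2) x by (simp add: mult_left_le_one_le order_trans)
    then have "y \<in> cball 0 1" using K(2) by (simp add: y_def norm_scaleC norm_divide)
    then have "T y \<in> closure (T ` cball 0 1)"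
      by (intro subsetD[OF closure_subset] imageI)
    moreover have "(T \<circ> S) x = complex_of_real K *\<^sub>C T y"
      using K(2) by (simp add: y_def bounded_clinear_scaleC[OF B] scaleC_scaleC)
    ultimately show "(T \<circ> S) x \<in> (*\<^sub>C) (complex_of_real K) ` closure (T ` cball 0 1)" by blast
  qed
  ultimately show "compact (closure ((T \<circ> S) ` cball 0 1))"
    by (rule compact_closure_subset)
qed

lemma compact_op_const0: "compact_op (\<lambda>_. 0)"
proof -
  have "compact (closure {0 :: 'a})" by simp
  moreover have "(\<lambda>_ :: 'a. 0 :: 'a) ` cball 0 1 = {0}" by (simp add: image_constant_conv)
  ultimately show ?thesis unfolding compact_op_def using bounded_clinear_const0 by auto
qed

subsection \<open>Sums of operators\<close>

text \<open>Test both summands on the leading eigenvectors of the sum.\<close>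

lemma kyfan_plus_le:
  assumes S: "nonneg_op S" "compact_op S" and T: "nonneg_op T" "compact_op T"
  shows "kyfan (\<lambda>x. S x + T x) k \<le> kyfan S k + kyfan T k"
proof -
  obtain u where u: "orthonormal_sys u"
      "\<And>k. kyfan (\<lambda>x. S x + T x) k = (\<Sum>n<k. Re (cinner (u n) (S (u n) + T (u n))))"
    by (rule kyfan_attained[OF nonneg_op_plus[OF S(1) T(1)] compact_op_plus[OF S(2) T(2)]]) (rule that)
  show ?thesis
    unfolding u(2)
    using kyfan_upper[OF S u(1), of "{..<k}" k] kyfan_upper[OF T u(1), of "{..<k}" k]
    by (simp add: cinner_simps sum.distrib)
qed

text \<open>That \<open>x\<close> lies in the span of \<open>W\<close> is recorded as equality in
  Bessel's inequality, the form in which \<open>eigensystem_trace_ge\<close> consumes it. The system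
  is indexed by its own vectors, with value zero off \<open>W\<close>.\<close>

lemma gram_schmidt:
  fixes X :: "'h::complex_inner set"
  assumes "finite X"
  shows "\<exists>W. finite W \<and> card W \<le> card X \<and> orthonormal_sys (\<lambda>v. if v \<in> W then v else 0) \<and>
    (\<forall>x\<in>X. (\<Sum>w\<in>W. (cmod (cinner w x))\<^sup>2) = (norm x)\<^sup>2)"
  using assms
proof (induction X)
  case empty
  show ?case by (intro exI[of _ "{}"]) (simp add: orthonormal_sys_def)
next
  case (insert x X)
  then obtain W where W: "finite W" "card W \<le> card X" "orthonormal_sys (\<lambda>v. if v \<in> W then v else 0)"
    and P: "\<forall>x\<in>X. (\<Sum>w\<in>W. (cmod (cinner w x))\<^sup>2) = (norm x)\<^sup>2" by (elim exE conjE)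
  define p where "p = (\<Sum>w\<in>W. cinner w x *\<^sub>C w)"
  define y where "y = x - p"
  have ny: "(norm y)\<^sup>2 = (norm x)\<^sup>2 - (\<Sum>w\<in>W. (cmod (cinner w x))\<^sup>2)"
    using norm_sq_orthonormal_diff[OF W(3,1), of x] by (simp add: y_def p_def)
  show ?case
  proof (cases "y = 0")
    case True
    then have "(\<Sum>w\<in>W. (cmod (cinner w x))\<^sup>2) = (norm x)\<^sup>2" using ny by simp
    then show ?thesis using W P insert.hyps by (intro exI[of _ W]) auto
  next
    case False
    have yW: "cinner w y = 0" if "w \<in> W" for w
      using cinner_orthonormal_sum[OF W(3,1), of w x] that by (simp add: y_def p_def cinner_simps)
    have W1: "norm w = 1" if "w \<in> W" "w \<noteq> 0" for w
      using W(3) that unfolding orthonormal_sys_def by metis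
    define e where "e = complex_of_real (1 / norm y) *\<^sub>C y"
    have e1: "norm e = 1" using False by (simp add: e_def norm_scaleC norm_divide)
    have eW: "cinner w e = 0" if "w \<in> W" for w using yW[OF that] by (simp add: e_def cinner_simps)
    then have Ww: "cinner e w = 0" if "w \<in> W" for w using that by (subst cinner_commute) simp
    have e: "e \<notin> W" using eW[of e] e1 by (auto simp: cinner_self)
    have o: "orthonormal_sys (\<lambda>v. if v \<in> insert e W then v else 0)"
      using W(3) e1 e eW Ww unfolding orthonormal_sys_def by (auto split: if_splits)
    have yp: "cinner y p = 0"
      unfolding p_def cinner_sum_right
      by (rule sum.neutral) (use yW in \<open>auto simp: cinner_simps intro: arg_cong[OF cinner_commute, THEN trans]\<close>)
    have "cinner y x = cinner y y + cinner y p" by (simp add: y_def cinner_simps)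
    then have "cmod (cinner e x) = norm y"
      using False by (simp add: e_def cinner_simps yp cinner_self norm_mult norm_divide norm_power power2_eq_square)
    then have "(\<Sum>w\<in>insert e W. (cmod (cinner w x))\<^sup>2) = (norm x)\<^sup>2"
      using e W(1) ny by simp
    moreover have "(\<Sum>w\<in>insert e W. (cmod (cinner w z))\<^sup>2) = (norm z)\<^sup>2" if z: "z \<in> X" for z
    proof (rule antisym)
      show "(\<Sum>w\<in>insert e W. (cmod (cinner w z))\<^sup>2) \<le> (norm z)\<^sup>2"
      proof -
        have "(\<Sum>w\<in>insert e W. (cmod (cinner w z))\<^sup>2) =
            (\<Sum>w\<in>insert e W. (cmod (cinner (if w \<in> insert e W then w else 0) z))\<^sup>2)"
          by (rule sum.cong) auto
        also have "\<dots> \<le> (norm z)\<^sup>2" by (rule bessel[OF o]) (simp add: W(1))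
        finally show ?thesis .
      qed
      show "(norm z)\<^sup>2 \<le> (\<Sum>w\<in>insert e W. (cmod (cinner w z))\<^sup>2)"
        using bspec[OF P z] e W(1) by simp
    qed
    moreover have "card (insert e W) \<le> card (insert x X)"
      using W(1,2) e insert.hyps by simp
    ultimately show ?thesis using o W(1) by (intro exI[of _ "insert e W"]) auto
  qed
qed

text \<open>The first \<open>k\<close> eigenvectors of \<open>S\<close> and those of
  \<open>T\<close> together span a space of dimension at most \<open>2 * k\<close>; the trace of the
  sum over it dominates both Ky Fan sums.\<close>

lemma kyfan_plus_ge:
  assumes S: "nonneg_op S" "compact_op S" and T: "nonneg_op T" "compact_op T"
  shows "kyfan S k + kyfan T k \<le> kyfan (\<lambda>x. S x + T x) (2 * k)"
proof -
  obtain u v where u: "eigensystem S (singular_values S) u" and v: "eigensystem T (singular_values T) v"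
    using singular_values_eigensystem[OF S] singular_values_eigensystem[OF T] by metis
  obtain W where W: "finite W" "card W \<le> card (u ` {..<k} \<union> v ` {..<k})"
    and o: "orthonormal_sys (\<lambda>x. if x \<in> W then x else 0)"
    and P: "\<And>x. x \<in> u ` {..<k} \<union> v ` {..<k} \<Longrightarrow> (\<Sum>w\<in>W. (cmod (cinner w x))\<^sup>2) = (norm x)\<^sup>2"
    using gram_schmidt[of "u ` {..<k} \<union> v ` {..<k}"] by auto
  have "card (u ` {..<k} \<union> v ` {..<k}) \<le> card (u ` {..<k}) + card (v ` {..<k})"
    by (rule card_Un_le)
  also have "\<dots> \<le> 2 * k"
    using card_image_le[of "{..<k}" u] card_image_le[of "{..<k}" v] by simp
  finally have c: "card W \<le> 2 * k" using W(2) by simp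
  have "kyfan S k \<le> (\<Sum>w\<in>W. Re (cinner w (S w)))"
    unfolding kyfan_def
    by (rule eigensystem_trace_ge[OF nonneg_opD(1)[OF S(1)] u]) (use P in auto)
  moreover have "kyfan T k \<le> (\<Sum>w\<in>W. Re (cinner w (T w)))"
    unfolding kyfan_def
    by (rule eigensystem_trace_ge[OF nonneg_opD(1)[OF T(1)] v]) (use P in auto)
  moreover have "(\<Sum>w\<in>W. Re (cinner w (S w + T w))) \<le> kyfan (\<lambda>x. S x + T x) (2 * k)"
    using kyfan_upper[OF nonneg_op_plus[OF S(1) T(1)] compact_op_plus[OF S(2) T(2)] o W(1) c]
    by (simp cong: sum.cong)
  ultimately show ?thesis by (simp add: cinner_simps sum.distrib)
qed

lemma singular_values_scale:
  assumes T: "nonneg_op T" "compact_op T" and r: "r \<ge> 0"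
  shows "singular_values (\<lambda>x. complex_of_real r *\<^sub>C T x) n = r * singular_values T n"
proof -
  obtain u where u: "eigensystem T (singular_values T) u"
    using singular_values_eigensystem[OF T] .
  note E = eigensystemD[OF u]
  \<comment> \<open>For \<open>r = 0\<close> all values vanish, and an eigensystem then demands zero
    vectors.\<close>
  define v where "v = (\<lambda>n. if r = 0 then 0 else u n)"
  have "eigensystem (\<lambda>x. complex_of_real r *\<^sub>C T x) (\<lambda>n. r * singular_values T n) v"
    unfolding eigensystem_def
  proof (intro conjI allI impI)
    show "decseq (\<lambda>n. r * singular_values T n)"
      using decseqD[OF E(1)] r by (auto simp: decseq_def intro: mult_left_mono)
    show "orthonormal_sys v" using E(3) by (auto simp: v_def orthonormal_sys_def)
  qed (use E r in \<open>auto simp: v_def scaleC_scaleC split: if_splits\<close>)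
  from singular_values_eqI[OF nonneg_op_scale[OF T(1) r] this] show ?thesis by simp
qed

lemma kyfan_scale:
  assumes "nonneg_op T" "compact_op T" "r \<ge> 0"
  shows "kyfan (\<lambda>x. complex_of_real r *\<^sub>C T x) k = r * kyfan T k"
  unfolding kyfan_def by (simp add: singular_values_scale[OF assms] sum_distrib_left)

lemma nonneg_op_adjoint_compose:
  assumes A: "bounded_clinear A" and B: "bounded_clinear B"
    and adj: "\<And>x y. cinner (B x) y = cinner x (A y)"
  shows "nonneg_op (A \<circ> B)"
  by (rule nonneg_opI) (simp_all add: bounded_clinear_compose A B adj[symmetric] cinner_self)

text \<open>\<open>A\<close> is the adjoint of \<open>B\<close>, and the normalised vectors
  \<open>B (u n)\<close> carry an eigensystem of \<open>A \<circ> B\<close> to one of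
  \<open>B \<circ> A\<close>. This is the bridge between a compression of \<open>T\<close> and the
  projection sandwiched by square roots of \<open>T\<close>.\<close>

lemma singular_values_swap:
  assumes A: "bounded_clinear A" and B: "bounded_clinear B"
    and adj: "\<And>x y. cinner (B x) y = cinner x (A y)"
    and c: "compact_op (A \<circ> B)"
  shows "singular_values (B \<circ> A) = singular_values (A \<circ> B)"
proof -
  have adj': "cinner (A x) y = cinner x (B y)" for x y
    using adj[of y x] by (metis cinner_commute)
  have nn: "nonneg_op (A \<circ> B)" "nonneg_op (B \<circ> A)"
    by (intro nonneg_op_adjoint_compose A B adj adj')+
  define s where "s = singular_values (A \<circ> B)"
  obtain u where "eigensystem (A \<circ> B) s u"
    unfolding s_def by (rule singular_values_eigensystem[OF nn(1) c])
  note E = eigensystemD[OF this]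
  have ABu: "A (B (u n)) = complex_of_real (s n) *\<^sub>C u n" for n
    using E(5)[of n] by simp
  \<comment> \<open>Where \<open>s n = 0\<close>, division by zero yields the factor 0 and thus the
    required zero vector.\<close>
  define v where "v = (\<lambda>n. complex_of_real (1 / sqrt (s n)) *\<^sub>C B (u n))"
  have vv: "cinner (v i) (v j) = (if i = j then if s i = 0 then 0 else 1 else 0)" for i j
  proof -
    have "cinner (v i) (v j) = complex_of_real (s j / (sqrt (s i) * sqrt (s j))) * cinner (u i) (u j)"
      by (simp add: v_def cinner_simps adj ABu)
    also have "\<dots> = (if i = j then if s i = 0 then 0 else 1 else 0)"
    proof (cases "i = j \<and> s i \<noteq> 0")
      case True
      then have "s j / (sqrt (s i) * sqrt (s j)) = 1" using E(2)[of j] by auto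
      then show ?thesis using True E(4)[of i] by (simp add: orthonormal_sys_cinner[OF E(3)])
    next
      case False
      then show ?thesis by (auto simp: orthonormal_sys_cinner[OF E(3)])
    qed
    finally show ?thesis .
  qed
  have nv: "(norm (v i))\<^sup>2 = (if s i = 0 then 0 else 1)" for i
    using vv[of i i] by (simp flip: Re_cinner_self split: if_splits)
  have v0: "v i = 0 \<longleftrightarrow> s i = 0" for i
    using nv[of i] by (auto split: if_splits)
  have v1: "norm (v i) = 1" if "s i \<noteq> 0" for i
    using nv[of i] that by (simp add: power2_eq_1_iff) (use norm_ge_zero[of "v i"] in linarith)
  have "eigensystem (B \<circ> A) s v"
    unfolding eigensystem_def
  proof (intro conjI allI impI)
    show "orthonormal_sys v" unfolding orthonormal_sys_def using v0 v1 vv by auto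
    show "(B \<circ> A) (v n) = complex_of_real (s n) *\<^sub>C v n" for n
      by (simp add: v_def ABu bounded_clinear_scaleC[OF A] bounded_clinear_scaleC[OF B] scaleC_scaleC mult.commute)
    fix x assume x: "\<forall>n. cinner (v n) x = 0"
    have "(A \<circ> B) (A x) = 0"
    proof (rule E(6))
      fix n
      have "cinner (B (u n)) x = 0"
        using x[rule_format, of n] E(4)[of n] E(2)[of n] bounded_clinear_zero[OF B]
        by (cases "s n = 0") (auto simp: v_def cinner_simps)
      then show "cinner (u n) (A x) = 0" by (simp add: adj)
    qed
    \<comment> \<open>Moving one \<open>B\<close> across shows that the squared norm of
      \<open>B (A x)\<close> pairs \<open>A x\<close> with \<open>A (B (A x))\<close>, which has
      just been shown to vanish.\<close>
    then have "cinner (B (A x)) (B (A x)) = 0" by (simp add: adj)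
    then show "(B \<circ> A) x = 0" by (simp add: cinner_self)
  qed (use E v0 in auto)
  then show ?thesis unfolding s_def by (rule singular_values_eqI[OF nn(2)])
qed

section \<open>The cone of nonnegative operators in the weak trace ideal\<close>

lemma gamma_term_kyfan: "gamma_term T k = kyfan T k / ln (1 + real k)"
  by (simp add: gamma_term_def kyfan_def)

lemma gamma_term_nonneg: "nonneg_op T \<Longrightarrow> compact_op T \<Longrightarrow> 0 \<le> gamma_term T k"
  by (simp add: gamma_term_kyfan kyfan_nonneg)

definition L1inf_pos :: "('h::chilbert_space \<Rightarrow> 'h) set" where
  "L1inf_pos = {T. nonneg_op T \<and> T \<in> L1inf}"

lemma L1inf_posD:
  assumes "T \<in> L1inf_pos"
  shows "nonneg_op T" "compact_op T" "T \<in> L1inf"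
  using assms by (auto simp: L1inf_pos_def L1inf_def)

lemma L1inf_posI:
  assumes "nonneg_op T" "compact_op T" "\<And>k. kyfan T k \<le> K * ln (1 + real k)"
  shows "T \<in> L1inf_pos"
proof -
  have "gamma_term T k \<le> K" if "k \<in> {1..}" for k
    using assms(3)[of k] that by (simp add: gamma_term_kyfan divide_le_eq)
  then have "bdd_above (gamma_term T ` {1..})" by (rule bdd_aboveI2)
  then show ?thesis using assms by (simp add: L1inf_pos_def L1inf_def)
qed

lemma L1inf_pos_bound:
  assumes "T \<in> L1inf_pos"
  obtains K where "K \<ge> 0" "\<And>k. kyfan T k \<le> K * ln (1 + real k)" "\<And>k. gamma_term T k \<le> K"
proof -
  note D = L1inf_posD[OF assms]
  obtain K where K: "\<And>k. k \<ge> 1 \<Longrightarrow> gamma_term T k \<le> K"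
    using D(3) unfolding L1inf_def bdd_above_def by auto
  have K0: "K \<ge> 0" using K[of 1] gamma_term_nonneg[OF D(1,2), of 1] by simp
  have "gamma_term T k \<le> K" for k using K[of k] K0 by (cases "k = 0") (auto simp: gamma_term_def)
  moreover have "kyfan T k \<le> K * ln (1 + real k)" for k
    using K[of k] by (cases "k = 0") (auto simp: gamma_term_kyfan divide_le_eq)
  ultimately show ?thesis using that K0 by blast
qed

lemma L1inf_pos_plus:
  assumes "S \<in> L1inf_pos" "T \<in> L1inf_pos"
  shows "(\<lambda>x. S x + T x) \<in> L1inf_pos"
proof -
  note S = L1inf_posD[OF assms(1)] and T = L1inf_posD[OF assms(2)]
  obtain K L where K: "\<And>k. kyfan S k \<le> K * ln (1 + real k)" and L: "\<And>k. kyfan T k \<le> L * ln (1 + real k)"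
    using L1inf_pos_bound[OF assms(1)] L1inf_pos_bound[OF assms(2)] by metis
  show ?thesis
  proof (rule L1inf_posI[of _ "K + L"])
    fix k show "kyfan (\<lambda>x. S x + T x) k \<le> (K + L) * ln (1 + real k)"
      using kyfan_plus_le[OF S(1,2) T(1,2), of k] K[of k] L[of k] by (simp add: algebra_simps)
  qed (intro nonneg_op_plus compact_op_plus S T)+
qed

lemma L1inf_pos_scale:
  assumes "T \<in> L1inf_pos" "r \<ge> 0"
  shows "(\<lambda>x. complex_of_real r *\<^sub>C T x) \<in> L1inf_pos"
proof -
  note T = L1inf_posD[OF assms(1)]
  obtain K where K: "\<And>k. kyfan T k \<le> K * ln (1 + real k)"
    using L1inf_pos_bound[OF assms(1)] by metis
  show ?thesis
  proof (rule L1inf_posI[of _ "r * K"])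
    fix k show "kyfan (\<lambda>x. complex_of_real r *\<^sub>C T x) k \<le> r * K * ln (1 + real k)"
      using K[of k] assms(2) by (simp add: kyfan_scale[OF T(1,2) assms(2)] mult.assoc mult_left_mono)
  qed (intro nonneg_op_scale compact_op_scaleC T assms)+
qed

lemma kyfan_const0: "kyfan (\<lambda>_. 0 :: 'h::chilbert_space) k = 0"
  using kyfan_scale[OF nonneg_op_const0 compact_op_const0, of 0 k] by simp

lemma gamma_term_const0: "gamma_term (\<lambda>_. 0 :: 'h::chilbert_space) k = 0"
  by (simp add: gamma_term_kyfan kyfan_const0)

lemma L1inf_pos_const0: "(\<lambda>_. 0) \<in> L1inf_pos"
  by (rule L1inf_posI[of _ 0]) (auto intro: nonneg_op_const0 compact_op_const0 simp: kyfan_const0)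

lemma gamma_seq_apply:
  assumes "T \<in> L1inf_pos"
  shows "apply_bcontfun (gamma_seq T) j = gamma_term T (Suc j)"
proof -
  obtain K where K: "\<And>k. gamma_term T k \<le> K" using L1inf_pos_bound[OF assms] by metis
  have "(\<lambda>j. gamma_term T (Suc j)) \<in> bcontfun"
    by (rule bcontfun_normI[of _ K])
       (use K gamma_term_nonneg[OF L1inf_posD(1,2)[OF assms]] in auto)
  then show ?thesis by (simp add: gamma_seq_def Bcontfun_inverse)
qed

lemma D2_apply: "apply_bcontfun (D2 a) j = apply_bcontfun a (j div 2)"
proof -
  have "(\<lambda>j. apply_bcontfun a (j div 2)) \<in> bcontfun"
    by (rule bcontfun_normI[of _ "norm a"]) (simp, rule norm_bounded)
  then show ?thesis by (simp add: D2_def Bcontfun_inverse)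
qed

section \<open>Dixmier functionals\<close>

lemma DL2D:
  assumes "\<omega> \<in> DL2 TYPE('h::chilbert_space)"
  shows "\<And>a. (\<And>k. 0 \<le> apply_bcontfun a k) \<Longrightarrow> 0 \<le> blinfun_apply \<omega> a"
    "\<And>a. (\<And>k. 0 \<le> apply_bcontfun a k) \<Longrightarrow>
      ereal (blinfun_apply \<omega> a) \<le> limsup (\<lambda>k. ereal (apply_bcontfun a k))"
    "\<And>T :: 'h \<Rightarrow> 'h. T \<in> L1inf \<Longrightarrow> positive_op T \<Longrightarrow>
      blinfun_apply \<omega> (D2 (gamma_seq T)) = blinfun_apply \<omega> (gamma_seq T)"
  using assms unfolding DL2_def by blast+

lemma bounded_bcontfun_nat:
  fixes f :: "nat \<Rightarrow> real"
  assumes "\<And>k. \<bar>f k\<bar> \<le> K"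
  shows "apply_bcontfun (Bcontfun f) = f"
proof -
  have "f \<in> bcontfun" by (rule bcontfun_normI[of _ K]) (use assms in auto)
  then show ?thesis by (simp add: Bcontfun_inverse)
qed

text \<open>The bound by the upper limit is granted for nonnegative sequences only, so it is applied
  to the absolute values; positivity then squeezes \<open>a\<close> between them and their
  negatives.\<close>

lemma DL2_null_sequence:
  assumes \<omega>: "\<omega> \<in> DL2 TYPE('h::chilbert_space)" and a: "apply_bcontfun a \<longlonglongrightarrow> 0"
  shows "blinfun_apply \<omega> a = 0"
proof -
  define b where "b = Bcontfun (\<lambda>k. \<bar>apply_bcontfun a k\<bar>)"
  have b: "apply_bcontfun b = (\<lambda>k. \<bar>apply_bcontfun a k\<bar>)"
    unfolding b_def using norm_bounded[of a] by (intro bounded_bcontfun_nat[of _ "norm a"]) simp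
  have "(\<lambda>k. ereal (apply_bcontfun b k)) \<longlonglongrightarrow> ereal 0"
    unfolding b using tendsto_rabs[OF a] by (intro tendsto_ereal) simp
  then have "limsup (\<lambda>k. ereal (apply_bcontfun b k)) = ereal 0"
    by (intro lim_imp_Limsup) simp_all
  then have "blinfun_apply \<omega> b \<le> 0"
    using DL2D(2)[OF \<omega>, of b] by (simp add: b)
  moreover have "0 \<le> blinfun_apply \<omega> (b - a)" "0 \<le> blinfun_apply \<omega> (b + a)"
    by (rule DL2D(1)[OF \<omega>]; simp add: b abs_if)+
  ultimately show ?thesis by (simp add: blinfun.add_right blinfun.diff_right)
qed

lemma DL2_mono_asymp:
  assumes \<omega>: "\<omega> \<in> DL2 TYPE('h::chilbert_space)" and e: "e \<longlonglongrightarrow> 0"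
    and le: "\<And>k. apply_bcontfun a k \<le> apply_bcontfun b k + e k"
  shows "blinfun_apply \<omega> a \<le> blinfun_apply \<omega> b"
proof -
  obtain K where K: "\<And>k. \<bar>e k\<bar> \<le> K"
    using e convergent_imp_bounded[of e] unfolding bounded_iff by auto
  define c where "c = Bcontfun e"
  have c: "apply_bcontfun c = e" unfolding c_def by (rule bounded_bcontfun_nat[OF K])
  have "blinfun_apply \<omega> c = 0" by (rule DL2_null_sequence[OF \<omega>]) (simp add: c e)
  moreover have "0 \<le> blinfun_apply \<omega> (b + c - a)"
    by (rule DL2D(1)[OF \<omega>]) (use le in \<open>simp add: c\<close>)
  ultimately show ?thesis by (simp add: blinfun.add_right blinfun.diff_right)
qed

text \<open>Invariance is postulated for nonzero operators; the zero operator has the zero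
  sequence.\<close>

lemma DL2_D2_gamma:
  fixes T :: "'h::chilbert_space \<Rightarrow> 'h"
  assumes \<omega>: "\<omega> \<in> DL2 TYPE('h)" and T: "T \<in> L1inf_pos"
  shows "blinfun_apply \<omega> (D2 (gamma_seq T)) = blinfun_apply \<omega> (gamma_seq T)"
proof (cases "T = (\<lambda>_. 0)")
  case True
  have "D2 (gamma_seq T) = gamma_seq T"
    by (rule bcontfun_eqI) (simp add: D2_apply True gamma_seq_apply[OF L1inf_pos_const0] gamma_term_const0)
  then show ?thesis by simp
next
  case False
  then show ?thesis using L1inf_posD[OF T] by (intro DL2D(3)[OF \<omega>]) (auto simp: positive_op_iff)
qed

text \<open>Additivity rests on \<open>S\<^sub>k(S) + S\<^sub>k(T) \<le> S\<^sub>2\<^sub>k(S + T)\<close> for the Ky Fan sums: up to a null sequence,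
  dilating the left-hand side by 2 produces the index of the right-hand side.\<close>

lemma DL2_gamma_plus:
  fixes S T :: "'h::chilbert_space \<Rightarrow> 'h"
  assumes \<omega>: "\<omega> \<in> DL2 TYPE('h)" and ST: "S \<in> L1inf_pos" "T \<in> L1inf_pos"
  shows "blinfun_apply \<omega> (gamma_seq (\<lambda>x. S x + T x)) =
    blinfun_apply \<omega> (gamma_seq S) + blinfun_apply \<omega> (gamma_seq T)"
proof (rule antisym)
  note X = L1inf_pos_plus[OF ST]
  note S = L1inf_posD[OF ST(1)] and T = L1inf_posD[OF ST(2)] and XD = L1inf_posD[OF X]
  have "blinfun_apply \<omega> (gamma_seq (\<lambda>x. S x + T x)) \<le> blinfun_apply \<omega> (gamma_seq S + gamma_seq T)"
  proof (rule DL2_mono_asymp[OF \<omega> tendsto_const])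
    fix k
    show "apply_bcontfun (gamma_seq (\<lambda>x. S x + T x)) k \<le> apply_bcontfun (gamma_seq S + gamma_seq T) k + 0"
      using kyfan_plus_le[OF S(1,2) T(1,2), of "Suc k"]
      by (simp add: gamma_seq_apply ST X gamma_term_kyfan divide_right_mono add_divide_distrib[symmetric])
  qed
  then show "blinfun_apply \<omega> (gamma_seq (\<lambda>x. S x + T x)) \<le>
    blinfun_apply \<omega> (gamma_seq S) + blinfun_apply \<omega> (gamma_seq T)"
    by (simp add: blinfun.add_right)
  let ?X = "\<lambda>x. S x + T x"
  obtain K where K: "K \<ge> 0" "\<And>k. gamma_term ?X k \<le> K"
    using L1inf_pos_bound[OF X] by metis
  define s0 where "s0 = singular_values ?X 0"
  have s0: "s0 \<ge> 0" unfolding s0_def by (rule singular_values_nonneg[OF XD(1,2)])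
  \<comment> \<open>Two losses with \<open>k = j + 1\<close>: replacing \<open>ln (1 + k)\<close> by
    the logarithm at half the index costs at most \<open>ln 2\<close> times the bound
    \<open>K\<close>, and twice the halved index may exceed \<open>k\<close> by one, which costs one
    more singular value, at most \<open>s0\<close>.\<close>
  define e where "e = (\<lambda>j. (K * ln 2 + s0) / ln (1 + (real j + 1) / 2))"
  have "blinfun_apply \<omega> (D2 (gamma_seq S) + D2 (gamma_seq T)) \<le> blinfun_apply \<omega> (gamma_seq ?X)"
  proof (rule DL2_mono_asymp[OF \<omega>, of e])
    show "e \<longlonglongrightarrow> 0" unfolding e_def by real_asymp
    fix j
    define k where "k = Suc j"
    \<comment> \<open>In 1-based counting \<open>D2\<close> reads index \<open>k\<close> at the
      ceiling of \<open>k / 2\<close>, which is \<open>l\<close>.\<close>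
    define l where "l = Suc (j div 2)"
    have "k \<le> 2 * l" unfolding l_def k_def by presburger
    then have l: "real l \<ge> real k / 2" "2 * l \<le> Suc k" by (simp_all add: l_def k_def)
    have lnl: "ln (1 + real l) > 0" by (simp add: l_def)
    have ln2: "ln (1 + real k) - ln 2 \<le> ln (1 + real l)"
    proof -
      have "ln (1 + real k) - ln 2 = ln ((1 + real k) / 2)" by (simp add: ln_div)
      also have "\<dots> \<le> ln (1 + real l)" using l by simp
      finally show ?thesis .
    qed
    have lnk: "ln (1 + real k) > 0" by (simp add: k_def)
    have "kyfan S l + kyfan T l \<le> kyfan ?X (2 * l)"
      by (rule kyfan_plus_ge[OF S(1,2) T(1,2)])
    also have "\<dots> \<le> kyfan ?X (Suc k)" by (rule kyfan_mono[OF XD(1,2) l(2)])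
    also have "\<dots> \<le> kyfan ?X k + s0"
      using decseqD[OF singular_values_decseq[OF XD(1,2)], of 0 k] by (simp add: kyfan_def s0_def)
    also have "kyfan ?X k = gamma_term ?X k * ln (1 + real k)"
      using lnk by (simp add: gamma_term_kyfan)
    also have "\<dots> \<le> gamma_term ?X k * ln (1 + real l) + gamma_term ?X k * ln 2"
      using mult_left_mono[OF ln2 gamma_term_nonneg[OF XD(1,2), of k]] by (simp add: algebra_simps)
    also have "\<dots> \<le> gamma_term ?X k * ln (1 + real l) + K * ln 2"
      using K(2)[of k] by (simp add: mult_right_mono)
    finally have "kyfan S l + kyfan T l \<le> gamma_term ?X k * ln (1 + real l) + (K * ln 2 + s0)" by simp
    then have "(kyfan S l + kyfan T l) / ln (1 + real l) \<le>
        (gamma_term ?X k * ln (1 + real l) + (K * ln 2 + s0)) / ln (1 + real l)"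
      using lnl by (intro divide_right_mono) auto
    then have "gamma_term S l + gamma_term T l \<le> gamma_term ?X k + (K * ln 2 + s0) / ln (1 + real l)"
      using lnl by (simp add: gamma_term_kyfan[of S] gamma_term_kyfan[of T] add_divide_distrib)
    also have "(K * ln 2 + s0) / ln (1 + real l) \<le> e j"
    proof -
      have "ln (1 + (real j + 1) / 2) \<le> ln (1 + real l)"
        using l(1) by (intro ln_mono) (auto simp: k_def intro!: add_pos_nonneg)
      moreover have "0 < ln (1 + (real j + 1) / 2)" by (intro ln_gt_zero) simp
      ultimately show ?thesis
        unfolding e_def using K(1) s0 lnl by (intro divide_left_mono mult_pos_pos) auto
    qed
    finally show "apply_bcontfun (D2 (gamma_seq S) + D2 (gamma_seq T)) j \<le> apply_bcontfun (gamma_seq ?X) j + e j"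
      by (simp add: D2_apply gamma_seq_apply ST X k_def l_def)
  qed
  then show "blinfun_apply \<omega> (gamma_seq S) + blinfun_apply \<omega> (gamma_seq T) \<le> blinfun_apply \<omega> (gamma_seq ?X)"
    by (simp add: blinfun.add_right DL2_D2_gamma[OF \<omega>] ST)
qed

lemma DL2_gamma_scale:
  fixes T :: "'h::chilbert_space \<Rightarrow> 'h"
  assumes T: "T \<in> L1inf_pos" and r: "r \<ge> 0"
  shows "blinfun_apply \<omega> (gamma_seq (\<lambda>x. complex_of_real r *\<^sub>C T x)) = r * blinfun_apply \<omega> (gamma_seq T)"
proof -
  have "gamma_seq (\<lambda>x. complex_of_real r *\<^sub>C T x) = r *\<^sub>R gamma_seq T"
    by (rule bcontfun_eqI)
       (simp add: gamma_seq_apply T r L1inf_pos_scale gamma_term_kyfan kyfan_scale L1inf_posD[OF T])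
  then show ?thesis by (simp add: blinfun.scaleR_right)
qed

subsection \<open>Linear extension from the positive cone\<close>

lemma sum_fun_apply: "(\<Sum>i\<in>I. f i) x = (\<Sum>i\<in>I. f i x)"
  by (induction I rule: infinite_finite_induct) auto

text \<open>Linear algebra is done in the space of all functions, which contains the cone; the
  functional found there is then restricted to \<open>L1inf\<close>.\<close>

lemma vector_space_operators: "vector_space (\<lambda>(c :: complex) (f :: 'a \<Rightarrow> 'h::complex_inner) x. c *\<^sub>C f x)"
  by standard (auto simp: scaleC_add_right scaleC_add_left scaleC_scaleC)

lemma cone_sum:
  fixes \<tau> :: "('h::chilbert_space \<Rightarrow> 'h) \<Rightarrow> real"
  assumes add: "\<And>S T. S \<in> L1inf_pos \<Longrightarrow> T \<in> L1inf_pos \<Longrightarrow> \<tau> (\<lambda>x. S x + T x) = \<tau> S + \<tau> T"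
    and scale: "\<And>r T. T \<in> L1inf_pos \<Longrightarrow> r \<ge> 0 \<Longrightarrow> \<tau> (\<lambda>x. complex_of_real r *\<^sub>C T x) = r * \<tau> T"
    and t: "finite t" "t \<subseteq> L1inf_pos" and p: "\<And>b. b \<in> t \<Longrightarrow> p b \<ge> 0"
  shows "(\<lambda>x. \<Sum>b\<in>t. complex_of_real (p b) *\<^sub>C b x) \<in> L1inf_pos \<and>
    \<tau> (\<lambda>x. \<Sum>b\<in>t. complex_of_real (p b) *\<^sub>C b x) = (\<Sum>b\<in>t. p b * \<tau> b)"
  using t p
proof (induction t)
  case empty
  have "\<tau> (\<lambda>x. 0) = 0" using scale[OF L1inf_pos_const0, of 0] by simp
  then show ?case by (simp add: L1inf_pos_const0)
next
  case (insert b t)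
  then have b: "b \<in> L1inf_pos" "p b \<ge> 0" by auto
  note sc = L1inf_pos_scale[OF b]
  have IH: "(\<lambda>x. \<Sum>b\<in>t. complex_of_real (p b) *\<^sub>C b x) \<in> L1inf_pos"
    "\<tau> (\<lambda>x. \<Sum>b\<in>t. complex_of_real (p b) *\<^sub>C b x) = (\<Sum>b\<in>t. p b * \<tau> b)" using insert by auto
  show ?case
    using add[OF sc IH(1)] L1inf_pos_plus[OF sc IH(1)] insert.hyps scale[OF b] IH(2) by simp
qed

text \<open>Coefficients of mixed sign lead out of the cone; moving the negative parts to the other
  side leaves an identity \<open>X + N = P\<close> between cone elements. It is verified on the
  forms, which are real.\<close>

lemma cone_real_combination:
  fixes \<tau> :: "('h::chilbert_space \<Rightarrow> 'h) \<Rightarrow> real"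
  assumes add: "\<And>S T. S \<in> L1inf_pos \<Longrightarrow> T \<in> L1inf_pos \<Longrightarrow> \<tau> (\<lambda>x. S x + T x) = \<tau> S + \<tau> T"
    and scale: "\<And>r T. T \<in> L1inf_pos \<Longrightarrow> r \<ge> 0 \<Longrightarrow> \<tau> (\<lambda>x. complex_of_real r *\<^sub>C T x) = r * \<tau> T"
    and t: "finite t" "t \<subseteq> L1inf_pos" and X: "X \<in> L1inf_pos"
    and eq: "\<And>x. Re (cinner x (X x)) = (\<Sum>b\<in>t. c b * Re (cinner x (b x)))"
  shows "\<tau> X = (\<Sum>b\<in>t. c b * \<tau> b)"
proof -
  define P where "P = (\<lambda>x. \<Sum>b\<in>t. complex_of_real (max 0 (c b)) *\<^sub>C b x)"
  define N where "N = (\<lambda>x. \<Sum>b\<in>t. complex_of_real (max 0 (- c b)) *\<^sub>C b x)"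
  have "P \<in> L1inf_pos \<and> \<tau> P = (\<Sum>b\<in>t. max 0 (c b) * \<tau> b)"
    unfolding P_def by (rule cone_sum[OF add scale t]) (simp_all add: le_max_iff_disj)
  then have P: "P \<in> L1inf_pos" "\<tau> P = (\<Sum>b\<in>t. max 0 (c b) * \<tau> b)" by blast+
  have "N \<in> L1inf_pos \<and> \<tau> N = (\<Sum>b\<in>t. max 0 (- c b) * \<tau> b)"
    unfolding N_def by (rule cone_sum[OF add scale t]) (simp_all add: le_max_iff_disj)
  then have N: "N \<in> L1inf_pos" "\<tau> N = (\<Sum>b\<in>t. max 0 (- c b) * \<tau> b)" by blast+
  have mx: "max 0 r - max 0 (- r) = r" for r :: real by auto
  have mx': "r + max 0 (- r) = max 0 r" for r :: real by auto
  have "(\<lambda>x. X x + N x) = P"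
  proof (rule quadratic_form_ext)
    note XN = nonneg_opD[OF L1inf_posD(1)[OF L1inf_pos_plus[OF X N(1)]]]
      and P' = nonneg_opD[OF L1inf_posD(1)[OF P(1)]]
    show "bounded_clinear (\<lambda>x. X x + N x)" "bounded_clinear P" using XN P' by auto
    fix x
    have "(\<Sum>b\<in>t. c b * Re (cinner x (b x))) + (\<Sum>b\<in>t. max 0 (- c b) * Re (cinner x (b x))) =
       (\<Sum>b\<in>t. max 0 (c b) * Re (cinner x (b x)))"
      unfolding sum.distrib[symmetric] distrib_right[symmetric]
      by (simp add: mx')
    then have "Re (cinner x (X x + N x)) = Re (cinner x (P x))"
      by (simp add: eq P_def N_def cinner_sum_right cinner_simps)
    then show "cinner x (X x + N x) = cinner x (P x)"
      using XN(2)[of x] P'(2)[of x] by (simp add: complex_eq_iff)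
  qed
  then have "\<tau> X + \<tau> N = \<tau> P" using add[OF X N(1)] by simp
  then have "\<tau> X = (\<Sum>b\<in>t. (max 0 (c b) - max 0 (- c b)) * \<tau> b)"
    by (simp add: P N sum_subtractf left_diff_distrib)
  then show ?thesis by (simp only: mx)
qed

text \<open>Prescribe \<tau> on a maximal linearly independent subset of the cone and extend
  linearly. The point is that the extension reproduces \<tau> on the rest of the cone, and this is
  where additivity and homogeneity enter.\<close>

lemma cone_linear_extension:
  fixes \<tau> :: "('h::chilbert_space \<Rightarrow> 'h) \<Rightarrow> real"
  assumes add: "\<And>S T. S \<in> L1inf_pos \<Longrightarrow> T \<in> L1inf_pos \<Longrightarrow> \<tau> (\<lambda>x. S x + T x) = \<tau> S + \<tau> T"
    and scale: "\<And>r T. T \<in> L1inf_pos \<Longrightarrow> r \<ge> 0 \<Longrightarrow> \<tau> (\<lambda>x. complex_of_real r *\<^sub>C T x) = r * \<tau> T"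
  shows "\<exists>\<phi>. (\<forall>S R. \<phi> (\<lambda>x. S x + R x) = \<phi> S + \<phi> R) \<and> (\<forall>a S. \<phi> (\<lambda>x. a *\<^sub>C S x) = a * \<phi> S) \<and>
    (\<forall>S\<in>L1inf_pos. \<phi> S = complex_of_real (\<tau> S))"
proof -
  let ?s = "\<lambda>(c :: complex) (f :: 'h \<Rightarrow> 'h) x. c *\<^sub>C f x"
  interpret V: vector_space ?s by (rule vector_space_operators)
  interpret W: vector_space "(*) :: complex \<Rightarrow> complex \<Rightarrow> complex"
    by standard (auto simp: algebra_simps)
  interpret VW: vector_space_pair ?s "(*) :: complex \<Rightarrow> complex \<Rightarrow> complex" ..
  obtain B where B: "B \<subseteq> L1inf_pos" "V.independent B" "L1inf_pos \<subseteq> V.span B"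
    using V.maximal_independent_subset[of L1inf_pos] by metis
  obtain g where g: "Vector_Spaces.linear ?s (*) g" "\<And>b. b \<in> B \<Longrightarrow> g b = complex_of_real (\<tau> b)"
    using VW.linear_independent_extend[OF B(2), of "\<lambda>b. complex_of_real (\<tau> b)"] by auto
  interpret g: Vector_Spaces.linear ?s "(*) :: complex \<Rightarrow> complex \<Rightarrow> complex" g by (rule g(1))
  show ?thesis
  proof (intro exI[of _ g] conjI allI ballI)
    show "g (\<lambda>x. S x + R x) = g S + g R" for S R
      using g.add[of S R] by (simp add: plus_fun_def)
    show "g (\<lambda>x. a *\<^sub>C S x) = a * g S" for a S
      by (rule g.scale)
    fix X :: "'h \<Rightarrow> 'h" assume X: "X \<in> L1inf_pos"
    then have "X \<in> V.span B" using B by auto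
    then obtain t c where t: "finite t" "t \<subseteq> B" and Xc: "X = (\<Sum>b\<in>t. ?s (c b) b)"
      unfolding V.span_explicit by auto
    have tC: "t \<subseteq> L1inf_pos" using t B by auto
    have form: "cinner x (X x) = (\<Sum>b\<in>t. c b * cinner x (b x))" for x
      by (simp add: Xc sum_fun_apply cinner_sum_right cinner_simps)
    have im: "Im (cinner x (b x)) = 0" if "b \<in> t" for b x
      using that tC nonneg_opD(2)[OF L1inf_posD(1)] by blast
    have "\<tau> X = (\<Sum>b\<in>t. Re (c b) * \<tau> b)"
    proof (rule cone_real_combination[OF add scale t(1) tC X])
      fix x
      show "Re (cinner x (X x)) = (\<Sum>b\<in>t. Re (c b) * Re (cinner x (b x)))"
        unfolding form Re_sum by (rule sum.cong) (auto simp: im)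
    qed
    \<comment> \<open>All forms are real, so the imaginary parts of the coefficients represent the
      zero operator.\<close>
    moreover have "\<tau> (\<lambda>_. 0) = (\<Sum>b\<in>t. Im (c b) * \<tau> b)"
    proof (rule cone_real_combination[OF add scale t(1) tC L1inf_pos_const0])
      fix x
      have "Im (cinner x (X x)) = (\<Sum>b\<in>t. Im (c b) * Re (cinner x (b x)))"
        unfolding form Im_sum by (rule sum.cong) (auto simp: im)
      then show "Re (cinner x 0) = (\<Sum>b\<in>t. Im (c b) * Re (cinner x (b x)))"
        using nonneg_opD(2)[OF L1inf_posD(1)[OF X], of x] by simp
    qed
    moreover have "\<tau> (\<lambda>_. 0) = 0" using scale[OF L1inf_pos_const0, of 0] by simp
    moreover have "g X = (\<Sum>b\<in>t. c b * complex_of_real (\<tau> b))"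
      unfolding Xc g.sum by (rule sum.cong[OF refl]) (use t g(2) in \<open>auto simp: g.scale\<close>)
    ultimately show "g X = complex_of_real (\<tau> X)"
      by (simp add: complex_eq_iff)
  qed
qed

text \<open>The linear extension provides a functional as the description requires. Its value at a
  nonzero \<open>T\<close> is prescribed, and homogeneity with factor 0 settles the zero
  operator.\<close>

lemma dixmier_trace_nonneg:
  fixes T :: "'h::chilbert_space \<Rightarrow> 'h"
  assumes \<omega>: "\<omega> \<in> DL2 TYPE('h)" and T: "T \<in> L1inf_pos"
  shows "dixmier_trace \<omega> T = complex_of_real (blinfun_apply \<omega> (gamma_seq T))"
proof -
  define \<tau> where "\<tau> = (\<lambda>T :: 'h \<Rightarrow> 'h. blinfun_apply \<omega> (gamma_seq T))"
  have "\<exists>\<phi>. (\<forall>S R. \<phi> (\<lambda>x. S x + R x) = \<phi> S + \<phi> R) \<and> (\<forall>a S. \<phi> (\<lambda>x. a *\<^sub>C S x) = a * \<phi> S) \<and>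
    (\<forall>S\<in>L1inf_pos. \<phi> S = complex_of_real (\<tau> S))"
    unfolding \<tau>_def by (intro cone_linear_extension DL2_gamma_plus[OF \<omega>] DL2_gamma_scale)
  then obtain \<phi> where \<phi>: "\<And>S R. \<phi> (\<lambda>x. S x + R x) = \<phi> S + \<phi> R" "\<And>a S. \<phi> (\<lambda>x. a *\<^sub>C S x) = a * \<phi> S"
    "\<And>S. S \<in> L1inf_pos \<Longrightarrow> \<phi> S = complex_of_real (\<tau> S)"
    by blast
  show ?thesis
    unfolding dixmier_trace_def
  proof (rule the_equality)
    show "\<exists>\<phi> :: ('h \<Rightarrow> 'h) \<Rightarrow> complex.
     (\<forall>S\<in>L1inf. \<forall>R\<in>L1inf. \<phi> (\<lambda>x. S x + R x) = \<phi> S + \<phi> R) \<and>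
     (\<forall>a. \<forall>S\<in>L1inf. \<phi> (\<lambda>x. a *\<^sub>C S x) = a * \<phi> S) \<and>
     (\<forall>S\<in>L1inf. positive_op S \<longrightarrow> \<phi> S = complex_of_real (blinfun_apply \<omega> (gamma_seq S))) \<and>
     complex_of_real (blinfun_apply \<omega> (gamma_seq T)) = \<phi> T"
      using \<phi>(3)[OF T] by (intro exI[of _ \<phi>]) (auto simp: \<phi> \<tau>_def L1inf_pos_def positive_op_iff)
  next
    fix c
    assume "\<exists>\<phi> :: ('h \<Rightarrow> 'h) \<Rightarrow> complex.
     (\<forall>S\<in>L1inf. \<forall>R\<in>L1inf. \<phi> (\<lambda>x. S x + R x) = \<phi> S + \<phi> R) \<and>
     (\<forall>a. \<forall>S\<in>L1inf. \<phi> (\<lambda>x. a *\<^sub>C S x) = a * \<phi> S) \<and>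
     (\<forall>S\<in>L1inf. positive_op S \<longrightarrow> \<phi> S = complex_of_real (blinfun_apply \<omega> (gamma_seq S))) \<and>
     c = \<phi> T"
    then obtain \<psi> :: "('h \<Rightarrow> 'h) \<Rightarrow> complex" where
      \<psi>: "\<And>a S. S \<in> L1inf \<Longrightarrow> \<psi> (\<lambda>x. a *\<^sub>C S x) = a * \<psi> S"
      "\<And>S. S \<in> L1inf \<Longrightarrow> positive_op S \<Longrightarrow> \<psi> S = complex_of_real (blinfun_apply \<omega> (gamma_seq S))"
      "c = \<psi> T" by blast
    show "c = complex_of_real (blinfun_apply \<omega> (gamma_seq T))"
    proof (cases "T = (\<lambda>_. 0)")
      case True
      have "\<psi> T = 0" using \<psi>(1)[OF L1inf_posD(3)[OF T], of 0] by (simp add: True)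
      moreover have "gamma_seq T = 0"
        by (rule bcontfun_eqI) (simp add: True gamma_seq_apply[OF L1inf_pos_const0] gamma_term_const0)
      ultimately show ?thesis by (simp add: \<psi>(3) blinfun.zero_right)
    next
      case False
      then show ?thesis using L1inf_posD[OF T] by (simp add: \<psi>(2,3) positive_op_iff)
    qed
  qed
qed

subsection \<open>Existence of Dixmier functionals\<close>

text \<open>Banach-Alaoglu by Tychonoff: functionals bounded by the norm live in a compact product
  of intervals. The filter \<open>G\<close> converges to the cluster point at every \<open>a\<close>
  and inherits eventual properties of the sequence, so identities and bounds pass to the
  limit.\<close>

lemma cluster_point_functional:
  fixes \<phi> :: "nat \<Rightarrow> linf_seq \<Rightarrow> real"
  assumes "\<And>j a. \<bar>\<phi> j a\<bar> \<le> norm a"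
  obtains f G where "G \<noteq> bot" "\<And>a. ((\<lambda>\<psi>. \<psi> a) \<longlongrightarrow> f a) G"
    "\<And>P. eventually (\<lambda>j. P (\<phi> j)) sequentially \<Longrightarrow> eventually P G"
proof -
  define K where "K = (\<Pi>\<^sub>E a\<in>UNIV. {- norm a .. norm (a :: linf_seq)})"
  have "compactin (product_topology (\<lambda>_. euclidean) UNIV) K"
    unfolding K_def by (subst compactin_PiE) simp
  then have K: "compact K" by (simp add: euclidean_product_topology)
  have "\<phi> j \<in> K" for j
    unfolding K_def using assms[of j] by (auto simp: abs_le_iff minus_le_iff)
  then have "eventually (\<lambda>\<psi>. \<psi> \<in> K) (filtermap \<phi> sequentially)"
    by (simp add: eventually_filtermap)
  moreover have "filtermap \<phi> sequentially \<noteq> bot" by (simp add: filtermap_bot_iff)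
  ultimately obtain f where f: "inf (nhds f) (filtermap \<phi> sequentially) \<noteq> bot"
    using K unfolding compact_filter by blast
  show ?thesis
  proof (rule that[OF f])
    fix a
    have "continuous_on UNIV (\<lambda>\<psi> :: linf_seq \<Rightarrow> real. \<psi> a)"
      using continuous_map_product_projection[of a UNIV "\<lambda>_. euclidean :: real topology"]
      by (simp add: euclidean_product_topology)
    then have "((\<lambda>\<psi>. \<psi> a) \<longlongrightarrow> f a) (at f)"
      unfolding continuous_on_def by blast
    then have "((\<lambda>\<psi>. \<psi> a) \<longlongrightarrow> f a) (nhds f)"
      using tendsto_at_iff_tendsto_nhds[of "\<lambda>\<psi>. \<psi> a" f] by simp
    then show "((\<lambda>\<psi>. \<psi> a) \<longlongrightarrow> f a) (inf (nhds f) (filtermap \<phi> sequentially))"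
      by (rule tendsto_mono[OF inf_le1])
  next
    fix P assume "eventually (\<lambda>j. P (\<phi> j)) sequentially"
    then have "eventually P (filtermap \<phi> sequentially)" by (simp add: eventually_filtermap)
    then show "eventually P (inf (nhds f) (filtermap \<phi> sequentially))"
      by (rule filter_leD[OF inf_le2])
  qed
qed

text \<open>Averaging along a dyadic orbit makes the cluster points invariant under \<^const>\<open>D2\<close>. With the
  index shift of \<^typ>\<open>linf_seq\<close>, the index \<open>2\<^sup>i k\<close> becomes \<open>2\<^sup>i k - 1\<close>.\<close>

definition dyadic_mean :: "(nat \<Rightarrow> nat) \<Rightarrow> nat \<Rightarrow> linf_seq \<Rightarrow> real" where
  "dyadic_mean k j a = (\<Sum>i<Suc j. apply_bcontfun a (2 ^ i * k j - 1)) / real (Suc j)"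

lemma dyadic_mean_ge:
  assumes "\<And>i. i \<le> j \<Longrightarrow> c \<le> apply_bcontfun a (2 ^ i * k j - 1)"
  shows "c \<le> dyadic_mean k j a"
proof -
  have "(\<Sum>i<Suc j. c) \<le> (\<Sum>i<Suc j. apply_bcontfun a (2 ^ i * k j - 1))"
    by (rule sum_mono) (use assms in auto)
  then show ?thesis by (simp add: dyadic_mean_def field_simps)
qed

lemma dyadic_mean_le:
  assumes "\<And>i. i \<le> j \<Longrightarrow> apply_bcontfun a (2 ^ i * k j - 1) \<le> c"
  shows "dyadic_mean k j a \<le> c"
proof -
  have "(\<Sum>i<Suc j. apply_bcontfun a (2 ^ i * k j - 1)) \<le> (\<Sum>i<Suc j. c)"
    by (rule sum_mono) (use assms in auto)
  then show ?thesis by (simp add: dyadic_mean_def field_simps)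
qed

lemma abs_apply_bcontfun_le: "\<bar>apply_bcontfun (a :: linf_seq) n\<bar> \<le> norm a"
  using norm_bounded[of a n] by simp

lemma dyadic_mean_abs_le: "\<bar>dyadic_mean k j a\<bar> \<le> norm a"
proof -
  have "- norm a \<le> dyadic_mean k j a"
    by (rule dyadic_mean_ge) (use abs_apply_bcontfun_le[of a] in \<open>auto simp: abs_le_iff minus_le_iff\<close>)
  moreover have "dyadic_mean k j a \<le> norm a"
    by (rule dyadic_mean_le) (use abs_apply_bcontfun_le[of a] in \<open>auto simp: abs_le_iff\<close>)
  ultimately show ?thesis by simp
qed

text \<open>Halving the index moves the orbit back by one step, so the two sums differ in their end
  terms only.\<close>

lemma dyadic_mean_D2:
  assumes k: "k j \<ge> 1"
  shows "\<bar>dyadic_mean k j (D2 a) - dyadic_mean k j a\<bar> \<le> 2 * norm a / real (Suc j)"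
proof -
  let ?a = "apply_bcontfun a"
  \<comment> \<open>In 0-based indices halving is exact on the orbit: an odd number
    \<open>2 * n - 1\<close> with positive \<open>n\<close> has integer half
    \<open>n - 1\<close>.\<close>
  have shift: "?a ((2 ^ Suc i * k j - 1) div 2) = ?a (2 ^ i * k j - 1)" for i
  proof -
    have "2 ^ i * k j \<ge> 1" using k by simp
    then have "(2 ^ Suc i * k j - 1) div 2 = 2 ^ i * k j - 1" by (simp add: mult.assoc)
    then show ?thesis by simp
  qed
  have "(\<Sum>i<Suc j. ?a ((2 ^ i * k j - 1) div 2)) = ?a ((k j - 1) div 2) + (\<Sum>i<j. ?a (2 ^ i * k j - 1))"
    by (subst sum.lessThan_Suc_shift) (simp only: shift power_0 mult_1)
  then have "(\<Sum>i<Suc j. apply_bcontfun (D2 a) (2 ^ i * k j - 1)) - (\<Sum>i<Suc j. ?a (2 ^ i * k j - 1)) =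
     ?a ((k j - 1) div 2) - ?a (2 ^ j * k j - 1)"
    by (simp add: D2_apply)
  then have "dyadic_mean k j (D2 a) - dyadic_mean k j a =
      (?a ((k j - 1) div 2) - ?a (2 ^ j * k j - 1)) / real (Suc j)"
    by (simp only: dyadic_mean_def diff_divide_distrib[symmetric])
  moreover have "\<bar>?a ((k j - 1) div 2) - ?a (2 ^ j * k j - 1)\<bar> \<le> 2 * norm a"
    using abs_apply_bcontfun_le[of a "(k j - 1) div 2"] abs_apply_bcontfun_le[of a "2 ^ j * k j - 1"] by linarith
  ultimately show ?thesis by (simp add: divide_right_mono)
qed

lemma dyadic_mean_eventually_ge:
  assumes k: "filterlim k at_top sequentially"
    and a: "eventually (\<lambda>n. c \<le> apply_bcontfun a n) sequentially"
  shows "eventually (\<lambda>j. c \<le> dyadic_mean k j a) sequentially"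
proof -
  obtain N where N: "\<And>n. n \<ge> N \<Longrightarrow> c \<le> apply_bcontfun a n"
    using a by (auto simp: eventually_sequentially)
  have "eventually (\<lambda>j. k j \<ge> Suc N) sequentially"
    using k by (simp add: filterlim_at_top)
  then show ?thesis
  proof eventually_elim
    case (elim j)
    show ?case
    proof (rule dyadic_mean_ge)
      fix i :: nat
      have "1 * k j \<le> 2 ^ i * k j" by (intro mult_right_mono) auto
      then show "c \<le> apply_bcontfun a (2 ^ i * k j - 1)" using elim by (intro N) linarith
    qed
  qed
qed

text \<open>A cluster point of the means is linear, stays between lower and upper limits because the
  starting points \<open>k j\<close> tend to infinity, and is invariant because the orbits get
  longer. The lower bounds \<open>b j\<close> survive as \<beta>.\<close>

lemma dyadic_functional:
  assumes k: "filterlim k at_top sequentially"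
    and T: "(\<lambda>j. b j) \<longlonglongrightarrow> \<beta>" and le: "\<And>j. b j \<le> dyadic_mean k j a0"
  shows "\<exists>\<omega>. \<omega> \<in> DL2 TYPE('h::chilbert_space) \<and> \<beta> \<le> blinfun_apply \<omega> a0"
proof -
  obtain f G where G: "G \<noteq> bot" and f: "\<And>a. ((\<lambda>\<psi>. \<psi> a) \<longlongrightarrow> f a) G"
    and ev: "\<And>P. eventually (\<lambda>j. P (dyadic_mean k j)) sequentially \<Longrightarrow> eventually P G"
    by (rule cluster_point_functional[of "dyadic_mean k"]) (use dyadic_mean_abs_le in blast)+
  have add: "f (a + b) = f a + f b" for a b
  proof (rule tendsto_unique[OF G f])
    have "eventually (\<lambda>\<psi>. \<psi> (a + b) = \<psi> a + \<psi> b) G"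
      by (rule ev) (simp add: dyadic_mean_def sum.distrib add_divide_distrib)
    then show "((\<lambda>\<psi>. \<psi> (a + b)) \<longlongrightarrow> f a + f b) G"
      using tendsto_add[OF f f] by (simp add: tendsto_cong)
  qed
  have scale: "f (r *\<^sub>R a) = r *\<^sub>R f a" for r a
  proof (rule tendsto_unique[OF G f])
    have "eventually (\<lambda>\<psi>. \<psi> (r *\<^sub>R a) = r *\<^sub>R \<psi> a) G"
      by (rule ev) (simp add: dyadic_mean_def sum_distrib_left del: sum.lessThan_Suc)
    then show "((\<lambda>\<psi>. \<psi> (r *\<^sub>R a)) \<longlongrightarrow> r *\<^sub>R f a) G"
      using tendsto_scaleR[OF tendsto_const f] by (simp add: tendsto_cong)
  qed
  have ge: "c \<le> f a" if "eventually (\<lambda>j. c \<le> dyadic_mean k j a) sequentially" for c a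
    by (rule tendsto_lowerbound[OF f _ G]) (rule ev[OF that])
  have ge': "c \<le> f a" if "eventually (\<lambda>n. c \<le> apply_bcontfun a n) sequentially" for c a
    by (rule ge[OF dyadic_mean_eventually_ge[OF k that]])
  have neg: "f (- a) = - f a" for a using scale[of "-1" a] by simp
  have le': "f a \<le> c" if "eventually (\<lambda>n. apply_bcontfun a n \<le> c) sequentially" for c a
    using ge'[of "- c" "- a"] that by (simp add: neg)
  have "\<bar>f a\<bar> \<le> norm a" for a
    using ge'[of "- norm a" a] le'[of a "norm a"] abs_apply_bcontfun_le[of a]
    by (auto simp: abs_le_iff minus_le_iff)
  then have bl: "bounded_linear f"
    by (intro bounded_linear_intro[of f 1] add scale) simp
  define \<omega> where "\<omega> = Blinfun f"
  have \<omega>: "blinfun_apply \<omega> a = f a" for a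
    unfolding \<omega>_def by (simp add: bounded_linear_Blinfun_apply[OF bl])
  have inv: "f (D2 a) = f a" for a
  proof -
    have "\<bar>f (D2 a) - f a\<bar> \<le> e" if e: "e > 0" for e
    proof -
      have "(\<lambda>j. 2 * norm a / real (Suc j)) \<longlonglongrightarrow> 0" by real_asymp
      then have "eventually (\<lambda>j. 2 * norm a / real (Suc j) < e) sequentially"
        using e by (rule order_tendstoD)
      moreover have "eventually (\<lambda>j. k j \<ge> 1) sequentially"
        using k by (simp add: filterlim_at_top)
      ultimately have "eventually (\<lambda>j. \<bar>dyadic_mean k j (D2 a) - dyadic_mean k j a\<bar> \<le> e) sequentially"
      proof eventually_elim
        case (elim j)
        then show ?case using dyadic_mean_D2[of k j a] by linarith
      qed
      then have "eventually (\<lambda>\<psi>. \<bar>\<psi> (D2 a) - \<psi> a\<bar> \<le> e) G"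
        by (rule ev[of "\<lambda>\<psi>. \<bar>\<psi> (D2 a) - \<psi> a\<bar> \<le> e"])
      then show ?thesis
        by (rule tendsto_upperbound[OF tendsto_rabs[OF tendsto_diff[OF f f]] _ G])
    qed
    then have "\<bar>f (D2 a) - f a\<bar> \<le> 0" by (rule field_le_epsilon) simp
    then show ?thesis by simp
  qed
  have "\<omega> \<in> DL2 TYPE('h)"
    unfolding DL2_def
  proof (intro CollectI conjI allI impI)
    fix a :: linf_seq assume "\<forall>k. 0 \<le> apply_bcontfun a k"
    then show "0 \<le> blinfun_apply \<omega> a" unfolding \<omega> by (intro ge') simp
  next
    show "blinfun_apply \<omega> (const_bcontfun 1) = 1"
      unfolding \<omega> by (intro antisym ge' le') (simp_all add: const_bcontfun.rep_eq)
  next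
    fix a :: linf_seq
    show "liminf (\<lambda>k. ereal (apply_bcontfun a k)) \<le> ereal (blinfun_apply \<omega> a)"
    proof (rule dense_le)
      fix y assume y: "y < liminf (\<lambda>k. ereal (apply_bcontfun a k))"
      have "eventually (\<lambda>n. y < ereal (apply_bcontfun a n)) sequentially"
        by (rule less_LiminfD[OF y])
      then show "y \<le> ereal (blinfun_apply \<omega> a)"
        unfolding \<omega> by (cases y) (auto elim!: eventually_mono intro!: ge')
    qed
    show "ereal (blinfun_apply \<omega> a) \<le> limsup (\<lambda>k. ereal (apply_bcontfun a k))"
    proof (rule dense_ge)
      fix y assume y: "limsup (\<lambda>k. ereal (apply_bcontfun a k)) < y"
      have "eventually (\<lambda>n. ereal (apply_bcontfun a n) < y) sequentially"
        by (rule Limsup_lessD[OF y])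
      then show "ereal (blinfun_apply \<omega> a) \<le> y"
        unfolding \<omega> by (cases y) (auto elim!: eventually_mono intro!: le')
    qed
  next
    fix T :: "'h \<Rightarrow> 'h"
    show "blinfun_apply \<omega> (D2 (gamma_seq T)) = blinfun_apply \<omega> (gamma_seq T)"
      by (simp add: \<omega> inv)
  qed
  moreover have "\<beta> \<le> f a0"
  proof (rule field_le_epsilon)
    fix e :: real assume "e > 0"
    then have "eventually (\<lambda>j. \<beta> - e < b j) sequentially"
      using order_tendstoD(1)[OF T, of "\<beta> - e"] by simp
    then have "eventually (\<lambda>j. \<beta> - e \<le> dyadic_mean k j a0) sequentially"
    proof eventually_elim
      case (elim j)
      then show ?case using le[of j] by linarith
    qed
    then show "\<beta> \<le> f a0 + e" using ge by fastforce
  qed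
  ultimately show ?thesis using \<omega> by auto
qed

lemma norm0_eq:
  assumes T: "T \<in> L1inf_pos"
  obtains \<beta> where "norm0 T = ereal \<beta>" "\<beta> \<ge> 0"
proof -
  obtain K where K: "\<And>k. gamma_term T k \<le> K" using L1inf_pos_bound[OF T] by metis
  have "norm0 T \<le> ereal K"
    unfolding norm0_def by (rule Limsup_bounded) (use K in simp)
  moreover have "ereal 0 \<le> norm0 T"
    unfolding norm0_def
    by (rule le_Limsup) (use gamma_term_nonneg[OF L1inf_posD(1,2)[OF T]] in auto)
  ultimately show ?thesis using that by (cases "norm0 T") auto
qed

text \<open>The averages have length \<open>j + 1\<close>, which is short compared to \<open>ln (k j)\<close>; hence the mean of
  \<open>\<gamma>(T)\<close> differs little from its value at \<open>k j\<close>.\<close>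

lemma exists_DL2_ge_norm0:
  fixes T :: "'h::chilbert_space \<Rightarrow> 'h"
  assumes T: "T \<in> L1inf_pos"
  shows "\<exists>\<omega>\<in>DL2 TYPE('h). norm0 T \<le> ereal (blinfun_apply \<omega> (gamma_seq T))"
proof -
  note D = L1inf_posD[OF T]
  obtain \<beta> where \<beta>: "norm0 T = ereal \<beta>" "\<beta> \<ge> 0" using norm0_eq[OF T] .
  obtain K where K: "K \<ge> 0" "\<And>k. gamma_term T k \<le> K" using L1inf_pos_bound[OF T] by metis
  \<comment> \<open>The square is chosen so that up to \<open>j\<close> doublings, each adding
    \<open>ln 2 < 1\<close> to the logarithm, change it by a fraction of at most
    \<open>1 / (j + 1)\<close>.\<close>
  have "\<exists>k. k \<ge> Suc j \<and> ln (1 + real k) \<ge> (real j + 1)\<^sup>2 \<and> gamma_term T k > \<beta> - 1 / (real j + 1)" for j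
  proof -
    have "filterlim (\<lambda>k :: nat. ln (1 + real k)) at_top sequentially" by real_asymp
    then have "eventually (\<lambda>k. ln (1 + real k) \<ge> (real j + 1)\<^sup>2) sequentially"
      by (simp add: filterlim_at_top)
    moreover have "eventually (\<lambda>k. k \<ge> Suc j) sequentially" by (rule eventually_ge_at_top)
    ultimately have ev: "eventually (\<lambda>k. ln (1 + real k) \<ge> (real j + 1)\<^sup>2 \<and> k \<ge> Suc j) sequentially"
      by (rule eventually_conj)
    have "\<not> eventually (\<lambda>k. gamma_term T k \<le> \<beta> - 1 / (real j + 1)) sequentially"
    proof
      assume "eventually (\<lambda>k. gamma_term T k \<le> \<beta> - 1 / (real j + 1)) sequentially"
      then have "norm0 T \<le> ereal (\<beta> - 1 / (real j + 1))"
        unfolding norm0_def by (intro Limsup_bounded) (simp add: eventually_mono)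
      then show False by (simp add: \<beta>)
    qed
    then have "\<exists>\<^sub>F k in sequentially. gamma_term T k > \<beta> - 1 / (real j + 1)"
      by (simp add: frequently_def not_less)
    from frequently_eventually_conj[OF this ev] show ?thesis
      by (auto dest: frequently_ex)
  qed
  then obtain k where k: "\<And>j. k j \<ge> Suc j" "\<And>j. ln (1 + real (k j)) \<ge> (real j + 1)\<^sup>2"
    "\<And>j. gamma_term T (k j) > \<beta> - 1 / (real j + 1)"
    by metis
  have "\<exists>\<omega>. \<omega> \<in> DL2 TYPE('h) \<and> \<beta> \<le> blinfun_apply \<omega> (gamma_seq T)"
  proof (rule dyadic_functional)
    show "filterlim k at_top sequentially"
      by (rule filterlim_at_top_mono[OF filterlim_Suc]) (use k(1) in auto)
    show "(\<lambda>j. \<beta> - 1 / (real j + 1) - K / (real j + 1)) \<longlonglongrightarrow> \<beta>" by real_asymp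
    fix j
    show "\<beta> - 1 / (real j + 1) - K / (real j + 1) \<le> dyadic_mean k j (gamma_seq T)"
    proof (rule dyadic_mean_ge)
      fix i assume i: "i \<le> j"
      define L where "L = ln (1 + real (k j))"
      define m where "m = 2 ^ i * k j"
      have L: "L \<ge> (real j + 1)\<^sup>2" using k(2) by (simp add: L_def)
      then have L0: "L > 0" by (smt (verit) of_nat_0_le_iff zero_less_power)
      have mk: "m \<ge> k j" by (simp add: m_def)
      have m1: "m \<ge> 1" using mk k(1)[of j] by simp
      have "ln (1 + real m) \<le> ln (2 ^ i * (1 + real (k j)))"
        unfolding m_def by (intro ln_mono) (auto simp: algebra_simps add_pos_nonneg)
      also have "\<dots> = real i * ln 2 + L" by (simp add: ln_mult ln_realpow L_def)
      also have "\<dots> \<le> (real j + 1) + L"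
      proof -
        have "real i * ln 2 \<le> real j * 1" using i ln_2_less_1 by (intro mult_mono) auto
        then show ?thesis by simp
      qed
      finally have lm: "ln (1 + real m) \<le> L + (real j + 1)" by simp
      have lm0: "ln (1 + real m) > 0" using m1 by simp
      have g: "0 \<le> gamma_term T (k j)" "gamma_term T (k j) \<le> K"
        using gamma_term_nonneg[OF D(1,2)] K by auto
      \<comment> \<open>Ky Fan sums grow with the index, so only the growth of the logarithm can
        lower the quotient; since the quotient is at most \<open>K\<close>, the loss is at most
        \<open>K / (j + 1)\<close>.\<close>
      have "gamma_term T (k j) - K / (real j + 1) \<le> gamma_term T (k j) * (1 - 1 / (real j + 1))"
        using g(2) by (simp add: algebra_simps divide_right_mono)
      also have "\<dots> \<le> gamma_term T (k j) * (L / (L + (real j + 1)))"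
      proof (intro mult_left_mono g(1))
        have "(real j + 1) * (real j + 1) \<le> L" using L by (simp add: power2_eq_square)
        then show "1 - 1 / (real j + 1) \<le> L / (L + (real j + 1))"
          using L0 by (simp add: field_simps)
      qed
      also have "\<dots> = kyfan T (k j) / (L + (real j + 1))"
        using L0 by (simp add: gamma_term_kyfan L_def)
      also have "\<dots> \<le> kyfan T m / ln (1 + real m)"
        by (rule frac_le) (use kyfan_mono[OF D(1,2) mk] kyfan_nonneg[OF D(1,2)] lm lm0 in auto)
      also have "\<dots> = apply_bcontfun (gamma_seq T) (2 ^ i * k j - 1)"
        using m1 by (simp add: gamma_seq_apply[OF T] gamma_term_kyfan m_def)
      finally show "\<beta> - 1 / (real j + 1) - K / (real j + 1) \<le> apply_bcontfun (gamma_seq T) (2 ^ i * k j - 1)"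
        using k(3)[of j] by linarith
    qed
  qed
  then show ?thesis by (auto simp: \<beta>)
qed

lemma DL2_le_norm0:
  fixes T :: "'h::chilbert_space \<Rightarrow> 'h"
  assumes \<omega>: "\<omega> \<in> DL2 TYPE('h)" and T: "T \<in> L1inf_pos"
  shows "ereal (blinfun_apply \<omega> (gamma_seq T)) \<le> norm0 T"
proof -
  have "ereal (blinfun_apply \<omega> (gamma_seq T)) \<le> limsup (\<lambda>k. ereal (gamma_term T (Suc k)))"
    using DL2D(2)[OF \<omega>, of "gamma_seq T"] gamma_term_nonneg[OF L1inf_posD(1,2)[OF T]]
    by (simp add: gamma_seq_apply[OF T])
  also have "\<dots> = norm0 T"
    unfolding norm0_def using limsup_shift[of "\<lambda>k. ereal (gamma_term T k)"] by simp
  finally show ?thesis .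
qed

section \<open>Diagonal operators\<close>

lemma orthonormal_basisD:
  assumes "orthonormal_basis h"
  shows "orthonormal_sys h" "norm (h m) = 1" "(\<lambda>m. cinner (h m) x *\<^sub>C h m) sums x"
proof -
  have c: "cinner (h i) (h j) = (if i = j then 1 else 0)" for i j
    using assms by (simp add: orthonormal_basis_def)
  have n: "norm (h m) = 1" for m
  proof -
    have "(norm (h m))\<^sup>2 = 1" using c[of m m] by (simp flip: Re_cinner_self)
    then show ?thesis by (simp add: power2_eq_1_iff) (use norm_ge_zero[of "h m"] in linarith)
  qed
  then show "norm (h m) = 1" .
  show "orthonormal_sys h" using c n by (simp add: orthonormal_sys_def)
  show "(\<lambda>m. cinner (h m) x *\<^sub>C h m) sums x" using assms by (simp add: orthonormal_basis_def)
qed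

lemma orthonormal_basis_nonzero: "orthonormal_basis h \<Longrightarrow> h m \<noteq> 0"
  using orthonormal_basisD(2)[of h m] by auto

lemma orthonormal_basis_ext:
  assumes "orthonormal_basis h" "\<And>m. cinner (h m) x = cinner (h m) y"
  shows "x = y"
  using orthonormal_basisD(3)[OF assms(1), of x] orthonormal_basisD(3)[OF assms(1), of y]
  by (simp add: assms(2) sums_unique2)

lemma parseval_cinner:
  assumes "orthonormal_basis h"
  shows "(\<lambda>m. cinner x (h m) * cinner (h m) y) sums cinner x y"
  using bounded_linear.sums[OF bounded_linear_cinner_right orthonormal_basisD(3)[OF assms, of y], of x]
  by (simp add: cinner_simps mult.commute)

lemma parseval:
  assumes "orthonormal_basis h"
  shows "(\<lambda>m. (cmod (cinner (h m) x))\<^sup>2) sums (norm x)\<^sup>2"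
proof -
  have "(\<lambda>m. Re (cinner x (h m) * cinner (h m) x)) sums Re (cinner x x)"
    by (rule bounded_linear.sums[OF bounded_linear_Re parseval_cinner[OF assms]])
  then show ?thesis
    by (simp add: cinner_norm_sq Re_cinner_self cmod_cinner_commute del: of_real_power times_complex.sel)
qed

definition diag_op :: "(nat \<Rightarrow> 'h::chilbert_space) \<Rightarrow> (nat \<Rightarrow> real) \<Rightarrow> 'h \<Rightarrow> 'h" where
  "diag_op h a x = (\<Sum>m. (complex_of_real (a m) * cinner (h m) x) *\<^sub>C h m)"

context
  fixes h :: "nat \<Rightarrow> 'h::chilbert_space"
  assumes h: "orthonormal_basis h"
begin

lemma summable_diag:
  assumes a: "\<And>m. \<bar>a m\<bar> \<le> K"
  shows "summable (\<lambda>m. (cmod (complex_of_real (a m) * cinner (h m) x))\<^sup>2)"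
proof (rule summable_comparison_test')
  show "summable (\<lambda>m. K\<^sup>2 * (cmod (cinner (h m) x))\<^sup>2)"
    by (intro summable_mult summable_bessel orthonormal_basisD(1)[OF h])
  fix m
  have "(a m)\<^sup>2 \<le> K\<^sup>2" using a[of m] by (simp add: abs_le_square_iff[symmetric])
  then show "norm ((cmod (complex_of_real (a m) * cinner (h m) x))\<^sup>2) \<le> K\<^sup>2 * (cmod (cinner (h m) x))\<^sup>2"
    by (simp add: norm_mult power_mult_distrib mult_right_mono)
qed

lemma cinner_diag_op:
  assumes a: "\<And>m. \<bar>a m\<bar> \<le> K"
  shows "cinner (h m) (diag_op h a x) = complex_of_real (a m) * cinner (h m) x"
  unfolding diag_op_def
  using cinner_orthonormal_suminf[OF orthonormal_basisD(1)[OF h] summable_diag[of a K x, OF a], of m]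
    orthonormal_basis_nonzero[OF h] by simp

lemma norm_sq_diag_op:
  assumes a: "\<And>m. \<bar>a m\<bar> \<le> K"
  shows "(\<lambda>m. (a m)\<^sup>2 * (cmod (cinner (h m) x))\<^sup>2) sums (norm (diag_op h a x))\<^sup>2"
  using parseval[OF h, of "diag_op h a x"]
  by (simp add: cinner_diag_op[of a K, OF a] norm_mult power_mult_distrib)

lemma diag_op_bounded_clinear:
  assumes a: "\<And>m. \<bar>a m\<bar> \<le> K"
  shows "bounded_clinear (diag_op h a)"
proof (rule bounded_clinearI[of _ K])
  note c = cinner_diag_op[of a K, OF a]
  show "diag_op h a (x + y) = diag_op h a x + diag_op h a y" for x y
    by (rule orthonormal_basis_ext[OF h]) (simp add: c cinner_simps algebra_simps)
  show "diag_op h a (r *\<^sub>C x) = r *\<^sub>C diag_op h a x" for r x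
    by (rule orthonormal_basis_ext[OF h]) (simp add: c cinner_simps)
  fix x
  have K: "K \<ge> 0" using a[of 0] by linarith
  have "(norm (diag_op h a x))\<^sup>2 = (\<Sum>m. (a m)\<^sup>2 * (cmod (cinner (h m) x))\<^sup>2)"
    by (rule sums_unique[OF norm_sq_diag_op[of a K, OF a]])
  also have "\<dots> \<le> (\<Sum>m. K\<^sup>2 * (cmod (cinner (h m) x))\<^sup>2)"
  proof (rule suminf_le)
    show "summable (\<lambda>m. (a m)\<^sup>2 * (cmod (cinner (h m) x))\<^sup>2)"
      by (rule sums_summable[OF norm_sq_diag_op[of a K, OF a]])
    show "summable (\<lambda>m. K\<^sup>2 * (cmod (cinner (h m) x))\<^sup>2)"
      by (intro summable_mult summable_bessel orthonormal_basisD(1)[OF h])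
    show "(a m)\<^sup>2 * (cmod (cinner (h m) x))\<^sup>2 \<le> K\<^sup>2 * (cmod (cinner (h m) x))\<^sup>2" for m
      using a[of m] by (intro mult_right_mono) (auto simp: abs_le_square_iff[symmetric])
  qed
  also have "\<dots> = K\<^sup>2 * (norm x)\<^sup>2"
    using sums_unique[OF sums_mult[OF parseval[OF h, of x], of "K\<^sup>2"]] by simp
  finally have "(norm (diag_op h a x))\<^sup>2 \<le> (norm x * K)\<^sup>2" by (simp add: power_mult_distrib mult.commute)
  then show "norm (diag_op h a x) \<le> norm x * K"
    by (rule power2_le_imp_le) (use K in simp)
qed

lemma diag_op_symmetric:
  assumes a: "\<And>m. \<bar>a m\<bar> \<le> K"
  shows "cinner (diag_op h a x) y = cinner x (diag_op h a y)"
proof -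
  note c = cinner_diag_op[of a K, OF a]
  have c': "cinner (diag_op h a x) (h m) = complex_of_real (a m) * cinner x (h m)" for m
    by (subst cinner_commute) (simp add: c, metis cinner_commute complex_cnj_cnj)
  have "(\<lambda>m. complex_of_real (a m) * (cinner x (h m) * cinner (h m) y)) sums cinner (diag_op h a x) y"
    using parseval_cinner[OF h, of "diag_op h a x" y] by (simp add: c' mult.assoc)
  moreover have "(\<lambda>m. complex_of_real (a m) * (cinner x (h m) * cinner (h m) y)) sums cinner x (diag_op h a y)"
    using parseval_cinner[OF h, of x "diag_op h a y"] by (simp add: c mult_ac)
  ultimately show ?thesis by (rule sums_unique2)
qed

lemma diag_op_form:
  assumes a: "\<And>m. \<bar>a m\<bar> \<le> K"
  shows "(\<lambda>m. complex_of_real (a m * (cmod (cinner (h m) x))\<^sup>2)) sums cinner x (diag_op h a x)"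
proof -
  have "cinner x (h m) * cinner (h m) (diag_op h a x) = complex_of_real (a m * (cmod (cinner (h m) x))\<^sup>2)" for m
  proof -
    have "cinner x (h m) * cinner (h m) (diag_op h a x) =
        complex_of_real (a m) * (cinner (h m) x * cinner x (h m))"
      by (simp add: cinner_diag_op[of a K, OF a])
    also have "\<dots> = complex_of_real (a m * (cmod (cinner (h m) x))\<^sup>2)"
      by (simp only: cinner_norm_sq of_real_mult)
    finally show ?thesis .
  qed
  then show ?thesis using parseval_cinner[OF h, of x "diag_op h a x"] by simp
qed

lemma diag_op_Re_form:
  assumes a: "\<And>m. \<bar>a m\<bar> \<le> K"
  shows "(\<lambda>m. a m * (cmod (cinner (h m) x))\<^sup>2) sums Re (cinner x (diag_op h a x))"
  using bounded_linear.sums[OF bounded_linear_Re diag_op_form[of a K x, OF a]] by simp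

lemma diag_op_compose:
  assumes a: "\<And>m. \<bar>a m\<bar> \<le> K" and b: "\<And>m. \<bar>b m\<bar> \<le> L"
  shows "diag_op h a \<circ> diag_op h b = diag_op h (\<lambda>m. a m * b m)"
proof
  fix x
  have ab: "\<bar>a m * b m\<bar> \<le> K * L" for m
    unfolding abs_mult using a[of m] b[of m] by (intro mult_mono) auto
  show "(diag_op h a \<circ> diag_op h b) x = diag_op h (\<lambda>m. a m * b m) x"
    by (rule orthonormal_basis_ext[OF h])
       (simp add: cinner_diag_op[of a K, OF a] cinner_diag_op[of b L, OF b]
         cinner_diag_op[of "\<lambda>m. a m * b m", OF ab])
qed

lemma diag_op_eqI:
  assumes T: "bounded_clinear T" and a: "\<And>m. \<bar>a m\<bar> \<le> K"
    and eq: "\<And>m. T (h m) = complex_of_real (a m) *\<^sub>C h m"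
  shows "T = diag_op h a"
proof
  fix x
  have "(\<lambda>m. T (cinner (h m) x *\<^sub>C h m)) sums T x"
    by (rule bounded_clinear_sums[OF T orthonormal_basisD(3)[OF h]])
  then show "T x = diag_op h a x"
    unfolding diag_op_def
    by (simp add: bounded_clinear_scaleC[OF T] eq scaleC_scaleC mult.commute sums_iff)
qed

text \<open>Tannery's theorem for the series of the squared norm: bounded coefficients that tend to
  zero one by one give strong convergence. It supplies the countable additivity of
  \<open>diag_measure\<close>.\<close>

lemma diag_op_tendsto:
  assumes a: "\<And>n m. \<bar>a n m\<bar> \<le> K" and lim: "\<And>m. (\<lambda>n. a n m) \<longlonglongrightarrow> 0"
  shows "(\<lambda>n. diag_op h (a n) x) \<longlonglongrightarrow> 0"
proof -
  have "eventually (\<lambda>n. summable (\<lambda>m. norm ((a n m)\<^sup>2 * (cmod (cinner (h m) x))\<^sup>2))) sequentially \<and>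
      summable (\<lambda>m :: nat. norm (0 :: real)) \<and>
      (\<lambda>n. \<Sum>m. (a n m)\<^sup>2 * (cmod (cinner (h m) x))\<^sup>2) \<longlonglongrightarrow> (\<Sum>m. 0)"
  proof (rule tannerys_theorem[where M = "\<lambda>m. K\<^sup>2 * (cmod (cinner (h m) x))\<^sup>2"])
    show "((\<lambda>n. (a n m)\<^sup>2 * (cmod (cinner (h m) x))\<^sup>2) \<longlongrightarrow> 0) sequentially" for m
      using tendsto_mult[OF tendsto_power[OF lim, of m 2] tendsto_const] by simp
    have "(a n m)\<^sup>2 \<le> K\<^sup>2" for n m
      using a[of n m] by (simp add: abs_le_square_iff[symmetric])
    then show "\<forall>\<^sub>F (m, n) in at_top \<times>\<^sub>F sequentially.
        norm ((a n m)\<^sup>2 * (cmod (cinner (h m) x))\<^sup>2) \<le> K\<^sup>2 * (cmod (cinner (h m) x))\<^sup>2"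
      by (intro always_eventually) (auto intro: mult_right_mono)
    show "summable (\<lambda>m. K\<^sup>2 * (cmod (cinner (h m) x))\<^sup>2)"
      by (intro summable_mult summable_bessel orthonormal_basisD(1)[OF h])
  qed simp
  then have "(\<lambda>n. (norm (diag_op h (a n) x))\<^sup>2) \<longlonglongrightarrow> 0"
    by (simp add: sums_unique[OF norm_sq_diag_op[of "a _" K, OF a]])
  then have "(\<lambda>n. sqrt ((norm (diag_op h (a n) x))\<^sup>2)) \<longlonglongrightarrow> sqrt 0"
    by (rule tendsto_real_sqrt)
  then show ?thesis by (simp add: tendsto_norm_zero_iff)
qed

end

text \<open>By symmetry the square of \<open>norm (B z)\<close> is at most
  \<open>norm z * norm (B (B z))\<close>, so along a subsequence on which the square of
  \<open>B\<close> converges, \<open>B\<close> itself is Cauchy.\<close>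

lemma compact_op_sqrt:
  assumes B: "bounded_clinear B" and sym: "\<And>x y. cinner (B x) y = cinner x (B y)"
    and c: "compact_op (B \<circ> B)"
  shows "compact_op B"
  unfolding compact_op_def
proof
  have *: "\<exists>l r. strict_mono r \<and> ((\<lambda>n. B (x (r n))) \<longlonglongrightarrow> l)" if x: "\<And>n::nat. norm (x n) \<le> 1" for x
  proof -
    obtain r y where r: "strict_mono r" and y: "(\<lambda>n. (B \<circ> B) (x (r n))) \<longlonglongrightarrow> y"
      by (rule compact_op_subseq[OF c, of x, OF x])
    have "Cauchy (\<lambda>n. B (x (r n)))"
      unfolding Cauchy_iff
    proof (intro allI impI)
      fix e :: real assume e: "e > 0"
      have "\<exists>N. \<forall>m\<ge>N. \<forall>n\<ge>N. norm ((B \<circ> B) (x (r m)) - (B \<circ> B) (x (r n))) < e\<^sup>2 / 2"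
        using LIMSEQ_imp_Cauchy[OF y] unfolding Cauchy_iff by (rule allE[of _ "e\<^sup>2 / 2"]) (use e in simp)
      then obtain N where N: "\<And>m n. m \<ge> N \<Longrightarrow> n \<ge> N \<Longrightarrow> norm ((B \<circ> B) (x (r m)) - (B \<circ> B) (x (r n))) < e\<^sup>2 / 2"
        by blast
      show "\<exists>M. \<forall>m\<ge>M. \<forall>n\<ge>M. norm (B (x (r m)) - B (x (r n))) < e"
      proof (intro exI allI impI)
        fix m n assume mn: "m \<ge> N" "n \<ge> N"
        define z where "z = x (r m) - x (r n)"
        have "(norm (B z))\<^sup>2 = Re (cinner z (B (B z)))"
          by (simp add: Re_cinner_self[symmetric] sym)
        also have "\<dots> \<le> norm z * norm (B (B z))"
          using complex_Re_le_cmod norm_cinner_le order_trans by blast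
        also have "\<dots> \<le> 2 * norm (B (B z))"
          using norm_triangle_ineq4[of "x (r m)" "x (r n)"] x[of "r m"] x[of "r n"]
          by (intro mult_right_mono) (auto simp: z_def)
        also have "\<dots> < e\<^sup>2"
          using N[OF mn] by (simp add: z_def bounded_clinear_simps[OF B])
        finally have "norm (B z) < e" using e by (simp add: power2_less_imp_less)
        then show "norm (B (x (r m)) - B (x (r n))) < e" by (simp add: z_def bounded_clinear_simps[OF B])
      qed
    qed
    then obtain l where "(\<lambda>n. B (x (r n))) \<longlonglongrightarrow> l"
      using Cauchy_convergent convergent_def by blast
    then show ?thesis using r by blast
  qed
  show "compact (closure (B ` cball 0 1))"
    unfolding compact_eq_seq_compact_metric seq_compact_def
  proof (intro allI impI)
    fix f :: "nat \<Rightarrow> 'a" assume f: "\<forall>n. f n \<in> closure (B ` cball 0 1)"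
    \<comment> \<open>Points of the closure need not be images, so they are traded for images at
      distance below \<open>1 / (n + 1)\<close>.\<close>
    have "\<exists>z. norm z \<le> 1 \<and> dist (B z) (f n) < 1 / real (Suc n)" for n
    proof -
      have "\<exists>y\<in>B ` cball 0 1. dist y (f n) < 1 / real (Suc n)"
        using f[rule_format, of n] unfolding closure_approachable
        by (rule allE[of _ "1 / real (Suc n)"]) simp
      then show ?thesis by auto
    qed
    then obtain z where z: "\<And>n. norm (z n) \<le> 1" "\<And>n. dist (B (z n)) (f n) < 1 / real (Suc n)"
      by metis
    obtain l r where r: "strict_mono r" and l: "(\<lambda>n. B (z (r n))) \<longlonglongrightarrow> l"
      using *[of z] z(1) by blast
    have "(\<lambda>n. dist (B (z n)) (f n)) \<longlonglongrightarrow> 0"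
      by (rule real_tendsto_sandwich[OF _ _ tendsto_const LIMSEQ_Suc[OF lim_1_over_n]])
         (use z(2) in \<open>auto intro!: always_eventually less_imp_le\<close>)
    from LIMSEQ_subseq_LIMSEQ[OF this r] have "(\<lambda>n. dist (B (z (r n))) (f (r n))) \<longlonglongrightarrow> 0"
      by (simp add: comp_def)
    then have "(\<lambda>n. B (z (r n)) - f (r n)) \<longlonglongrightarrow> 0"
      by (simp add: dist_norm tendsto_norm_zero_iff)
    from tendsto_diff[OF l this] have fl: "(f \<circ> r) \<longlonglongrightarrow> l"
      by (simp add: comp_def)
    moreover have "l \<in> closure (B ` cball 0 1)"
      by (rule closed_sequentially[OF closed_closure _ fl]) (use f in auto)
    ultimately show "\<exists>l\<in>closure (B ` cball 0 1). \<exists>r. strict_mono r \<and> (f \<circ> r) \<longlonglongrightarrow> l"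
      using r by blast
  qed
qed (rule B)

section \<open>Spectral measures\<close>

lemma is_projectionD:
  assumes "is_projection P"
  shows "bounded_clinear P" "cinner (P x) y = cinner x (P y)" "P (P x) = P x"
  using assms by (auto simp: is_projection_def selfadjoint_op_def fun_eq_iff)

lemma is_projection_norm:
  assumes P: "is_projection P"
  shows "cinner x (P x) = complex_of_real ((norm (P x))\<^sup>2)"
proof -
  have "cinner x (P x) = cinner (P x) (P x)"
    by (simp add: is_projectionD[OF P])
  then show ?thesis by (simp add: cinner_self)
qed

context
  fixes E :: "'b::topological_space set \<Rightarrow> 'h::chilbert_space \<Rightarrow> 'h"
  assumes E: "spectral_measure E"
begin

lemma spectral_measure_projection: "B \<in> sets borel \<Longrightarrow> is_projection (E B)"
  using E by (simp add: spectral_measure_def)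

lemma spectral_measure_UNIV: "E UNIV x = x"
  using E by (simp add: spectral_measure_def)

lemma spectral_measure_Int: "B \<in> sets borel \<Longrightarrow> C \<in> sets borel \<Longrightarrow> E B (E C x) = E (B \<inter> C) x"
  using E by (simp add: spectral_measure_def fun_eq_iff)

lemma spectral_measure_sums:
  "range B \<subseteq> sets borel \<Longrightarrow> disjoint_family B \<Longrightarrow> (\<lambda>j :: nat. E (B j) x) sums E (\<Union>j. B j) x"
  using E by (simp add: spectral_measure_def)

lemma spectral_measure_empty: "E {} x = 0"
proof -
  have "(\<lambda>j :: nat. E {} x) sums E (\<Union>j :: nat. {}) x"
    by (rule spectral_measure_sums) (auto simp: disjoint_family_on_def)
  then have "(\<lambda>j :: nat. E {} x) \<longlonglongrightarrow> 0" by (intro summable_LIMSEQ_zero) (rule sums_summable)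
  then show ?thesis by (simp add: LIMSEQ_const_iff)
qed

lemma spectral_measure_Un:
  assumes "B \<in> sets borel" "C \<in> sets borel" "B \<inter> C = {}"
  shows "E (B \<union> C) x = E B x + E C x"
proof -
  have "(\<lambda>j. E (binaryset B C j) x) sums E (\<Union>j. binaryset B C j) x"
    by (rule spectral_measure_sums) (use assms in \<open>auto simp: binaryset_def disjoint_family_on_def\<close>)
  moreover have "(\<lambda>j. E (binaryset B C j) x) sums (E B x + E C x)"
    by (rule binaryset_sums[of "\<lambda>B. E B x"]) (rule spectral_measure_empty)
  ultimately show ?thesis by (simp add: UN_binaryset_eq sums_unique2)
qed

lemma spectral_measure_compl: "B \<in> sets borel \<Longrightarrow> E B x + E (- B) x = x"
  using spectral_measure_Un[of B "- B" x] spectral_measure_UNIV[of x] by (simp add: Compl_partition)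

lemma scalar_spectral_measure_sets [simp]:
  "sets (scalar_spectral_measure E x) = sets borel" "space (scalar_spectral_measure E x) = UNIV"
  unfolding scalar_spectral_measure_def
  using sets.sigma_sets_eq[of "borel :: 'b measure"] by (simp_all add: sets_measure_of_conv)

lemma measurable_scalar_spectral_measure:
  "f \<in> borel \<rightarrow>\<^sub>M N \<Longrightarrow> f \<in> scalar_spectral_measure E x \<rightarrow>\<^sub>M N"
  by (simp add: measurable_cong_sets[OF scalar_spectral_measure_sets(1) refl])

text \<open>\<open>measure_of\<close> returns the intended values only for a countably additive set
  function, which is obtained by pairing the strong sums of \<open>E\<close> with
  \<open>x\<close>.\<close>

lemma emeasure_scalar_spectral_measure:
  assumes B: "B \<in> sets borel"
  shows "emeasure (scalar_spectral_measure E x) B = ennreal ((norm (E B x))\<^sup>2)"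
proof -
  have n: "Re (cinner x (E C x)) = (norm (E C x))\<^sup>2" if "C \<in> sets borel" for C
    using is_projection_norm[OF spectral_measure_projection[OF that], of x] by simp
  have "emeasure (scalar_spectral_measure E x) B = ennreal (Re (cinner x (E B x)))"
    unfolding scalar_spectral_measure_def
  proof (rule emeasure_measure_of_sigma[OF _ _ _ B])
    show "sigma_algebra UNIV (sets (borel :: 'b measure))"
      using sets.sigma_algebra_axioms[of "borel :: 'b measure"] by simp
    show "positive (sets borel) (\<lambda>B. ennreal (Re (cinner x (E B x))))"
      by (simp add: positive_def spectral_measure_empty)
    show "countably_additive (sets borel) (\<lambda>B. ennreal (Re (cinner x (E B x))))"
    proof (rule countably_additiveI)
      fix A :: "nat \<Rightarrow> 'b set"
      assume A: "range A \<subseteq> sets borel" "disjoint_family A"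
      have "(\<lambda>i. Re (cinner x (E (A i) x))) sums Re (cinner x (E (\<Union>i. A i) x))"
        by (rule bounded_linear.sums[OF bounded_linear_Re
            bounded_linear.sums[OF bounded_linear_cinner_right spectral_measure_sums[OF A]]])
      moreover have "0 \<le> Re (cinner x (E (A i) x))" for i using A(1) by (subst n) auto
      ultimately show "(\<Sum>i. ennreal (Re (cinner x (E (A i) x)))) = ennreal (Re (cinner x (E (\<Union>i. A i) x)))"
        by (simp add: suminf_ennreal2 sums_iff)
    qed
  qed
  then show ?thesis by (simp add: n[OF B])
qed

lemma finite_scalar_spectral_measure: "finite_measure (scalar_spectral_measure E x)"
  by (rule finite_measureI) (simp add: emeasure_scalar_spectral_measure)

lemma measure_scalar_spectral_measure_UNIV: "measure (scalar_spectral_measure E x) UNIV = (norm x)\<^sup>2"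
  by (simp add: measure_def emeasure_scalar_spectral_measure spectral_measure_UNIV)

lemma scalar_spectral_measure_restrict:
  assumes B: "B \<in> sets borel"
  shows "scalar_spectral_measure E (E B x) = density (scalar_spectral_measure E x) (indicator B)"
proof (rule measure_eqI)
  fix C assume "C \<in> sets (scalar_spectral_measure E (E B x))"
  then have C: "C \<in> sets borel" by simp
  have "emeasure (density (scalar_spectral_measure E x) (indicator B)) C =
      (\<integral>\<^sup>+ t. indicator (B \<inter> C) t \<partial>scalar_spectral_measure E x)"
  proof (subst emeasure_density)
    show "indicator B \<in> borel_measurable (scalar_spectral_measure E x)"
      using B by (intro measurable_scalar_spectral_measure) simp
  qed (use C in \<open>auto intro!: nn_integral_cong split: split_indicator\<close>)
  also have "\<dots> = emeasure (scalar_spectral_measure E x) (B \<inter> C)"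
    using B C by simp
  finally show "emeasure (scalar_spectral_measure E (E B x)) C = emeasure (density (scalar_spectral_measure E x) (indicator B)) C"
    using B C by (simp add: emeasure_scalar_spectral_measure spectral_measure_Int Int_commute)
qed simp

text \<open>Passing to \<open>E B x\<close> restricts the scalar measure to \<open>B\<close>, so the
  form of an integral has no cross terms between \<open>B\<close> and its complement.\<close>

lemma integral_restrict:
  fixes f :: "'b \<Rightarrow> real"
  assumes B: "B \<in> sets borel" and f: "integrable (scalar_spectral_measure E x) f"
  shows "integrable (scalar_spectral_measure E (E B x)) f"
    "(LINT t|scalar_spectral_measure E x. f t) =
      (LINT t|scalar_spectral_measure E (E B x). f t) + (LINT t|scalar_spectral_measure E (E (- B) x). f t)"
proof -
  let ?M = "scalar_spectral_measure E x"
  have D: "scalar_spectral_measure E (E C x) = density ?M (\<lambda>t. ennreal (indicator C t))" if "C \<in> sets borel" for C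
    using scalar_spectral_measure_restrict[OF that, of x] by (simp add: ennreal_indicator)
  have m: "f \<in> borel_measurable ?M" using f by simp
  have i: "integrable ?M (\<lambda>t. indicator C t *\<^sub>R f t)" if "C \<in> sets borel" for C
    using integrable_mult_indicator[of C ?M f] that f by simp
  have C: "integrable (scalar_spectral_measure E (E C x)) f"
    "(LINT t|scalar_spectral_measure E (E C x). f t) = (LINT t|?M. indicator C t *\<^sub>R f t)" if "C \<in> sets borel" for C
  proof -
    have mi: "(indicator C :: 'b \<Rightarrow> real) \<in> borel_measurable ?M"
      using that by (intro measurable_scalar_spectral_measure) simp
    show "integrable (scalar_spectral_measure E (E C x)) f"
      unfolding D[OF that] by (subst integrable_density[OF m mi]) (use i[OF that] in auto)
    show "(LINT t|scalar_spectral_measure E (E C x). f t) = (LINT t|?M. indicator C t *\<^sub>R f t)"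
      unfolding D[OF that] by (subst integral_density[OF m mi]) auto
  qed
  show "integrable (scalar_spectral_measure E (E B x)) f" by (rule C(1)[OF B])
  have "(LINT t|?M. f t) = (LINT t|?M. indicator B t *\<^sub>R f t + indicator (- B) t *\<^sub>R f t)"
    by (rule Bochner_Integration.integral_cong) (auto split: split_indicator)
  also have "\<dots> = (LINT t|?M. indicator B t *\<^sub>R f t) + (LINT t|?M. indicator (- B) t *\<^sub>R f t)"
    using B by (intro Bochner_Integration.integral_add i) auto
  finally show "(LINT t|?M. f t) =
      (LINT t|scalar_spectral_measure E (E B x). f t) + (LINT t|scalar_spectral_measure E (E (- B) x). f t)"
    using B by (simp add: C(2))
qed

lemma AE_scalar_spectral_measure:
  assumes B: "B \<in> sets borel" and x: "E B x = x"
  shows "AE t in scalar_spectral_measure E x. t \<in> B"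
proof (rule AE_I)
  have "E (- B) x = 0" using spectral_measure_compl[OF B, of x] x by simp
  then show "emeasure (scalar_spectral_measure E x) (- B) = 0"
    using B by (simp add: emeasure_scalar_spectral_measure)
qed (use B in auto)

lemma spectral_measure_idem: "B \<in> sets borel \<Longrightarrow> E B (E B x) = E B x"
  by (simp add: spectral_measure_Int)

end

text \<open>\<open>E\<close> is tied to \<open>D\<close> through forms, and commutation of
  \<open>E B\<close> with \<open>D\<close> is not given. Splitting \<open>h\<close> into
  \<open>y = E B h\<close> and \<open>z\<close>, the absence of cross terms in the form makes the
  real part of \<open>cinner y (D z)\<close> vanish; pairing the eigenvalue equation with
  \<open>y\<close> then yields the first moment of its measure.\<close>

lemma spectral_resolution_eigenvector_component:
  fixes D :: "'h::chilbert_space \<Rightarrow> 'h"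
  assumes sa: "selfadjoint_on domD D" and R: "spectral_resolution domD D E"
    and h: "h \<in> domD" "D h = complex_of_real \<kappa> *\<^sub>C h" and B: "B \<in> sets borel"
  shows "integrable (scalar_spectral_measure E (E B h)) (\<lambda>t. t)"
    "(LINT t|scalar_spectral_measure E (E B h). t - \<kappa>) = 0"
proof -
  have E: "spectral_measure E" and dom: "domD = {x. integrable (scalar_spectral_measure E x) (\<lambda>t. t\<^sup>2)}"
    and form: "\<And>x. x \<in> domD \<Longrightarrow> cinner x (D x) = complex_of_real (LINT t|scalar_spectral_measure E x. t)"
    using R by (auto simp: spectral_resolution_def)
  interpret fm: finite_measure "scalar_spectral_measure E x" for x
    by (rule finite_scalar_spectral_measure[OF E])
  have int1: "integrable (scalar_spectral_measure E x) (\<lambda>t. t)" if "x \<in> domD" for x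
  proof (rule Bochner_Integration.integrable_bound)
    show "integrable (scalar_spectral_measure E x) (\<lambda>t. 1 + t\<^sup>2)"
      using that dom by simp
    show "AE t in scalar_spectral_measure E x. norm t \<le> norm (1 + t\<^sup>2)"
    proof (rule AE_I2)
      fix t :: real
      have "0 \<le> (\<bar>t\<bar> - 1)\<^sup>2" by simp
      then have "2 * \<bar>t\<bar> \<le> t\<^sup>2 + 1" by (simp add: power2_diff)
      then show "norm t \<le> norm (1 + t\<^sup>2)" by simp
    qed
  qed (simp add: measurable_ident_sets scalar_spectral_measure_sets[OF E])
  define y where "y = E B h"
  define z where "z = E (- B) h"
  have B': "- B \<in> sets borel" using B by auto
  have yz: "y + z = h" unfolding y_def z_def by (rule spectral_measure_compl[OF E B])
  have h2: "integrable (scalar_spectral_measure E h) (\<lambda>t. t\<^sup>2)" using h(1) dom by blast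
  have yd: "y \<in> domD"
    unfolding dom y_def by (rule CollectI, rule integral_restrict(1)[OF E B h2])
  have zd: "z \<in> domD"
    unfolding dom z_def by (rule CollectI, rule integral_restrict(1)[OF E B' h2])
  have lin: "D (y + z) = D y + D z"
    using sa yd zd unfolding selfadjoint_on_def by blast
  have sym: "cinner (D z) y = cinner z (D y)"
    using sa yd zd unfolding selfadjoint_on_def by blast
  have "cinner h (D h) = cinner y (D y) + cinner z (D z)"
    using integral_restrict(2)[OF E B int1[OF h(1)]]
    by (simp add: form h(1) yd zd y_def[symmetric] z_def[symmetric])
  moreover have "cinner h (D h) = cinner y (D y) + cinner z (D z) + cinner y (D z) + cinner z (D y)"
    using lin by (simp add: yz[symmetric] cinner_simps)
  ultimately have "cinner y (D z) + cinner z (D y) = 0" by simp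
  moreover have "cinner z (D y) = cnj (cinner y (D z))"
    using sym by (metis cinner_commute)
  ultimately have re: "Re (cinner y (D z)) = 0" unfolding complex_eq_iff by simp
  have yh: "cinner y h = complex_of_real ((norm y)\<^sup>2)"
  proof -
    have "cinner y h = cinner h (E B h)"
      unfolding y_def by (simp add: is_projectionD(2)[OF spectral_measure_projection[OF E B]])
    then show ?thesis
      using is_projection_norm[OF spectral_measure_projection[OF E B], of h] by (simp add: y_def)
  qed
  have "cinner y (D h) = cinner y (D y) + cinner y (D z)"
    using lin by (simp add: yz[symmetric] cinner_simps)
  then have "complex_of_real (\<kappa> * (norm y)\<^sup>2) = cinner y (D y) + cinner y (D z)"
    by (simp add: h(2) cinner_simps yh)
  from arg_cong[OF this, of Re] have "Re (cinner y (D y)) = \<kappa> * (norm y)\<^sup>2"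
    unfolding Re_complex_of_real using re by simp
  then have q: "(LINT t|scalar_spectral_measure E y. t) = \<kappa> * (norm y)\<^sup>2"
    by (simp add: form yd)
  show "integrable (scalar_spectral_measure E (E B h)) (\<lambda>t. t)"
    using int1[OF yd] by (simp add: y_def)
  have "(LINT t|scalar_spectral_measure E y. t - \<kappa>) = 0"
    using int1[OF yd] q measure_scalar_spectral_measure_UNIV[OF E, of y]
    by (simp add: scalar_spectral_measure_sets[OF E] mult.commute)
  then show "(LINT t|scalar_spectral_measure E (E B h). t - \<kappa>) = 0" by (simp add: y_def)
qed

text \<open>On either side of \<kappa> the function \<open>t - \<kappa>\<close> has a strict sign,
  yet it integrates to zero against the component of \<open>h\<close> living there; so both
  components vanish.\<close>

lemma spectral_resolution_eigenvector:
  fixes D :: "'h::chilbert_space \<Rightarrow> 'h"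
  assumes sa: "selfadjoint_on domD D" and R: "spectral_resolution domD D E"
    and h: "h \<in> domD" "D h = complex_of_real \<kappa> *\<^sub>C h"
  shows "E {\<kappa>} h = h"
proof -
  have E: "spectral_measure E" using R by (simp add: spectral_resolution_def)
  interpret fm: finite_measure "scalar_spectral_measure E x" for x
    by (rule finite_scalar_spectral_measure[OF E])
  have zero: "E B h = 0" if B: "B \<in> sets borel" and s: "s \<noteq> 0" "\<And>t. t \<in> B \<Longrightarrow> s * (t - \<kappa>) > 0" for B and s :: real
  proof -
    let ?M = "scalar_spectral_measure E (E B h)"
    note C = spectral_resolution_eigenvector_component[OF sa R h B]
    have AEB: "AE t in ?M. t \<in> B"
      by (rule AE_scalar_spectral_measure[OF E B spectral_measure_idem[OF E B]])
    have int: "integrable ?M (\<lambda>t. s * (t - \<kappa>))" using C(1) by simp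
    have "(LINT t|?M. s * (t - \<kappa>)) = 0" using C(2) by simp
    moreover have "AE t in ?M. 0 \<le> s * (t - \<kappa>)" using AEB by eventually_elim (simp add: s(2) less_imp_le)
    ultimately have "AE t in ?M. s * (t - \<kappa>) = 0"
      using integral_nonneg_eq_0_iff_AE[OF int] by simp
    with AEB have "AE t in ?M. False"
      by eventually_elim (use s(2) in force)
    then have "emeasure ?M (space ?M) = 0" by (simp add: eventually_False ae_filter_eq_bot_iff)
    then show ?thesis
      using measure_scalar_spectral_measure_UNIV[OF E, of "E B h"]
      by (simp add: scalar_spectral_measure_sets[OF E] measure_def)
  qed
  have "E {\<kappa><..} h = 0" by (rule zero[of _ 1]) auto
  moreover have "E {..<\<kappa>} h = 0" by (rule zero[of _ "-1"]) auto
  moreover have "E ({\<kappa><..} \<union> {..<\<kappa>}) h = E {\<kappa><..} h + E {..<\<kappa>} h"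
    by (rule spectral_measure_Un[OF E]) auto
  moreover have "{\<kappa><..} \<union> {..<\<kappa>} = - {\<kappa>}" by auto
  ultimately show ?thesis using spectral_measure_compl[OF E, of "{\<kappa>}" h] by simp
qed

text \<open>The form of \<open>T\<close> splits along \<open>P = E {\<kappa>}\<close> and is
  \<open>G \<kappa>\<close> times the squared norm on the range. Polarizing with \<open>v\<close>
  and with i times \<open>v\<close> removes the cross terms, so \<open>T h\<close> stays in the
  range of \<open>P\<close>.\<close>

lemma spectral_integral_eigenvector:
  fixes T :: "'h::chilbert_space \<Rightarrow> 'h" and G :: "real \<Rightarrow> real"
  assumes E: "spectral_measure E" and I: "spectral_integral E (\<lambda>t. complex_of_real (G t)) T"
    and h: "E {\<kappa>} h = h" and G: "G \<in> borel_measurable borel" "bounded (range G)"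
  shows "T h = complex_of_real (G \<kappa>) *\<^sub>C h"
proof -
  have T: "bounded_clinear T" and form: "cinner x (T x) = complex_of_real (LINT t|scalar_spectral_measure E x. G t)" for x
    using I by (auto simp: spectral_integral_def)
  interpret fm: finite_measure "scalar_spectral_measure E x" for x
    by (rule finite_scalar_spectral_measure[OF E])
  have int: "integrable (scalar_spectral_measure E x) G" for x
  proof -
    obtain K where "\<And>t. norm (G t) \<le> K" using G(2) unfolding bounded_iff by auto
    then show ?thesis
      using G(1) by (intro fm.integrable_const_bound[of _ K])
        (auto simp: measurable_cong_sets[OF scalar_spectral_measure_sets(1)[OF E] refl])
  qed
  define P where "P = E {\<kappa>}"
  have P: "is_projection P" unfolding P_def by (rule spectral_measure_projection[OF E]) simp
  note PD = is_projectionD[OF P]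
  have split: "cinner x (T x) = cinner (P x) (T (P x)) + cinner (x - P x) (T (x - P x))" for x
  proof -
    have "E (- {\<kappa>}) x = x - P x"
      using spectral_measure_compl[OF E, of "{\<kappa>}" x] by (simp add: P_def eq_diff_eq add.commute)
    then show ?thesis
      using integral_restrict(2)[OF E _ int[of x], of "{\<kappa>}"] by (simp add: form P_def)
  qed
  have onP: "cinner (P x) (T (P x)) = complex_of_real (G \<kappa> * (norm (P x))\<^sup>2)" for x
  proof -
    let ?M = "scalar_spectral_measure E (P x)"
    have "AE t in ?M. t \<in> {\<kappa>}"
      by (rule AE_scalar_spectral_measure[OF E]) (use PD(3)[of x] in \<open>auto simp: P_def\<close>)
    then have "AE t in ?M. G t = G \<kappa>" by eventually_elim simp
    then have "(LINT t|?M. G t) = (LINT t|?M. G \<kappa>)"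
      using int by (intro integral_cong_AE) auto
    then show ?thesis
      using measure_scalar_spectral_measure_UNIV[OF E, of "P x"]
      by (simp add: form scalar_spectral_measure_sets[OF E] mult.commute)
  qed
  have Ph: "P h = h" using h by (simp add: P_def)
  have "P \<circ> T \<circ> P = (\<lambda>x. complex_of_real (G \<kappa>) *\<^sub>C P x)"
  proof (rule quadratic_form_ext)
    fix x
    have "cinner x ((P \<circ> T \<circ> P) x) = cinner (P x) (T (P x))" by (simp add: PD(2))
    also have "\<dots> = complex_of_real (G \<kappa>) * cinner x (P x)"
      by (simp add: onP is_projection_norm[OF P])
    finally show "cinner x ((P \<circ> T \<circ> P) x) = cinner x (complex_of_real (G \<kappa>) *\<^sub>C P x)"
      by (simp add: cinner_simps)
  qed (intro bounded_clinear_compose bounded_clinear_scaleC_op PD(1) T)+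
  from fun_cong[OF this, of h] have PTh: "P (T h) = complex_of_real (G \<kappa>) *\<^sub>C h" by (simp add: Ph)
  have cross: "cinner v (T h) + cinner h (T v) = 0" if "P v = 0" for v
  proof -
    have "P (h + v) = h" using that Ph by (simp add: bounded_clinear_simps[OF PD(1)])
    then show ?thesis
      using split[of "h + v"] by (simp add: bounded_clinear_simps[OF T] cinner_simps)
  qed
  have "cinner v (T h) = 0" if v: "P v = 0" for v
  proof -
    have "P (\<i> *\<^sub>C v) = 0" using v by (simp add: bounded_clinear_simps[OF PD(1)])
    from cross[OF this] have "\<i> * (cinner h (T v) - cinner v (T h)) = 0"
      by (simp add: bounded_clinear_simps[OF T] cinner_simps algebra_simps)
    then show ?thesis using cross[OF v] by simp
  qed
  moreover have "P (T h - P (T h)) = 0" by (simp add: bounded_clinear_simps[OF PD(1)] PD(3))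
  moreover have "cinner (T h - P (T h)) (P (T h)) = 0"
    by (simp add: cinner_simps PD(2,3))
  ultimately have "cinner (T h - P (T h)) (T h - P (T h)) = 0"
    by (simp add: cinner_diff_right)
  then have "T h = P (T h)" by (simp add: cinner_self)
  then show ?thesis using PTh by simp
qed

section \<open>Functional calculus of a diagonal operator\<close>

lemma diag_op_is_projection:
  assumes h: "orthonormal_basis h" and a: "\<And>m. a m = 0 \<or> a m = 1"
  shows "is_projection (diag_op h a)"
proof -
  have b: "\<bar>a m\<bar> \<le> 1" for m using a[of m] by auto
  have "(\<lambda>m. a m * a m) = a" using a by (intro ext) (metis mult.right_neutral mult_zero_right)
  then show ?thesis
    unfolding is_projection_def selfadjoint_op_def
    using diag_op_bounded_clinear[OF h, of a 1, OF b] diag_op_symmetric[OF h, of a 1, OF b]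
      diag_op_compose[OF h, of a 1 a 1, OF b b] by simp
qed

definition diag_measure :: "(nat \<Rightarrow> 'h::chilbert_space) \<Rightarrow> (nat \<Rightarrow> real) \<Rightarrow> real set \<Rightarrow> 'h \<Rightarrow> 'h" where
  "diag_measure h lam B = diag_op h (\<lambda>m. indicator B (lam m))"

context
  fixes h :: "nat \<Rightarrow> 'h::chilbert_space" and lam :: "nat \<Rightarrow> real"
  assumes h: "orthonormal_basis h"
begin

lemma cinner_diag_measure:
  "cinner (h m) (diag_measure h lam B x) = complex_of_real (indicator B (lam m)) * cinner (h m) x"
  unfolding diag_measure_def
  by (subst cinner_diag_op[OF h, of _ 1]) (auto simp: indicator_def)

lemma spectral_measure_diag: "spectral_measure (diag_measure h lam)"
  unfolding spectral_measure_def
proof (intro conjI ballI allI impI)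
  fix B :: "real set"
  show "is_projection (diag_measure h lam B)"
    unfolding diag_measure_def by (rule diag_op_is_projection[OF h]) (auto simp: indicator_def)
next
  show "diag_measure h lam UNIV = id"
    by (intro ext orthonormal_basis_ext[OF h]) (simp add: cinner_diag_measure)
next
  fix B C :: "real set"
  show "diag_measure h lam (B \<inter> C) = diag_measure h lam B \<circ> diag_measure h lam C"
    by (intro ext orthonormal_basis_ext[OF h]) (simp add: cinner_diag_measure indicator_inter_arith mult.assoc)
next
  fix B :: "nat \<Rightarrow> real set" and x
  assume B: "range B \<subseteq> sets borel \<and> disjoint_family B"
  \<comment> \<open>The part of the union missed by the first \<open>n\<close> sets; by disjointness
    it is again an indicator, hence bounded by 1.\<close>
  define a where "a = (\<lambda>n m. indicator (\<Union>j. B j) (lam m) - (\<Sum>j<n. indicator (B j) (lam m)) :: real)"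
  have S: "(\<Sum>j<n. indicator (B j) t) = (indicator (\<Union>j<n. B j) t :: real)" for n t
    using B by (subst indicator_UN_disjoint) (auto simp: disjoint_family_on_def)
  have ab: "\<bar>a n m\<bar> \<le> 1" for n m
    unfolding a_def S by (auto simp: indicator_def)
  have lim: "(\<lambda>n. a n m) \<longlonglongrightarrow> 0" for m
  proof (cases "\<exists>j. lam m \<in> B j")
    case True
    then obtain j where j: "lam m \<in> B j" by blast
    have "eventually (\<lambda>n. a n m = 0) sequentially"
      using eventually_gt_at_top[of j]
    proof eventually_elim
      case (elim n)
      then show ?case using j unfolding a_def S by (auto simp: indicator_def)
    qed
    then show ?thesis by (simp add: tendsto_eventually)
  next
    case False
    then have "a n m = 0" for n unfolding a_def by simp
    then show ?thesis by simp
  qed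
  have eq: "diag_measure h lam (\<Union>j. B j) x - (\<Sum>j<n. diag_measure h lam (B j) x) = diag_op h (a n) x" for n
  proof (rule orthonormal_basis_ext[OF h])
    fix m
    have "cinner (h m) (diag_measure h lam (\<Union>j. B j) x - (\<Sum>j<n. diag_measure h lam (B j) x)) =
        complex_of_real (a n m) * cinner (h m) x"
      unfolding cinner_diff_right cinner_sum_right cinner_diag_measure a_def
      by (simp only: of_real_diff of_real_sum left_diff_distrib sum_distrib_right)
    then show "cinner (h m) (diag_measure h lam (\<Union>j. B j) x - (\<Sum>j<n. diag_measure h lam (B j) x)) =
        cinner (h m) (diag_op h (a n) x)"
      by (simp only: cinner_diag_op[OF h, of "a n" 1, OF ab])
  qed
  have "(\<lambda>n. diag_measure h lam (\<Union>j. B j) x - diag_op h (a n) x) \<longlonglongrightarrow> diag_measure h lam (\<Union>j. B j) x - 0"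
    by (intro tendsto_diff tendsto_const diag_op_tendsto[OF h, of a 1, OF ab lim])
  then show "(\<lambda>j. diag_measure h lam (B j) x) sums diag_measure h lam (\<Union>j. B j) x"
    unfolding sums_def by (simp add: eq[symmetric])
qed

text \<open>Mass \<open>(cmod (cinner (h m) x))\<^sup>2\<close> sits at \<open>lam m\<close>, so
  integrals against this measure become series over \<open>m\<close>.\<close>

lemma scalar_spectral_measure_diag:
  "scalar_spectral_measure (diag_measure h lam) x =
    distr (density (count_space UNIV) (\<lambda>m. ennreal ((cmod (cinner (h m) x))\<^sup>2))) borel lam"
proof (rule measure_eqI)
  fix B assume "B \<in> sets (scalar_spectral_measure (diag_measure h lam) x)"
  then have B: "B \<in> sets borel" by (simp add: scalar_spectral_measure_sets[OF spectral_measure_diag])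
  have s: "(\<lambda>m. (indicator B (lam m))\<^sup>2 * (cmod (cinner (h m) x))\<^sup>2) sums (norm (diag_measure h lam B x))\<^sup>2"
    unfolding diag_measure_def by (rule norm_sq_diag_op[OF h, of _ 1]) (auto simp: indicator_def)
  have "emeasure (distr (density (count_space UNIV) (\<lambda>m. ennreal ((cmod (cinner (h m) x))\<^sup>2))) borel lam) B =
      emeasure (density (count_space UNIV) (\<lambda>m. ennreal ((cmod (cinner (h m) x))\<^sup>2))) (lam -` B)"
    using B by (subst emeasure_distr) auto
  also have "\<dots> = (\<integral>\<^sup>+ m. ennreal ((cmod (cinner (h m) x))\<^sup>2) * indicator (lam -` B) m \<partial>count_space UNIV)"
    by (subst emeasure_density) auto
  also have "\<dots> = (\<Sum>m. ennreal ((indicator B (lam m))\<^sup>2 * (cmod (cinner (h m) x))\<^sup>2))"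
    by (subst nn_integral_count_space_nat) (auto intro!: suminf_cong simp: indicator_def)
  also have "\<dots> = ennreal ((norm (diag_measure h lam B x))\<^sup>2)"
    using s by (subst suminf_ennreal2) (auto simp: sums_iff)
  finally show "emeasure (scalar_spectral_measure (diag_measure h lam) x) B =
      emeasure (distr (density (count_space UNIV) (\<lambda>m. ennreal ((cmod (cinner (h m) x))\<^sup>2))) borel lam) B"
    by (simp add: emeasure_scalar_spectral_measure[OF spectral_measure_diag B])
qed (simp add: scalar_spectral_measure_sets[OF spectral_measure_diag])

lemma integrable_diag_measure:
  fixes f :: "real \<Rightarrow> real"
  assumes "f \<in> borel_measurable borel"
  shows "integrable (scalar_spectral_measure (diag_measure h lam) x) f \<longleftrightarrow>
    summable (\<lambda>m. \<bar>f (lam m)\<bar> * (cmod (cinner (h m) x))\<^sup>2)"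
  unfolding scalar_spectral_measure_diag
  by (subst integrable_distr_eq[OF _ assms], simp, subst integrable_density)
     (auto simp: integrable_count_space_nat_iff abs_mult mult.commute)

lemma integral_diag_measure:
  fixes f :: "real \<Rightarrow> real"
  assumes f: "f \<in> borel_measurable borel"
    and s: "summable (\<lambda>m. \<bar>f (lam m)\<bar> * (cmod (cinner (h m) x))\<^sup>2)"
  shows "(LINT t|scalar_spectral_measure (diag_measure h lam) x. f t) =
    (\<Sum>m. f (lam m) * (cmod (cinner (h m) x))\<^sup>2)"
proof -
  have "(LINT t|scalar_spectral_measure (diag_measure h lam) x. f t) =
      (LINT m|count_space UNIV. (cmod (cinner (h m) x))\<^sup>2 *\<^sub>R f (lam m))"
    unfolding scalar_spectral_measure_diag
    by (subst integral_distr[OF _ f], simp, subst integral_density) auto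
  also have "\<dots> = (\<Sum>m. (cmod (cinner (h m) x))\<^sup>2 *\<^sub>R f (lam m))"
    by (rule integral_count_space_nat) (use s in \<open>simp add: integrable_count_space_nat_iff abs_mult mult.commute\<close>)
  finally show ?thesis by (simp add: mult.commute)
qed

text \<open>The domain is found from the maximality of a selfadjoint operator: if the weighted
  squares are summable, the candidate \<open>z\<close> for \<open>D x\<close> satisfies the adjoint
  relation against all of \<open>domD\<close>, which puts \<open>x\<close> into
  \<open>domD\<close>.\<close>

lemma spectral_resolution_diag:
  fixes D :: "'h \<Rightarrow> 'h"
  assumes sa: "selfadjoint_on domD D" and eig: "\<And>m. h m \<in> domD \<and> D (h m) = complex_of_real (lam m) *\<^sub>C h m"
  shows "spectral_resolution domD D (diag_measure h lam)"
proof -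
  note os = orthonormal_basisD(1)[OF h]
  have c: "cinner (h m) (D x) = complex_of_real (lam m) * cinner (h m) x" if "x \<in> domD" for m x
  proof -
    have "cinner (D (h m)) x = cinner (h m) (D x)" using sa eig that unfolding selfadjoint_on_def by blast
    then show ?thesis using eig[of m] by (simp add: cinner_simps)
  qed
  have s2: "(\<lambda>m. (lam m)\<^sup>2 * (cmod (cinner (h m) x))\<^sup>2) sums (norm (D x))\<^sup>2" if "x \<in> domD" for x
    using parseval[OF h, of "D x"] by (simp add: c[OF that] norm_mult power_mult_distrib)
  have sq: "integrable (scalar_spectral_measure (diag_measure h lam) x) (\<lambda>t. t\<^sup>2) \<longleftrightarrow>
      summable (\<lambda>m. (lam m)\<^sup>2 * (cmod (cinner (h m) x))\<^sup>2)" for x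
    by (subst integrable_diag_measure) auto
  have "x \<in> domD" if x: "summable (\<lambda>m. (lam m)\<^sup>2 * (cmod (cinner (h m) x))\<^sup>2)" for x
  proof -
    define z where "z = (\<Sum>m. (complex_of_real (lam m) * cinner (h m) x) *\<^sub>C h m)"
    have z: "cinner (h m) z = complex_of_real (lam m) * cinner (h m) x" for m
      unfolding z_def
      using cinner_orthonormal_suminf[OF os, of "\<lambda>m. complex_of_real (lam m) * cinner (h m) x" m] x
        orthonormal_basis_nonzero[OF h] by (simp add: norm_mult power_mult_distrib)
    have "cinner (D x') x = cinner x' z" if x': "x' \<in> domD" for x'
    proof (rule sums_unique2[OF parseval_cinner[OF h]])
      have "cinner (D x') (h m) * cinner (h m) x = cinner x' (h m) * cinner (h m) z" for m
      proof -
        have "cinner (D x') (h m) = complex_of_real (lam m) * cinner x' (h m)"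
          by (subst cinner_commute) (simp add: c[OF x'], metis cinner_commute complex_cnj_cnj)
        then show ?thesis by (simp add: z)
      qed
      then show "(\<lambda>m. cinner (D x') (h m) * cinner (h m) x) sums cinner x' z"
        using parseval_cinner[OF h, of x' z] by simp
    qed
    then show ?thesis using sa unfolding selfadjoint_on_def by blast
  qed
  then have dom: "domD = {x. integrable (scalar_spectral_measure (diag_measure h lam) x) (\<lambda>t. t\<^sup>2)}"
    unfolding sq using s2 by (auto simp: sums_iff)
  have form: "cinner x (D x) = complex_of_real (LINT t|scalar_spectral_measure (diag_measure h lam) x. t)"
    if x: "x \<in> domD" for x
  proof -
    have "summable (\<lambda>m. (1 + (lam m)\<^sup>2) * (cmod (cinner (h m) x))\<^sup>2)"
      unfolding distrib_right mult_1
      by (intro summable_add summable_bessel os sums_summable[OF s2[OF x]])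
    then have s: "summable (\<lambda>m. \<bar>lam m\<bar> * (cmod (cinner (h m) x))\<^sup>2)"
    proof (rule summable_comparison_test'[where N = 0])
      fix m
      have "0 \<le> (\<bar>lam m\<bar> - 1)\<^sup>2" by simp
      then have "2 * \<bar>lam m\<bar> \<le> (lam m)\<^sup>2 + 1" by (simp add: power2_diff)
      then have "\<bar>lam m\<bar> \<le> 1 + (lam m)\<^sup>2" by simp
      then show "norm (\<bar>lam m\<bar> * (cmod (cinner (h m) x))\<^sup>2) \<le> (1 + (lam m)\<^sup>2) * (cmod (cinner (h m) x))\<^sup>2"
        by (simp add: mult_right_mono)
    qed
    then have s': "summable (\<lambda>m. lam m * (cmod (cinner (h m) x))\<^sup>2)"
      using summable_rabs_cancel[of "\<lambda>m. lam m * (cmod (cinner (h m) x))\<^sup>2"] by (simp add: abs_mult)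
    have "cinner x (h m) * cinner (h m) (D x) = complex_of_real (lam m * (cmod (cinner (h m) x))\<^sup>2)" for m
    proof -
      have "cinner x (h m) * cinner (h m) (D x) = complex_of_real (lam m) * (cinner (h m) x * cinner x (h m))"
        by (simp add: c[OF x])
      also have "\<dots> = complex_of_real (lam m * (cmod (cinner (h m) x))\<^sup>2)"
        by (simp only: cinner_norm_sq of_real_mult)
      finally show ?thesis .
    qed
    then have "(\<lambda>m. complex_of_real (lam m * (cmod (cinner (h m) x))\<^sup>2)) sums cinner x (D x)"
      using parseval_cinner[OF h, of x "D x"] by simp
    moreover have "(\<lambda>m. complex_of_real (lam m * (cmod (cinner (h m) x))\<^sup>2)) sums
        complex_of_real (\<Sum>m. lam m * (cmod (cinner (h m) x))\<^sup>2)"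
      by (intro sums_of_real summable_sums s')
    ultimately have "cinner x (D x) = complex_of_real (\<Sum>m. lam m * (cmod (cinner (h m) x))\<^sup>2)"
      by (rule sums_unique2)
    then show ?thesis using s by (subst integral_diag_measure) auto
  qed
  show ?thesis
    unfolding spectral_resolution_def by (intro conjI ballI spectral_measure_diag dom form)
qed

text \<open>\<open>diag_measure\<close> witnesses existence. Any other resolution yields a bounded
  operator with the same values on every \<open>h m\<close>, hence the same operator.\<close>

lemma borel_calc_diag:
  fixes D :: "'h \<Rightarrow> 'h" and G :: "real \<Rightarrow> real"
  assumes sa: "selfadjoint_on domD D" and eig: "\<And>m. h m \<in> domD \<and> D (h m) = complex_of_real (lam m) *\<^sub>C h m"
    and G: "G \<in> borel_measurable borel" "bounded (range G)"
  shows "borel_calc domD D (\<lambda>t. complex_of_real (G t)) = diag_op h (\<lambda>m. G (lam m))"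
proof -
  obtain K where "\<And>t. norm (G t) \<le> K" using G(2) unfolding bounded_iff by auto
  then have K: "\<bar>G (lam m)\<bar> \<le> K" for m by simp
  show ?thesis
    unfolding borel_calc_def
  proof (rule the_equality)
    have "spectral_integral (diag_measure h lam) (\<lambda>t. complex_of_real (G t)) (diag_op h (\<lambda>m. G (lam m)))"
      unfolding spectral_integral_def
    proof (intro conjI allI)
      show "bounded_clinear (diag_op h (\<lambda>m. G (lam m)))" by (rule diag_op_bounded_clinear[OF h K])
      fix x
      have s: "summable (\<lambda>m. \<bar>G (lam m)\<bar> * (cmod (cinner (h m) x))\<^sup>2)"
      proof (rule summable_comparison_test'[where N = 0])
        show "summable (\<lambda>m. K * (cmod (cinner (h m) x))\<^sup>2)"
          by (intro summable_mult summable_bessel orthonormal_basisD(1)[OF h])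
      qed (use K in \<open>simp add: mult_right_mono\<close>)
      have "summable (\<lambda>m. G (lam m) * (cmod (cinner (h m) x))\<^sup>2)"
        using s summable_rabs_cancel[of "\<lambda>m. G (lam m) * (cmod (cinner (h m) x))\<^sup>2"]
        by (simp add: abs_mult)
      then have "(\<lambda>m. complex_of_real (G (lam m) * (cmod (cinner (h m) x))\<^sup>2)) sums
          complex_of_real (\<Sum>m. G (lam m) * (cmod (cinner (h m) x))\<^sup>2)"
        by (intro sums_of_real summable_sums)
      with diag_op_form[OF h, of "\<lambda>m. G (lam m)" K x, OF K]
      have "cinner x (diag_op h (\<lambda>m. G (lam m)) x) = complex_of_real (\<Sum>m. G (lam m) * (cmod (cinner (h m) x))\<^sup>2)"
        by (rule sums_unique2)
      then show "cinner x (diag_op h (\<lambda>m. G (lam m)) x) =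
          (LINT t|scalar_spectral_measure (diag_measure h lam) x. complex_of_real (G t))"
        unfolding integral_complex_of_real by (simp only: integral_diag_measure[OF G(1) s])
    qed
    then show "\<exists>E. spectral_resolution domD D E \<and>
        spectral_integral E (\<lambda>t. complex_of_real (G t)) (diag_op h (\<lambda>m. G (lam m)))"
      by (intro exI[of _ "diag_measure h lam"] conjI spectral_resolution_diag[OF sa eig])
  next
    fix T assume "\<exists>E. spectral_resolution domD D E \<and> spectral_integral E (\<lambda>t. complex_of_real (G t)) T"
    then obtain E where R: "spectral_resolution domD D E" and I: "spectral_integral E (\<lambda>t. complex_of_real (G t)) T"
      by blast
    have E: "spectral_measure E" using R by (simp add: spectral_resolution_def)
    show "T = diag_op h (\<lambda>m. G (lam m))"
    proof (rule diag_op_eqI[OF h _ K])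
      show "bounded_clinear T" using I by (simp add: spectral_integral_def)
      fix m
      have "E {lam m} (h m) = h m"
        by (rule spectral_resolution_eigenvector[OF sa R]) (use eig[of m] in auto)
      then show "T (h m) = complex_of_real (G (lam m)) *\<^sub>C h m"
        by (rule spectral_integral_eigenvector[OF E I _ G])
    qed
  qed
qed

end

section \<open>Multiplication operators\<close>

context
  fixes M :: "'f measure" and U :: "'h::chilbert_space \<Rightarrow> 'f \<Rightarrow> complex"
  assumes U: "unitary_to_L2 M U"
begin

lemma unitary_L2: "U x \<in> borel_measurable M" "integrable M (\<lambda>t. (cmod (U x t))\<^sup>2)"
  using U by (auto simp: unitary_to_L2_def L2_fun_def)

lemma unitary_add: "AE t in M. U (x + y) t = U x t + U y t"
  and unitary_scaleC: "AE t in M. U (c *\<^sub>C x) t = c * U x t"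
  and unitary_cinner: "cinner x y = (LINT t|M. cnj (U x t) * U y t)"
  and unitary_surj: "f \<in> L2_fun M \<Longrightarrow> \<exists>x. AE t in M. U x t = f t"
  using U by (auto simp: unitary_to_L2_def)

lemma cinner_unitary_eq:
  assumes "AE t in M. U x t = f t" "AE t in M. U y t = g t"
    "f \<in> borel_measurable M" "g \<in> borel_measurable M"
  shows "cinner x y = (LINT t|M. cnj (f t) * g t)"
  unfolding unitary_cinner
proof (rule integral_cong_AE)
  show "AE t in M. cnj (U x t) * U y t = cnj (f t) * g t"
    using assms(1,2) by eventually_elim simp
qed (use assms(3,4) unitary_L2(1) in \<open>auto intro!: borel_measurable_times
      measurable_compose[OF _ borel_measurable_continuous_onI[OF continuous_on_cnj[OF continuous_on_id]]]\<close>)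

lemma norm_sq_unitary_eq:
  assumes "AE t in M. U x t = f t" "f \<in> borel_measurable M"
  shows "(norm x)\<^sup>2 = (LINT t|M. (cmod (f t))\<^sup>2)"
proof -
  have "complex_of_real ((norm x)\<^sup>2) = (LINT t|M. complex_of_real ((cmod (f t))\<^sup>2))"
    unfolding cinner_self[symmetric] cinner_unitary_eq[OF assms(1,1,2,2)]
    by (simp add: complex_norm_square mult.commute del: of_real_power)
  also have "\<dots> = complex_of_real (LINT t|M. (cmod (f t))\<^sup>2)" by (rule integral_complex_of_real)
  finally show ?thesis by (simp only: of_real_eq_iff)
qed

text \<open>\<open>U\<close> picks representatives and is linear almost everywhere only; injectivity
  follows from the isometry applied to the difference.\<close>

lemma unitary_ext:
  assumes "AE t in M. U x t = U y t"
  shows "x = y"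
proof -
  have "AE t in M. U (x + (- 1) *\<^sub>C y) t = 0"
    using unitary_add[of x "(- 1) *\<^sub>C y"] unitary_scaleC[of "- 1" y] assms by eventually_elim simp
  then have "(norm (x + (- 1) *\<^sub>C y))\<^sup>2 = 0"
    by (subst norm_sq_unitary_eq[where f = "\<lambda>_. 0"]) auto
  then show ?thesis by (simp add: scaleC_minus_one)
qed

text \<open>Justifies the definite description: boundedness of \<open>f\<close> keeps the product
  square integrable, surjectivity gives a preimage, and \<open>unitary_ext\<close> makes it
  unique.\<close>

lemma mult_op_AE:
  assumes f: "f \<in> Linf_fun M"
  shows "AE t in M. U (mult_op M U f x) t = f t * U x t"
proof -
  have fm: "f \<in> borel_measurable M" using f by (simp add: Linf_fun_def)
  obtain C where C: "AE t in M. cmod (f t) \<le> C" using f by (auto simp: Linf_fun_def)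
  note m = unitary_L2(1)[of x]
  have "(\<lambda>t. f t * U x t) \<in> L2_fun M"
    unfolding L2_fun_def
  proof (intro CollectI conjI)
    show "integrable M (\<lambda>t. (cmod (f t * U x t))\<^sup>2)"
    proof (rule Bochner_Integration.integrable_bound)
      show "integrable M (\<lambda>t. C\<^sup>2 * (cmod (U x t))\<^sup>2)" using unitary_L2(2)[of x] by simp
      show "AE t in M. norm ((cmod (f t * U x t))\<^sup>2) \<le> norm (C\<^sup>2 * (cmod (U x t))\<^sup>2)"
        using C by eventually_elim (auto simp: norm_mult power_mult_distrib intro!: mult_right_mono power_mono)
    qed (use fm m in measurable)
  qed (use fm m in measurable)
  then obtain y where y: "AE t in M. U y t = f t * U x t" using unitary_surj by blast
  have "mult_op M U f x = y"
    unfolding mult_op_def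
  proof (rule the_equality[where P = "\<lambda>y. AE t in M. U y t = f t * U x t", OF y])
    fix z assume "AE t in M. U z t = f t * U x t"
    with y have "AE t in M. U z t = U y t" by eventually_elim simp
    then show "z = y" by (rule unitary_ext)
  qed
  then show ?thesis using y by simp
qed

lemma mult_op_eqI:
  assumes f: "f \<in> Linf_fun M" and y: "AE t in M. U y t = f t * U x t"
  shows "mult_op M U f x = y"
  by (rule unitary_ext) (use mult_op_AE[OF f, of x] y in eventually_elim, simp)

lemma mult_op_cong:
  assumes "f \<in> Linf_fun M" "g \<in> Linf_fun M" "AE t in M. f t = g t"
  shows "mult_op M U f = mult_op M U g"
  by (intro ext mult_op_eqI[OF assms(1)]) (use mult_op_AE[OF assms(2)] assms(3) in eventually_elim, simp)

definition mult_proj :: "'f set \<Rightarrow> 'h \<Rightarrow> 'h" where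
  "mult_proj J = mult_op M U (indicator J)"

lemma indicator_Linf: "J \<in> sets M \<Longrightarrow> indicator J \<in> Linf_fun M"
  unfolding Linf_fun_def by (auto intro!: exI[of _ 1] simp: indicator_def)

lemma mult_proj_AE: "J \<in> sets M \<Longrightarrow> AE t in M. U (mult_proj J x) t = indicator J t * U x t"
  unfolding mult_proj_def by (rule mult_op_AE[OF indicator_Linf])

lemma mult_proj_eqI: "J \<in> sets M \<Longrightarrow> AE t in M. U y t = indicator J t * U x t \<Longrightarrow> mult_proj J x = y"
  unfolding mult_proj_def by (rule mult_op_eqI[OF indicator_Linf])

lemma norm_sq_mult_proj:
  assumes "J \<in> sets M"
  shows "(norm (mult_proj J x))\<^sup>2 = (LINT t:J|M. (cmod (U x t))\<^sup>2)"
proof -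
  have "(norm (mult_proj J x))\<^sup>2 = (LINT t|M. (cmod (indicator J t * U x t))\<^sup>2)"
    by (rule norm_sq_unitary_eq[OF mult_proj_AE[OF assms]])
       (use assms unitary_L2(1) in \<open>auto intro!: borel_measurable_times\<close>)
  also have "\<dots> = (LINT t:J|M. (cmod (U x t))\<^sup>2)"
    unfolding set_lebesgue_integral_def
    by (rule Bochner_Integration.integral_cong) (auto simp: indicator_def)
  finally show ?thesis .
qed

lemma mult_proj_proj:
  assumes "J \<in> sets M" "K \<in> sets M"
  shows "mult_proj J (mult_proj K x) = mult_proj (J \<inter> K) x"
  by (rule mult_proj_eqI[OF assms(1)])
     (use mult_proj_AE[OF assms(2), of x] mult_proj_AE[OF sets.Int[OF assms], of x] in
       \<open>eventually_elim, simp add: indicator_inter_arith\<close>)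

lemma mult_proj_symmetric:
  assumes J: "J \<in> sets M"
  shows "cinner (mult_proj J x) y = cinner x (mult_proj J y)"
proof -
  have m: "(\<lambda>t. indicator J t * U x t) \<in> borel_measurable M" for x
    using J unitary_L2(1) by (auto intro!: borel_measurable_times)
  have "cinner (mult_proj J x) y = (LINT t|M. cnj (indicator J t * U x t) * U y t)"
    by (rule cinner_unitary_eq[OF mult_proj_AE[OF J]]) (use m unitary_L2 in auto)
  also have "\<dots> = (LINT t|M. cnj (U x t) * (indicator J t * U y t))"
    by (rule Bochner_Integration.integral_cong) (auto simp: indicator_def)
  also have "\<dots> = cinner x (mult_proj J y)"
    by (rule cinner_unitary_eq[OF _ mult_proj_AE[OF J], symmetric]) (use m unitary_L2 in auto)
  finally show ?thesis .
qed

lemma mult_proj_projection: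
  assumes J: "J \<in> sets M"
  shows "is_projection (mult_proj J)"
proof -
  have idem: "mult_proj J (mult_proj J x) = mult_proj J x" for x using mult_proj_proj[OF J J] by simp
  have "bounded_clinear (mult_proj J)"
  proof (rule bounded_clinearI[of _ 1])
    show "mult_proj J (x + y) = mult_proj J x + mult_proj J y" for x y
      by (rule mult_proj_eqI[OF J])
         (use unitary_add[of x y] unitary_add[of "mult_proj J x" "mult_proj J y"] mult_proj_AE[OF J, of x] mult_proj_AE[OF J, of y]
           in \<open>eventually_elim, simp add: algebra_simps\<close>)
    show "mult_proj J (c *\<^sub>C x) = c *\<^sub>C mult_proj J x" for c x
      by (rule mult_proj_eqI[OF J])
         (use unitary_scaleC[of c x] unitary_scaleC[of c "mult_proj J x"] mult_proj_AE[OF J, of x]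
           in \<open>eventually_elim, simp\<close>)
    fix x
    have "(norm (mult_proj J x))\<^sup>2 = cmod (cinner x (mult_proj J x))"
    proof -
      have "cinner x (mult_proj J x) = cinner (mult_proj J x) (mult_proj J x)"
        by (simp add: mult_proj_symmetric[OF J] idem)
      then show ?thesis by (simp add: cinner_self norm_power)
    qed
    also have "\<dots> \<le> norm x * norm (mult_proj J x)" by (rule norm_cinner_le)
    finally show "norm (mult_proj J x) \<le> norm x * 1"
      by (cases "norm (mult_proj J x) = 0") (auto simp: power2_eq_square)
  qed
  then show ?thesis
    by (simp add: is_projection_def selfadjoint_op_def mult_proj_symmetric[OF J] fun_eq_iff idem)
qed

lemma mult_proj_Un:
  assumes "J \<in> sets M" "K \<in> sets M" "J \<inter> K = {}"
  shows "mult_proj (J \<union> K) x = mult_proj J x + mult_proj K x"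
  by (rule mult_proj_eqI[OF sets.Un[OF assms(1,2)]])
     (use unitary_add[of "mult_proj J x" "mult_proj K x"] mult_proj_AE[OF assms(1), of x] mult_proj_AE[OF assms(2), of x] in
       \<open>eventually_elim, use assms(3) in \<open>auto simp: indicator_def\<close>\<close>)

lemma mult_proj_null:
  assumes "J \<in> null_sets M"
  shows "mult_proj J x = 0"
proof -
  have J: "J \<in> sets M" using assms by auto
  have "AE t in M. U (mult_proj J x) t = 0"
    using mult_proj_AE[OF J, of x] AE_not_in[OF assms] by eventually_elim (simp add: indicator_def)
  then have "(norm (mult_proj J x))\<^sup>2 = (LINT t|M. (cmod 0)\<^sup>2)" by (rule norm_sq_unitary_eq) simp
  then show ?thesis by simp
qed

lemma mult_proj_empty: "mult_proj {} x = 0"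
  by (rule mult_proj_null) simp

lemma mult_proj_UN_lessThan:
  assumes "range F \<subseteq> sets M" "disjoint_family F"
  shows "mult_proj (\<Union>j<n. F j) x = (\<Sum>j<n::nat. mult_proj (F j) x)"
proof (induction n)
  case (Suc n)
  have "(\<Union>j<Suc n. F j) = F n \<union> (\<Union>j<n. F j)" by (auto simp: lessThan_Suc)
  moreover have "F n \<inter> (\<Union>j<n. F j) = {}"
    using disjoint_family_onD[OF assms(2), of n] by force
  ultimately show ?case
    using Suc assms(1) by (subst \<open>_ = F n \<union> _\<close>, subst mult_proj_Un) (auto simp: add.commute)
qed (simp add: mult_proj_empty)

text \<open>Dominated convergence: a point lies in at most one \<open>F j\<close>, so it is
  eventually outside the tails.\<close>

lemma mult_proj_tail_tendsto:
  assumes F: "range F \<subseteq> sets M" "disjoint_family F"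
  shows "(\<lambda>n. mult_proj (\<Union>j\<in>{n..}. F j) x) \<longlonglongrightarrow> 0"
proof -
  define s where "s = (\<lambda>n t. indicat_real (\<Union>j\<in>{n..}. F j) t *\<^sub>R (cmod (U x t))\<^sup>2)"
  have m: "(\<Union>j\<in>{n..}. F j) \<in> sets M" for n using F(1) by auto
  note [measurable] = unitary_L2(1)[of x] m
  have "(\<lambda>n. LINT t|M. s n t) \<longlonglongrightarrow> (LINT t|M. 0)"
  proof (rule integral_dominated_convergence[where w = "\<lambda>t. (cmod (U x t))\<^sup>2"])
    show "AE t in M. (\<lambda>n. s n t) \<longlonglongrightarrow> 0"
    proof (rule AE_I2)
      fix t
      have "\<exists>N. \<forall>j\<ge>N. t \<notin> F j"
      proof (cases "\<exists>j. t \<in> F j")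
        case True
        then obtain j where "t \<in> F j" by blast
        then have "\<forall>i\<ge>Suc j. t \<notin> F i" using disjoint_family_onD[OF F(2), of j] by force
        then show ?thesis by blast
      qed auto
      then obtain N where N: "\<And>j. j \<ge> N \<Longrightarrow> t \<notin> F j" by blast
      have "eventually (\<lambda>n. s n t = 0) sequentially"
        using eventually_ge_at_top[of N]
      proof eventually_elim
        case (elim n)
        then have "t \<notin> (\<Union>j\<in>{n..}. F j)" using N by auto
        then show ?case by (simp add: s_def)
      qed
      then show "(\<lambda>n. s n t) \<longlonglongrightarrow> 0" by (rule tendsto_eventually)
    qed
    show "integrable M (\<lambda>t. (cmod (U x t))\<^sup>2)" by (rule unitary_L2)
    show "AE t in M. norm (s n t) \<le> (cmod (U x t))\<^sup>2" for n
      by (rule AE_I2) (auto simp: s_def indicator_def)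
  qed (auto simp: s_def)
  then have "(\<lambda>n. (norm (mult_proj (\<Union>j\<in>{n..}. F j) x))\<^sup>2) \<longlonglongrightarrow> 0"
    by (simp add: norm_sq_mult_proj[OF m] set_lebesgue_integral_def s_def)
  then have "(\<lambda>n. sqrt ((norm (mult_proj (\<Union>j\<in>{n..}. F j) x))\<^sup>2)) \<longlonglongrightarrow> sqrt 0"
    by (rule tendsto_real_sqrt)
  then show ?thesis by (simp add: tendsto_norm_zero_iff)
qed

lemma mult_proj_sums:
  assumes F: "range F \<subseteq> sets M" "disjoint_family F"
  shows "(\<lambda>j. mult_proj (F j) x) sums mult_proj (\<Union>j. F j) x"
proof -
  have "mult_proj (\<Union>j. F j) x = (\<Sum>j<n. mult_proj (F j) x) + mult_proj (\<Union>j\<in>{n..}. F j) x" for n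
  proof -
    have "(\<Union>j. F j) = (\<Union>j<n. F j) \<union> (\<Union>j\<in>{n..}. F j)"
      by (auto simp: set_eq_iff) (metis atLeast_iff lessThan_iff not_less)
    moreover have "(\<Union>j<n. F j) \<inter> (\<Union>j\<in>{n..}. F j) = {}"
    proof -
      have "y \<notin> F j" if "y \<in> F i" "i < n" "n \<le> j" for y i j
        using disjoint_family_onD[OF F(2), of i j] that by auto
      then show ?thesis by auto
    qed
    moreover have "(\<Union>j<n. F j) \<in> sets M" "(\<Union>j\<in>{n..}. F j) \<in> sets M" using F(1) by auto
    ultimately show ?thesis
      using mult_proj_Un[of "\<Union>j<n. F j" "\<Union>j\<in>{n..}. F j" x] mult_proj_UN_lessThan[OF F, of n x] by simp
  qed
  then have eq: "(\<Sum>j<n. mult_proj (F j) x) = mult_proj (\<Union>j. F j) x - mult_proj (\<Union>j\<in>{n..}. F j) x" for n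
    by (simp add: eq_diff_eq)
  have "(\<lambda>n. mult_proj (\<Union>j. F j) x - mult_proj (\<Union>j\<in>{n..}. F j) x) \<longlonglongrightarrow> mult_proj (\<Union>j. F j) x - 0"
    by (intro tendsto_diff tendsto_const mult_proj_tail_tendsto F)
  then show ?thesis unfolding sums_def by (simp add: eq)
qed

text \<open>On a finite measure space the constant 1 is square integrable. Evaluating the idempotent
  on its preimage gives \<open>f * f = f\<close> almost everywhere, and \<open>J\<close> is the set
  where \<open>f\<close> equals 1.\<close>

lemma projection_mult_op:
  assumes M: "finite_measure M" and f: "f \<in> Linf_fun M" and idem: "mult_op M U f \<circ> mult_op M U f = mult_op M U f"
  obtains J where "J \<in> sets M" "mult_op M U f = mult_proj J"
proof -
  have fm: "f \<in> borel_measurable M" using f by (simp add: Linf_fun_def)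
  have "(\<lambda>_. 1) \<in> L2_fun M" using M by (simp add: L2_fun_def finite_measure.integrable_const)
  then obtain x where x: "AE t in M. U x t = 1" using unitary_surj by blast
  define J where "J = {t \<in> space M. f t = 1}"
  have J: "J \<in> sets M" unfolding J_def using fm by measurable
  have "mult_op M U f (mult_op M U f x) = mult_op M U f x" using idem by (simp add: fun_eq_iff)
  then have "AE t in M. U (mult_op M U f x) t = f t * U (mult_op M U f x) t"
    using mult_op_AE[OF f, of "mult_op M U f x"] by simp
  moreover have "AE t in M. t \<in> space M" by (rule AE_space)
  ultimately have "AE t in M. f t = indicator J t"
    using x mult_op_AE[OF f, of x] by eventually_elim (auto simp: J_def indicator_def)
  then have "mult_op M U f = mult_proj J"
    unfolding mult_proj_def by (rule mult_op_cong[OF f indicator_Linf[OF J]])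
  then show ?thesis using that J by blast
qed

text \<open>The preimage of the constant 1 detects null sets, as its projection is represented by
  the indicator of the set.\<close>

lemma mult_proj_orthogonal_null:
  assumes M: "finite_measure M" and J: "J \<in> sets M" "K \<in> sets M" and 0: "mult_proj J \<circ> mult_proj K = (\<lambda>_. 0)"
  shows "J \<inter> K \<in> null_sets M"
proof -
  have "(\<lambda>_. 1) \<in> L2_fun M" using M by (simp add: L2_fun_def finite_measure.integrable_const)
  then obtain x where x: "AE t in M. U x t = 1" using unitary_surj by blast
  have JK: "J \<inter> K \<in> sets M" using J by auto
  have z: "mult_proj (J \<inter> K) x = 0" using fun_cong[OF 0, of x] by (simp add: mult_proj_proj[OF J])
  have "AE t in M. U (0 *\<^sub>C x) t = 0 * U x t" by (rule unitary_scaleC)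
  then have "AE t in M. t \<notin> J \<inter> K"
    using x mult_proj_AE[OF JK, of x] by eventually_elim (auto simp: z indicator_def split: if_splits)
  then show ?thesis using AE_iff_null_sets[OF JK] by simp
qed

end

section \<open>Residues and singular values of compressions\<close>

context
  fixes h :: "nat \<Rightarrow> 'h::chilbert_space" and g :: "nat \<Rightarrow> real" and K :: real and P :: "'h \<Rightarrow> 'h"
  assumes h: "orthonormal_basis h" and g: "\<And>m. 0 \<le> g m" "\<And>m. g m \<le> K"
    and T: "diag_op h g \<in> L1inf_pos" and P: "is_projection P"
begin

lemma abs_g: "\<bar>g m\<bar> \<le> K"
  using g by simp

lemma abs_sqrt_g: "\<bar>sqrt (g m)\<bar> \<le> sqrt K"
  using g by simp

lemma sqrt_diag_compose: "diag_op h (\<lambda>m. sqrt (g m)) \<circ> diag_op h (\<lambda>m. sqrt (g m)) = diag_op h g"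
  using diag_op_compose[OF h, of "\<lambda>m. sqrt (g m)" "sqrt K" "\<lambda>m. sqrt (g m)" "sqrt K", OF abs_sqrt_g abs_sqrt_g] g
  by simp

lemmas sqrt_diag_bounded = diag_op_bounded_clinear[OF h, of "\<lambda>m. sqrt (g m)" "sqrt K", OF abs_sqrt_g]

lemmas sqrt_diag_symmetric = diag_op_symmetric[OF h, of "\<lambda>m. sqrt (g m)" "sqrt K", OF abs_sqrt_g]

lemma sqrt_diag_compact: "compact_op (diag_op h (\<lambda>m. sqrt (g m)))"
  by (rule compact_op_sqrt[OF sqrt_diag_bounded sqrt_diag_symmetric])
     (simp add: sqrt_diag_compose L1inf_posD(2)[OF T])

lemma compression_nonneg: "nonneg_op (P \<circ> diag_op h g \<circ> P)"
proof (rule nonneg_opI)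
  have B: "bounded_clinear (diag_op h g)" by (rule diag_op_bounded_clinear[OF h abs_g])
  show "bounded_clinear (P \<circ> diag_op h g \<circ> P)"
    by (intro bounded_clinear_compose is_projectionD(1)[OF P] B)
  fix x
  have "cinner x ((P \<circ> diag_op h g \<circ> P) x) = cinner (P x) (diag_op h g (P x))"
    by (simp add: is_projectionD(2)[OF P])
  then show "Im (cinner x ((P \<circ> diag_op h g \<circ> P) x)) = 0" "0 \<le> Re (cinner x ((P \<circ> diag_op h g \<circ> P) x))"
    using nonneg_opD[OF L1inf_posD(1)[OF T]] by simp_all
qed

lemma compression_compact: "compact_op (P \<circ> diag_op h g \<circ> P)"
  by (intro compact_op_compose_left compact_op_compose_right is_projectionD(1)[OF P] L1inf_posD(2)[OF T])

text \<open>With \<open>B\<close> the square root, the compression factors as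
  \<open>P \<circ> B\<close> after \<open>B \<circ> P\<close>, and the operator here as the same two
  factors in the other order.\<close>

lemma sqrt_compression:
  shows "nonneg_op (diag_op h (\<lambda>m. sqrt (g m)) \<circ> P \<circ> diag_op h (\<lambda>m. sqrt (g m)))" (is "nonneg_op ?Y")
    and "compact_op (diag_op h (\<lambda>m. sqrt (g m)) \<circ> P \<circ> diag_op h (\<lambda>m. sqrt (g m)))"
    and "singular_values (diag_op h (\<lambda>m. sqrt (g m)) \<circ> P \<circ> diag_op h (\<lambda>m. sqrt (g m))) =
      singular_values (P \<circ> diag_op h g \<circ> P)"
proof -
  let ?B = "diag_op h (\<lambda>m. sqrt (g m))"
  note PD = is_projectionD[OF P]
  have PB: "bounded_clinear (P \<circ> ?B)" and BP: "bounded_clinear (?B \<circ> P)"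
    by (intro bounded_clinear_compose PD(1) sqrt_diag_bounded)+
  have adj: "cinner ((?B \<circ> P) x) y = cinner x ((P \<circ> ?B) y)" for x y
    by (simp add: sqrt_diag_symmetric PD(2))
  then have adj': "cinner ((P \<circ> ?B) x) y = cinner x ((?B \<circ> P) y)" for x y
    by (metis cinner_commute)
  have X: "(P \<circ> ?B) \<circ> (?B \<circ> P) = P \<circ> diag_op h g \<circ> P"
    by (simp add: sqrt_diag_compose[symmetric] comp_assoc)
  have Y: "(?B \<circ> P) \<circ> (P \<circ> ?B) = ?Y"
    by (simp add: fun_eq_iff PD(3))
  show "nonneg_op ?Y"
    using nonneg_op_adjoint_compose[OF BP PB adj'] by (simp only: Y)
  show "compact_op ?Y"
    by (intro compact_op_compose_right[OF sqrt_diag_bounded] compact_op_compose_right[OF PD(1)] sqrt_diag_compact)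
  show "singular_values ?Y = singular_values (P \<circ> diag_op h g \<circ> P)"
    using singular_values_swap[OF PB BP adj] compression_compact by (simp only: X Y)
qed

text \<open>The weights \<open>g m * (norm (P (h m)))\<^sup>2\<close> are the diagonal entries of
  the sandwiched projection, not in general of the compression; equality of the singular values
  transfers Ky Fan's bound.\<close>

lemma sum_compression_le:
  assumes F: "finite F"
  shows "(\<Sum>m\<in>F. g m * (norm (P (h m)))\<^sup>2) \<le> kyfan (P \<circ> diag_op h g \<circ> P) (card F)"
proof -
  let ?B = "diag_op h (\<lambda>m. sqrt (g m))"
  note PD = is_projectionD[OF P]
  have Bh: "?B (h m) = complex_of_real (sqrt (g m)) *\<^sub>C h m" for m
    by (rule orthonormal_basis_ext[OF h])
       (simp add: cinner_diag_op[OF h, of "\<lambda>m. sqrt (g m)" "sqrt K", OF abs_sqrt_g] cinner_scaleC_right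
         orthonormal_sys_cinner[OF orthonormal_basisD(1)[OF h]])
  have "Re (cinner (h m) ((?B \<circ> P \<circ> ?B) (h m))) = g m * (norm (P (h m)))\<^sup>2" for m
  proof -
    have "cinner (h m) ((?B \<circ> P \<circ> ?B) (h m)) = cinner (?B (h m)) (P (?B (h m)))"
      by (simp add: sqrt_diag_symmetric)
    also have "\<dots> = complex_of_real (sqrt (g m)) * complex_of_real (sqrt (g m)) * cinner (h m) (P (h m))"
      by (simp add: Bh bounded_clinear_scaleC[OF PD(1)] cinner_simps mult.assoc)
    also have "complex_of_real (sqrt (g m)) * complex_of_real (sqrt (g m)) = complex_of_real (g m)"
      using g(1)[of m] by (simp flip: of_real_mult)
    also have "complex_of_real (g m) * cinner (h m) (P (h m)) = complex_of_real (g m * (norm (P (h m)))\<^sup>2)"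
      by (simp add: is_projection_norm[OF P])
    finally show ?thesis by simp
  qed
  then show ?thesis
    using kyfan_upper[OF sqrt_compression(1,2) orthonormal_basisD(1)[OF h] F order_refl]
    by (simp add: kyfan_def sqrt_compression(3))
qed

lemma sum_diag_le:
  assumes F: "finite F"
  shows "(\<Sum>m\<in>F. g m) \<le> kyfan (diag_op h g) (card F)"
proof -
  have "Re (cinner (h m) (diag_op h g (h m))) = g m" for m
    by (simp add: cinner_diag_op[OF h abs_g] cinner_self orthonormal_basisD(2)[OF h])
  then show ?thesis
    using kyfan_upper[OF L1inf_posD(1,2)[OF T] orthonormal_basisD(1)[OF h] F order_refl] by simp
qed

text \<open>A trial eigenvector of the compression is fixed by \<open>P\<close>; splitting the sum over \<open>m\<close> at the
  level \<open>g m = 1 / N\<close> costs at most \<open>1\<close> below it and a factor \<open>N\<^sup>\<sigma> \<le> e\<close> above it.\<close>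

lemma kyfan_compression_le:
  assumes N: "N \<ge> 1" and \<sigma>: "\<sigma> \<ge> 0" "real N powr \<sigma> \<le> exp 1"
    and s: "summable (\<lambda>m. g m powr (1 + \<sigma>) * (norm (P (h m)))\<^sup>2)"
  shows "kyfan (P \<circ> diag_op h g \<circ> P) N \<le> exp 1 * (\<Sum>m. g m powr (1 + \<sigma>) * (norm (P (h m)))\<^sup>2) + 1"
proof -
  let ?X = "P \<circ> diag_op h g \<circ> P"
  note PD = is_projectionD[OF P]
  obtain u where u: "orthonormal_sys u" "\<And>n. ?X (u n) = complex_of_real (singular_values ?X n) *\<^sub>C u n"
    "\<And>n. u n = 0 \<longleftrightarrow> singular_values ?X n = 0"
    "\<And>k. kyfan ?X k = (\<Sum>n<k. Re (cinner (u n) (?X (u n))))"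
    by (rule kyfan_attained[OF compression_nonneg compression_compact]) (rule that)
  \<comment> \<open>An eigenvector for a nonzero eigenvalue lies in the range of the compression,
    hence of \<open>P\<close>; the others are zero by convention.\<close>
  have Pu: "P (u n) = u n" for n
  proof (cases "u n = 0")
    case False
    then have nz: "complex_of_real (singular_values ?X n) \<noteq> 0" using u(3) by simp
    have "P (?X (u n)) = ?X (u n)" by (simp add: PD(3))
    then have "complex_of_real (singular_values ?X n) *\<^sub>C P (u n) = complex_of_real (singular_values ?X n) *\<^sub>C u n"
      unfolding u(2) by (simp add: bounded_clinear_scaleC[OF PD(1)])
    then have "(1 / complex_of_real (singular_values ?X n)) *\<^sub>C complex_of_real (singular_values ?X n) *\<^sub>C P (u n) =
       (1 / complex_of_real (singular_values ?X n)) *\<^sub>C complex_of_real (singular_values ?X n) *\<^sub>C u n" by simp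
    then show ?thesis using nz by (simp add: scaleC_scaleC)
  qed (simp add: bounded_clinear_zero[OF PD(1)])
  \<comment> \<open>These weights obey two bounds: by Parseval their total is at most
    \<open>N\<close>, and by Bessel \<open>q m\<close> is at most the squared norm of
    \<open>P (h m)\<close>. The first serves small \<open>g m\<close>, the second large
    ones.\<close>
  define q where "q = (\<lambda>m. \<Sum>n<N. (cmod (cinner (h m) (u n)))\<^sup>2)"
  have gq: "(\<lambda>m. g m * q m) sums kyfan ?X N"
  proof -
    have "(\<lambda>m. \<Sum>n<N. g m * (cmod (cinner (h m) (u n)))\<^sup>2) sums (\<Sum>n<N. Re (cinner (u n) (diag_op h g (u n))))"
      by (intro sums_sum diag_op_Re_form[OF h abs_g])
    moreover have "cinner (u n) (?X (u n)) = cinner (u n) (diag_op h g (u n))" for n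
      by (simp add: PD(2)[symmetric] Pu)
    ultimately show ?thesis by (simp only: u(4) q_def sum_distrib_left)
  qed
  have q1: "q sums (\<Sum>n<N. (norm (u n))\<^sup>2)"
    unfolding q_def by (intro sums_sum parseval[OF h])
  have qN: "(\<Sum>m. q m) \<le> real N"
  proof -
    have "(\<Sum>n<N. (norm (u n))\<^sup>2) \<le> (\<Sum>n<N. 1)"
      by (rule sum_mono) (rule orthonormal_sys_norm_sq_le[OF u(1)])
    then show ?thesis using sums_unique[OF q1] by simp
  qed
  have qp: "q m \<le> (norm (P (h m)))\<^sup>2" for m
  proof -
    have "cmod (cinner (h m) (u n)) = cmod (cinner (u n) (P (h m)))" for n
      by (metis PD(2) Pu cmod_cinner_commute)
    then have "q m = (\<Sum>n<N. (cmod (cinner (u n) (P (h m))))\<^sup>2)" by (simp add: q_def)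
    also have "\<dots> \<le> (norm (P (h m)))\<^sup>2" by (rule bessel[OF u(1)]) simp
    finally show ?thesis .
  qed
  have q0: "q m \<ge> 0" for m unfolding q_def by (intro sum_nonneg) simp
  have le: "g m * q m \<le> exp 1 * (g m powr (1 + \<sigma>) * (norm (P (h m)))\<^sup>2) + q m / real N" for m
  proof (cases "g m > 1 / real N")
    case True
    then have g0: "g m > 0" using N by (smt (verit) divide_nonneg_nonneg of_nat_0_le_iff)
    have "1 \<le> real N * g m" using True N by (simp add: field_simps)
    then have "1 \<le> (real N * g m) powr \<sigma>" using \<sigma> by (simp add: ge_one_powr_ge_zero)
    also have "\<dots> = real N powr \<sigma> * g m powr \<sigma>" using g0 by (simp add: powr_mult)
    also have "\<dots> \<le> exp 1 * g m powr \<sigma>" using \<sigma> by (intro mult_right_mono) auto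
    finally have "g m * 1 \<le> g m * (exp 1 * g m powr \<sigma>)" using g0 by (intro mult_left_mono) auto
    also have "\<dots> = exp 1 * g m powr (1 + \<sigma>)" using g0 by (simp add: powr_add)
    finally have "g m \<le> exp 1 * g m powr (1 + \<sigma>)" by simp
    then have "g m * q m \<le> exp 1 * g m powr (1 + \<sigma>) * (norm (P (h m)))\<^sup>2"
      using qp[of m] q0[of m] by (intro mult_mono) auto
    then show ?thesis using q0[of m] by (simp add: mult.assoc add_increasing2)
  next
    case False
    then have "g m * q m \<le> (1 / real N) * q m" using q0[of m] by (intro mult_right_mono) auto
    then show ?thesis by (simp add: add_increasing)
  qed
  have "kyfan ?X N = (\<Sum>m. g m * q m)" by (rule sums_unique[OF gq])
  also have "\<dots> \<le> (\<Sum>m. exp 1 * (g m powr (1 + \<sigma>) * (norm (P (h m)))\<^sup>2) + q m / real N)"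
    by (intro suminf_le le summable_add summable_mult summable_divide s sums_summable[OF gq] sums_summable[OF q1])
  also have "\<dots> = exp 1 * (\<Sum>m. g m powr (1 + \<sigma>) * (norm (P (h m)))\<^sup>2) + (\<Sum>m. q m) / real N"
    using s sums_summable[OF q1]
    by (simp add: suminf_add[symmetric] suminf_mult suminf_divide summable_mult summable_divide)
  also have "(\<Sum>m. q m) / real N \<le> 1" using qN N by simp
  finally show ?thesis by simp
qed

text \<open>Having \<open>n\<close> values above \<open>exp (- j)\<close> forces
  \<open>n * exp (- j) \<le> C * ln (1 + n)\<close>. Bounding the logarithm by
  \<open>2 * sqrt (1 + n)\<close> gives \<open>sqrt (1 + n) \<le> 4 * C * exp j\<close>; this square
  root is the origin of the factor 2.\<close>

lemma ln_card_level_le: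
  obtains c where "\<And>F j. finite F \<Longrightarrow> (\<And>m. m \<in> F \<Longrightarrow> g m > exp (- real j)) \<Longrightarrow> ln (1 + real (card F)) \<le> 2 * real j + c"
proof -
  obtain C0 where C0: "\<And>k. kyfan (diag_op h g) k \<le> C0 * ln (1 + real k)"
    using L1inf_pos_bound[OF T] by metis
  \<comment> \<open>At least 1, so that \<open>ln (4 * C)\<close> is nonnegative and the bound
    covers the empty set.\<close>
  define C where "C = max 1 C0"
  have C: "C \<ge> 1" "\<And>k. kyfan (diag_op h g) k \<le> C * ln (1 + real k)"
  proof -
    fix k
    have "C0 * ln (1 + real k) \<le> C * ln (1 + real k)" by (intro mult_right_mono) (auto simp: C_def)
    then show "kyfan (diag_op h g) k \<le> C * ln (1 + real k)" using C0[of k] by simp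
  qed (simp add: C_def)
  have "ln (1 + real (card F)) \<le> 2 * real j + 2 * ln (4 * C)"
    if F: "finite F" "\<And>m. m \<in> F \<Longrightarrow> g m > exp (- real j)" for F j
  proof (cases "card F = 0")
    case True
    then show ?thesis using C(1) by simp
  next
    case False
    define n where "n = real (card F)"
    have n: "n \<ge> 1" using False by (simp add: n_def)
    define r where "r = sqrt (1 + n)"
    have r: "r > 0" "r\<^sup>2 = 1 + n" using n by (auto simp: r_def)
    have lr: "ln (1 + n) = 2 * ln r" using n by (simp add: r_def ln_sqrt)
    have "n * exp (- real j) = (\<Sum>m\<in>F. exp (- real j))" by (simp add: n_def)
    also have "\<dots> \<le> (\<Sum>m\<in>F. g m)" by (rule sum_mono) (use F in \<open>auto intro: less_imp_le\<close>)
    also have "\<dots> \<le> C * ln (1 + n)" using sum_diag_le[OF F(1)] C(2)[of "card F"] by (simp add: n_def)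
    also have "\<dots> \<le> C * (2 * r)" using ln_bound[of r] r C(1) by (simp add: lr)
    finally have "n * exp (- real j) \<le> 2 * C * r" by simp
    then have n4: "2 * (n * exp (- real j)) \<le> r * (4 * C)" by simp
    have "r * (r * exp (- real j)) = r\<^sup>2 * exp (- real j)" by (simp add: power2_eq_square)
    also have "\<dots> \<le> 2 * n * exp (- real j)" using r n by (intro mult_right_mono) auto
    finally have "r * (r * exp (- real j)) \<le> r * (4 * C)" using n4 by (simp only: mult.assoc)
    then have "r * exp (- real j) \<le> 4 * C" using r(1) by simp
    then have "r \<le> 4 * C * exp (real j)" by (simp add: exp_minus field_simps)
    then have "ln r \<le> ln (4 * C * exp (real j))" using r(1) by (intro ln_mono) auto
    also have "\<dots> = ln (4 * C) + real j" using C(1) by (simp add: ln_mult)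
    finally show ?thesis using lr by (simp add: n_def)
  qed
  then show ?thesis by (rule that[of "2 * ln (4 * C)"])
qed

text \<open>Layer cake: \<open>g\<^sup>\<sigma>\<close> is comparable to the sum of \<open>(1 - r) r\<^sup>j\<close>, \<open>r = e\<^sup>-\<^sup>\<sigma>\<close>, over the levels
  \<open>e\<^sup>-\<^sup>j < g\<close>, and the mass of \<open>g m * \<parallel>P h\<^sub>m\<parallel>\<^sup>2\<close> above a level is a Ky Fan sum of the compression.\<close>

lemma residue_sum_le:
  assumes b: "b \<ge> 0" "\<And>n. kyfan (P \<circ> diag_op h g \<circ> P) n \<le> b * ln (1 + real n) + L"
  obtains c1 c0 where "c1 \<ge> 1" "\<And>F \<sigma>. finite F \<Longrightarrow> \<sigma> > 0 \<Longrightarrow>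
    (\<Sum>m\<in>F. g m powr (1 + \<sigma>) * (norm (P (h m)))\<^sup>2) \<le> c1 powr \<sigma> * (2 * b * exp \<sigma> / \<sigma> + c0)"
proof -
  obtain c where c: "\<And>F j. finite F \<Longrightarrow> (\<And>m. m \<in> F \<Longrightarrow> g m > exp (- real j)) \<Longrightarrow>
      ln (1 + real (card F)) \<le> 2 * real j + c"
    using ln_card_level_le by blast
  define c0 where "c0 = b * c + L"
  \<comment> \<open>Ensures \<open>g m \<le> c1 * exp (- J m)\<close> for the level
    \<open>J m\<close> chosen below: the factor e undoes one level step, and \<open>K\<close> covers
    level 0, where nothing but the global bound is available.\<close>
  define c1 where "c1 = max 1 K * exp 1"
  have K1: "1 \<le> max 1 K * exp 1" using mult_mono[of 1 "max 1 K" 1 "exp 1"] by simp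
  define w where "w = (\<lambda>m. g m * (norm (P (h m)))\<^sup>2)"
  have w0: "w m \<ge> 0" for m unfolding w_def using g(1) by simp
  have level: "(\<Sum>m\<in>F. w m) \<le> 2 * b * real (Suc j) + c0"
    if F: "finite F" "\<And>m. m \<in> F \<Longrightarrow> g m > exp (- real j)" for F j
  proof -
    have "(\<Sum>m\<in>F. w m) \<le> b * ln (1 + real (card F)) + L"
      using sum_compression_le[OF F(1)] b(2)[of "card F"] unfolding w_def by linarith
    \<comment> \<open>\<open>Suc j\<close> in place of \<open>j\<close> matches the derivative of
      the geometric series, summed below.\<close>
    also have "b * ln (1 + real (card F)) \<le> b * (2 * real (Suc j) + c)"
      using c[OF F] b(1) by (intro mult_left_mono) auto
    finally show ?thesis by (simp add: c0_def algebra_simps)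
  qed
  have main: "(\<Sum>m\<in>F. g m powr (1 + \<sigma>) * (norm (P (h m)))\<^sup>2) \<le> c1 powr \<sigma> * (2 * b * exp \<sigma> / \<sigma> + c0)"
    if F: "finite F" and pos: "\<And>m. m \<in> F \<Longrightarrow> g m > 0" and \<sigma>: "\<sigma> > 0" for F \<sigma>
  proof -
    define r where "r = exp (- \<sigma>)"
    have r: "0 < r" "r < 1" using \<sigma> by (auto simp: r_def)
    \<comment> \<open>The first level below \<open>g m\<close>; the geometric terms from
      \<open>J m\<close> on add up to \<open>r ^ J m / (1 - r)\<close>.\<close>
    define J where "J = (\<lambda>m. LEAST j :: nat. exp (- real j) < g m)"
    have J: "exp (- real (J m)) < g m" if "m \<in> F" for m
    proof -
      obtain j :: nat where "real j > - ln (g m)" using reals_Archimedean2 by blast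
      then have "exp (- real j) < exp (ln (g m))" by simp
      then have "exp (- real j) < g m" using pos[OF that] by simp
      then show ?thesis unfolding J_def by (rule LeastI)
    qed
    have gJ: "g m powr \<sigma> \<le> c1 powr \<sigma> * r ^ J m" if m: "m \<in> F" for m
    proof -
      have "g m \<le> c1 * exp (- real (J m))"
      proof (cases "J m")
        case 0
        have "g m \<le> max 1 K * 1" using g(2)[of m] by simp
        also have "\<dots> \<le> c1" unfolding c1_def by (intro mult_left_mono) auto
        finally show ?thesis using 0 by simp
      next
        case (Suc i)
        then have "\<not> exp (- real i) < g m" unfolding J_def using not_less_Least[of i] by (metis lessI)
        then have "g m \<le> 1 * exp (- real i)" by simp
        also have "\<dots> \<le> max 1 K * exp (- real i)" by (intro mult_right_mono) auto
        also have "exp (- real i) = exp 1 * exp (- real (J m))" by (simp add: Suc mult_exp_exp)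
        finally show ?thesis by (simp add: c1_def)
      qed
      then have "g m powr \<sigma> \<le> (c1 * exp (- real (J m))) powr \<sigma>"
        using pos[OF m] \<sigma> by (intro powr_mono2) auto
      also have "\<dots> = c1 powr \<sigma> * exp (- real (J m)) powr \<sigma>"
        using K1 by (simp add: powr_mult c1_def)
      also have "exp (- real (J m)) powr \<sigma> = r ^ J m"
        by (simp add: r_def powr_def exp_of_nat_mult[symmetric])
      finally show ?thesis .
    qed
    have geo: "(\<lambda>j. if J m \<le> j then r ^ j else 0) sums (r ^ J m / (1 - r))" for m
    proof -
      have "(\<lambda>i. r ^ J m * r ^ i) sums (r ^ J m * (1 / (1 - r)))"
        by (intro sums_mult geometric_sums) (use r in simp)
      then have "(\<lambda>i. if J m \<le> i + J m then r ^ (i + J m) else 0) sums (r ^ J m / (1 - r))"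
        by (simp add: power_add mult.commute)
      then show ?thesis by (subst (asm) sums_zero_iff_shift) auto
    qed
    have s1: "(\<lambda>j. \<Sum>m\<in>F. w m * (if J m \<le> j then r ^ j else 0)) sums (\<Sum>m\<in>F. w m * (r ^ J m / (1 - r)))"
      by (intro sums_sum sums_mult geo)
    have le1: "(\<Sum>m\<in>F. w m * (if J m \<le> j then r ^ j else 0)) \<le> 2 * b * (real (Suc j) * r ^ j) + c0 * r ^ j" for j
    proof -
      have "(\<Sum>m\<in>F. w m * (if J m \<le> j then r ^ j else 0)) = (\<Sum>m\<in>{m \<in> F. J m \<le> j}. w m) * r ^ j"
        unfolding sum_distrib_right sum.inter_filter[OF F] by (rule sum.cong) auto
      also have "\<dots> \<le> (2 * b * real (Suc j) + c0) * r ^ j"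
      proof (intro mult_right_mono level)
        fix m assume m: "m \<in> {m \<in> F. J m \<le> j}"
        then have "exp (- real j) \<le> exp (- real (J m))" by simp
        also have "\<dots> < g m" using J m by simp
        finally show "exp (- real j) < g m" .
      qed (use F r in auto)
      finally show ?thesis by (simp add: algebra_simps)
    qed
    have s2: "(\<lambda>j. 2 * b * (real (Suc j) * r ^ j) + c0 * r ^ j) sums (2 * b * (1 / (1 - r)\<^sup>2) + c0 * (1 / (1 - r)))"
      by (intro sums_add sums_mult geometric_sums geometric_deriv_sums) (use r in auto)
    have "(\<Sum>m\<in>F. w m * (r ^ J m / (1 - r))) \<le> 2 * b * (1 / (1 - r)\<^sup>2) + c0 * (1 / (1 - r))"
      by (rule sums_le[OF le1 s1 s2])
    then have "(\<Sum>m\<in>F. w m * r ^ J m) / (1 - r) \<le> (2 * b / (1 - r) + c0) / (1 - r)"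
      by (simp add: sum_divide_distrib add_divide_distrib power2_eq_square)
    then have "(\<Sum>m\<in>F. w m * r ^ J m) \<le> 2 * b / (1 - r) + c0"
      using r by (simp add: divide_le_cancel)
    \<comment> \<open>This is \<open>1 + \<sigma> \<le> exp \<sigma>\<close> in disguise; the pole
      in \<sigma> is compensated by the prefactor \<open>1 / k\<close> of the residue at
      \<open>\<sigma> = 1 / k\<close>.\<close>
    also have "2 * b / (1 - r) \<le> 2 * b * exp \<sigma> / \<sigma>"
    proof -
      have "1 + \<sigma> \<le> exp \<sigma>" by (rule exp_ge_add_one_self)
      moreover have "exp \<sigma> * r = 1" by (simp add: r_def exp_minus)
      ultimately have "\<sigma> \<le> exp \<sigma> * (1 - r)" by (simp add: algebra_simps)
      then have "1 / (1 - r) \<le> exp \<sigma> / \<sigma>" using r \<sigma> by (simp add: field_simps)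
      then have "2 * b * (1 / (1 - r)) \<le> 2 * b * (exp \<sigma> / \<sigma>)" using b(1) by (intro mult_left_mono) auto
      then show ?thesis by simp
    qed
    finally have S: "(\<Sum>m\<in>F. w m * r ^ J m) \<le> 2 * b * exp \<sigma> / \<sigma> + c0" by simp
    have "(\<Sum>m\<in>F. g m powr (1 + \<sigma>) * (norm (P (h m)))\<^sup>2) \<le> (\<Sum>m\<in>F. c1 powr \<sigma> * (w m * r ^ J m))"
    proof (rule sum_mono)
      fix m assume m: "m \<in> F"
      have "g m powr (1 + \<sigma>) * (norm (P (h m)))\<^sup>2 = w m * g m powr \<sigma>"
        using pos[OF m] by (simp add: w_def powr_add)
      also have "\<dots> \<le> w m * (c1 powr \<sigma> * r ^ J m)" by (intro mult_left_mono gJ m w0)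
      finally show "g m powr (1 + \<sigma>) * (norm (P (h m)))\<^sup>2 \<le> c1 powr \<sigma> * (w m * r ^ J m)"
        by (simp add: mult_ac)
    qed
    also have "\<dots> \<le> c1 powr \<sigma> * (2 * b * exp \<sigma> / \<sigma> + c0)"
      unfolding sum_distrib_left[symmetric] by (intro mult_left_mono S) auto
    finally show ?thesis .
  qed
  have "(\<Sum>m\<in>F. g m powr (1 + \<sigma>) * (norm (P (h m)))\<^sup>2) \<le> c1 powr \<sigma> * (2 * b * exp \<sigma> / \<sigma> + c0)"
    if F: "finite F" and \<sigma>: "\<sigma> > 0" for F \<sigma>
  proof -
    \<comment> \<open>Zero values contribute nothing since \<open>0 powr (1 + \<sigma>)\<close> is
      0, and levels exist for positive values only.\<close>
    have "(\<Sum>m\<in>F. g m powr (1 + \<sigma>) * (norm (P (h m)))\<^sup>2) =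
        (\<Sum>m\<in>{m \<in> F. g m > 0}. g m powr (1 + \<sigma>) * (norm (P (h m)))\<^sup>2)"
      using F g(1) by (intro sum.mono_neutral_right) (auto simp: not_less intro: antisym)
    also have "\<dots> \<le> c1 powr \<sigma> * (2 * b * exp \<sigma> / \<sigma> + c0)"
      by (rule main) (use F \<sigma> in auto)
    finally show ?thesis .
  qed
  then show ?thesis using that[of c1 c0] K1 by (simp add: c1_def)
qed

definition residue_mean :: "nat \<Rightarrow> real" where
  "residue_mean k = 1 / real k * (\<Sum>m. g m powr (1 + 1 / real k) * (norm (P (h m)))\<^sup>2)"

text \<open>Beyond some index \<open>gamma_term\<close> is below \<open>b\<close>; the earlier Ky
  Fan sums are absorbed in \<open>L\<close>, which has no influence on the limiting residue.\<close>

lemma kyfan_affine_bound: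
  assumes b: "norm0 (P \<circ> diag_op h g \<circ> P) < ereal b"
  obtains L where "\<And>n. kyfan (P \<circ> diag_op h g \<circ> P) n \<le> b * ln (1 + real n) + L"
proof -
  let ?X = "P \<circ> diag_op h g \<circ> P"
  note X = compression_nonneg compression_compact
  have "eventually (\<lambda>n. ereal (gamma_term ?X n) < ereal b) sequentially"
    using b unfolding norm0_def by (rule Limsup_lessD)
  then obtain N where N: "\<And>n. n \<ge> N \<Longrightarrow> gamma_term ?X n < b"
    by (auto simp: eventually_sequentially)
  have b0: "b \<ge> 0" using N[of N] gamma_term_nonneg[OF X, of N] by simp
  have "kyfan ?X n \<le> b * ln (1 + real n) + kyfan ?X N" for n
  proof (cases "n \<ge> N \<and> n > 0")
    case True
    then have "kyfan ?X n / ln (1 + real n) \<le> b" using N[of n] by (simp add: gamma_term_kyfan)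
    then have "kyfan ?X n \<le> b * ln (1 + real n)" using True by (simp add: divide_le_eq)
    then show ?thesis using kyfan_nonneg[OF X, of N] by simp
  next
    case False
    then have "kyfan ?X n \<le> kyfan ?X N" using kyfan_nonneg[OF X, of N] by (auto intro: kyfan_mono[OF X])
    moreover have "0 \<le> b * ln (1 + real n)" using b0 by simp
    ultimately show ?thesis by simp
  qed
  then show ?thesis by (rule that)
qed

lemma residue_summable:
  assumes X: "P \<circ> diag_op h g \<circ> P \<in> L1inf_pos" and \<sigma>: "\<sigma> > 0"
  shows "summable (\<lambda>m. g m powr (1 + \<sigma>) * (norm (P (h m)))\<^sup>2)"
proof -
  obtain b where b: "b \<ge> 0" "\<And>k. kyfan (P \<circ> diag_op h g \<circ> P) k \<le> b * ln (1 + real k)"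
    using L1inf_pos_bound[OF X] by metis
  have b': "\<And>k. kyfan (P \<circ> diag_op h g \<circ> P) k \<le> b * ln (1 + real k) + 0" using b(2) by simp
  obtain c1 c0 where c: "c1 \<ge> 1" "\<And>F \<sigma>. finite F \<Longrightarrow> \<sigma> > 0 \<Longrightarrow>
      (\<Sum>m\<in>F. g m powr (1 + \<sigma>) * (norm (P (h m)))\<^sup>2) \<le> c1 powr \<sigma> * (2 * b * exp \<sigma> / \<sigma> + c0)"
    by (rule residue_sum_le[OF b(1) b']) (rule that)
  show ?thesis
    by (rule summableI_nonneg_bounded[OF _ c(2)[OF _ \<sigma>]]) auto
qed

text \<open>The bound of \<open>residue_sum_le\<close> at \<open>\<sigma> = 1 / k\<close>, divided
  by \<open>k\<close>, tends to \<open>2 * b\<close>: the powers of \<open>c1\<close> and e tend to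
  1, and \<open>c0 / k\<close> vanishes.\<close>

lemma limsup_residue_le:
  assumes X: "P \<circ> diag_op h g \<circ> P \<in> L1inf_pos" and b: "norm0 (P \<circ> diag_op h g \<circ> P) < ereal b"
  shows "limsup (\<lambda>k. ereal (residue_mean k)) \<le> ereal (2 * b)"
proof -
  obtain \<beta> where "norm0 (P \<circ> diag_op h g \<circ> P) = ereal \<beta>" "\<beta> \<ge> 0" using norm0_eq[OF X] .
  then have b0: "b \<ge> 0" using b by simp
  obtain L where L: "\<And>n. kyfan (P \<circ> diag_op h g \<circ> P) n \<le> b * ln (1 + real n) + L"
    by (rule kyfan_affine_bound[OF b]) (rule that)
  obtain c1 c0 where c: "c1 \<ge> 1" "\<And>F \<sigma>. finite F \<Longrightarrow> \<sigma> > 0 \<Longrightarrow>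
      (\<Sum>m\<in>F. g m powr (1 + \<sigma>) * (norm (P (h m)))\<^sup>2) \<le> c1 powr \<sigma> * (2 * b * exp \<sigma> / \<sigma> + c0)"
    by (rule residue_sum_le[OF b0 L]) (rule that)
  define B where "B = (\<lambda>k :: nat. c1 powr (1 / real k) * (2 * b * exp (1 / real k) + c0 / real k))"
  have "eventually (\<lambda>k. residue_mean k \<le> B k) sequentially"
    using eventually_gt_at_top[of 0]
  proof eventually_elim
    case (elim k)
    have "(\<Sum>m. g m powr (1 + 1 / real k) * (norm (P (h m)))\<^sup>2) \<le>
        c1 powr (1 / real k) * (2 * b * exp (1 / real k) / (1 / real k) + c0)"
      by (rule suminf_le_const[OF residue_summable[OF X]], use elim in simp)
         (rule c(2), use elim in simp_all)
    then have "residue_mean k \<le> 1 / real k * (c1 powr (1 / real k) * (2 * b * exp (1 / real k) / (1 / real k) + c0))"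
      unfolding residue_mean_def by (intro mult_left_mono) auto
    also have "\<dots> = B k" using elim by (simp add: B_def field_simps)
    finally show ?case .
  qed
  then have "limsup (\<lambda>k. ereal (residue_mean k)) \<le> limsup (\<lambda>k. ereal (B k))"
    by (intro Limsup_mono) simp
  also have "\<dots> = ereal (2 * b)"
  proof (rule lim_imp_Limsup)
    have k0: "(\<lambda>k. 1 / real k) \<longlonglongrightarrow> 0" by (rule lim_1_over_n)
    have "B \<longlonglongrightarrow> c1 powr 0 * (2 * b * exp 0 + 0)"
      unfolding B_def
      by (intro tendsto_mult tendsto_add tendsto_const tendsto_exp tendsto_powr k0 lim_const_over_n) (use c(1) in simp)
    then show "(\<lambda>k. ereal (B k)) \<longlonglongrightarrow> ereal (2 * b)"
      using c(1) by (intro tendsto_ereal) simp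
  qed simp
  finally show ?thesis .
qed

text \<open>\<open>kyfan_compression_le\<close> is applied with an exponent depending on
  \<open>N\<close>; the mean at that exponent is below \<open>b\<close> once \<open>N\<close> is
  large, and the additive 1 disappears after division by the logarithm.\<close>

lemma norm0_le_residue:
  assumes X: "P \<circ> diag_op h g \<circ> P \<in> L1inf_pos" and b: "limsup (\<lambda>k. ereal (residue_mean k)) < ereal b"
  shows "norm0 (P \<circ> diag_op h g \<circ> P) \<le> ereal (exp 1 * b)"
proof -
  let ?X = "P \<circ> diag_op h g \<circ> P"
  have "eventually (\<lambda>k. ereal (residue_mean k) < ereal b) sequentially"
    using b by (rule Limsup_lessD)
  then obtain k0 where k0: "\<And>k. k \<ge> k0 \<Longrightarrow> residue_mean k < b" by (auto simp: eventually_sequentially)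
  have b0: "b \<ge> 0"
  proof -
    have "0 \<le> residue_mean (Suc k0)"
      unfolding residue_mean_def by (intro mult_nonneg_nonneg suminf_nonneg residue_summable[OF X]) auto
    then show ?thesis using k0[of "Suc k0"] by simp
  qed
  define B where "B = (\<lambda>N :: nat. (exp 1 * b * (ln (1 + real N) + 1) + 1) / ln (1 + real N))"
  have "filterlim (\<lambda>N :: nat. ln (1 + real N)) at_top sequentially" by real_asymp
  then have "eventually (\<lambda>N. ln (1 + real N) \<ge> real (Suc k0)) sequentially"
    by (simp only: filterlim_at_top)
  then have "eventually (\<lambda>N. gamma_term ?X N \<le> B N) sequentially"
    using eventually_ge_at_top[of 1]
  proof eventually_elim
    case (elim N)
    \<comment> \<open>The least integer for which \<open>N powr (1 / k) \<le> exp 1\<close> follows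
      from \<open>ln (1 + N) \<le> k\<close>; it also exceeds the denominator of
      \<open>gamma_term\<close> by at most 1.\<close>
    define k where "k = nat \<lceil>ln (1 + real N)\<rceil>"
    have ln0: "ln (1 + real N) > 0" using elim(2) by simp
    have k: "ln (1 + real N) \<le> real k" "real k \<le> ln (1 + real N) + 1"
      unfolding k_def using ln0 by linarith+
    have kk: "k \<ge> Suc k0" using elim(1) k(1) by linarith
    then have kpos: "real k > 0" by simp
    have Ne: "real N powr (1 / real k) \<le> exp 1"
    proof -
      have "ln (real N) \<le> ln (1 + real N)" using elim(2) by (intro ln_mono) auto
      then have "ln (real N) \<le> real k" using k(1) by linarith
      then have "ln (real N) / real k \<le> 1" using kpos by simp
      then show ?thesis using elim(2) by (simp add: powr_def)
    qed
    have kf: "kyfan ?X N \<le> exp 1 * (\<Sum>m. g m powr (1 + 1 / real k) * (norm (P (h m)))\<^sup>2) + 1"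
      by (rule kyfan_compression_le[OF elim(2) _ Ne residue_summable[OF X]]) (use kpos in auto)
    have S: "(\<Sum>m. g m powr (1 + 1 / real k) * (norm (P (h m)))\<^sup>2) = real k * residue_mean k"
      using kpos by (simp add: residue_mean_def)
    have "real k * residue_mean k \<le> real k * b"
      using k0[of k] kk by (intro mult_left_mono) auto
    also have "\<dots> \<le> (ln (1 + real N) + 1) * b" using k(2) b0 by (rule mult_right_mono)
    finally have "exp 1 * (real k * residue_mean k) \<le> exp 1 * ((ln (1 + real N) + 1) * b)"
      by (intro mult_left_mono) auto
    also have "\<dots> = exp 1 * b * (ln (1 + real N) + 1)" by simp
    finally have "kyfan ?X N \<le> exp 1 * b * (ln (1 + real N) + 1) + 1"
      using kf unfolding S by linarith
    then show ?case
      unfolding gamma_term_kyfan B_def using ln0 by (intro divide_right_mono) auto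
  qed
  then have "norm0 ?X \<le> limsup (\<lambda>N. ereal (B N))"
    unfolding norm0_def by (intro Limsup_mono) simp
  also have "\<dots> = ereal (exp 1 * b)"
  proof (rule lim_imp_Limsup)
    have "(\<lambda>N :: nat. exp 1 * b + (exp 1 * b + 1) / ln (1 + real N)) \<longlonglongrightarrow> exp 1 * b" by real_asymp
    moreover have "eventually (\<lambda>N. exp 1 * b + (exp 1 * b + 1) / ln (1 + real N) = B N) sequentially"
      using eventually_ge_at_top[of 1]
      by eventually_elim (simp add: B_def field_simps)
    ultimately have "B \<longlonglongrightarrow> exp 1 * b" by (rule Lim_transform_eventually)
    then show "(\<lambda>N. ereal (B N)) \<longlonglongrightarrow> ereal (exp 1 * b)" by (intro tendsto_ereal)
  qed simp
  finally show ?thesis .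
qed

end

section \<open>The tail conditions\<close>

lemma ereal_tendsto_0_iff:
  fixes f :: "nat \<Rightarrow> ereal"
  assumes nn: "\<And>N. 0 \<le> f N"
  shows "f \<longlonglongrightarrow> 0 \<longleftrightarrow> (\<forall>e>0. eventually (\<lambda>N. f N < ereal e) sequentially)"
proof
  assume "f \<longlonglongrightarrow> 0"
  then show "\<forall>e>0. eventually (\<lambda>N. f N < ereal e) sequentially"
    using order_tendstoD(2)[of f 0 sequentially] by simp
next
  assume *: "\<forall>e>0. eventually (\<lambda>N. f N < ereal e) sequentially"
  show "f \<longlonglongrightarrow> 0"
  proof (rule order_tendstoI)
    fix a :: ereal assume "a < 0"
    then show "eventually (\<lambda>N. a < f N) sequentially" using nn by (auto intro: always_eventually less_le_trans)
  next
    fix a :: ereal assume a: "0 < a"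
    obtain e where e: "e > 0" "ereal e \<le> a"
      using a by (cases a) (auto intro: that[of 1] simp: that)
    then show "eventually (\<lambda>N. f N < a) sequentially"
      using * by (auto elim!: eventually_mono intro: less_le_trans)
  qed
qed

context
  fixes M :: "'f measure" and U :: "'h::chilbert_space \<Rightarrow> 'f \<Rightarrow> complex"
    and h :: "nat \<Rightarrow> 'h" and g :: "nat \<Rightarrow> real" and K :: real
  assumes U: "unitary_to_L2 M U" and fin: "finite_measure M"
    and h: "orthonormal_basis h" and g: "\<And>m. 0 \<le> g m" "\<And>m. g m \<le> K"
    and T: "diag_op h g \<in> L1inf_pos" and meas: "spectrally_measurable M U (diag_op h g)"
begin

definition compression :: "'f set \<Rightarrow> 'h \<Rightarrow> 'h" where
  "compression J = mult_proj M U J \<circ> diag_op h g \<circ> mult_proj M U J"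

lemma compress_eq: "compress M U (diag_op h g) J = compression J"
  by (simp add: compress_def compression_def mult_proj_def[OF U])

lemma compression_L1inf_pos:
  assumes J: "J \<in> sets M"
  shows "compression J \<in> L1inf_pos"
proof -
  have "compression J \<in> L1inf"
    using meas J unfolding spectrally_measurable_def measurable_op_def by (simp add: compress_eq)
  then show ?thesis
    using compression_nonneg[OF h g T mult_proj_projection[OF U J]]
    by (simp add: L1inf_pos_def compression_def)
qed

lemma norm0_nonneg: "X \<in> L1inf_pos \<Longrightarrow> 0 \<le> norm0 X"
  using norm0_eq by (metis ereal_less_eq(5))

abbreviation residue :: "'f set \<Rightarrow> ereal" where
  "residue J \<equiv> limsup (\<lambda>k. ereal (residue_mean h g (mult_proj M U J) k))"

lemma residue_nonneg:
  assumes J: "J \<in> sets M"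
  shows "0 \<le> residue J"
proof -
  note X = compression_L1inf_pos[OF J, unfolded compression_def]
  have "0 \<le> residue_mean h g (mult_proj M U J) k" for k
  proof (cases "k = 0")
    \<comment> \<open>Here \<open>1 / 0 = 0\<close> makes the mean zero, so the upper limit may run
      over all indices.\<close>
    case True
    then show ?thesis by (simp add: residue_mean_def[OF h g T mult_proj_projection[OF U J]])
  next
    case False
    then show ?thesis
      unfolding residue_mean_def[OF h g T mult_proj_projection[OF U J]]
      by (intro mult_nonneg_nonneg suminf_nonneg residue_summable[OF h g T mult_proj_projection[OF U J] X]) auto
  qed
  then show ?thesis by (intro le_Limsup) auto
qed

lemma residue_tail_condition_iff:
  assumes gG: "\<And>m. g m = G (lam m)"
  shows "residue_tail_condition M U h lam G \<longleftrightarrow>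
    (\<forall>F :: nat \<Rightarrow> 'f set. range F \<subseteq> sets M \<and> disjoint_family F \<longrightarrow>
      (\<lambda>N. residue (\<Union>j\<in>{N..}. F j)) \<longlonglongrightarrow> 0)"
  unfolding residue_tail_condition_def
proof (intro all_cong1 imp_cong refl)
  fix F :: "nat \<Rightarrow> 'f set"
  assume F: "range F \<subseteq> sets M \<and> disjoint_family F"
  have "residue_mean h g (mult_proj M U (\<Union>j\<in>{N..}. F j)) k = 1 / real k * (\<Sum>m. G (lam m) powr (1 + 1 / real k) *
      (LINT t:(\<Union>j\<in>{N..}. F j)|M. (cmod (U (h m) t))\<^sup>2))" for N k
  proof -
    have J: "(\<Union>j\<in>{N..}. F j) \<in> sets M" using F by auto
    show ?thesis
      by (simp only: residue_mean_def[OF h g T mult_proj_projection[OF U J]] norm_sq_mult_proj[OF U J] gG)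
  qed
  then show "((\<lambda>N. limsup (\<lambda>k. ereal (1 / real k * (\<Sum>m. G (lam m) powr (1 + 1 / real k) *
        (LINT t:(\<Union>j\<in>{N..}. F j)|M. (cmod (U (h m) t))\<^sup>2))))) \<longlonglongrightarrow> 0) =
     ((\<lambda>N. residue (\<Union>j\<in>{N..}. F j)) \<longlonglongrightarrow> 0)" by simp
qed

lemma residue_tail_iff_norm0_tail:
  assumes F: "range F \<subseteq> sets M"
  shows "(\<lambda>N. residue (\<Union>j\<in>{N::nat..}. F j)) \<longlonglongrightarrow> 0 \<longleftrightarrow>
    (\<lambda>N. norm0 (compression (\<Union>j\<in>{N..}. F j))) \<longlonglongrightarrow> 0"
proof -
  have J: "(\<Union>j\<in>{N..}. F j) \<in> sets M" for N using F by auto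
  note P = mult_proj_projection[OF U J]
  note X = compression_L1inf_pos[OF J, unfolded compression_def]
  have R: "0 \<le> residue (\<Union>j\<in>{N..}. F j)" for N by (rule residue_nonneg[OF J])
  have N0: "0 \<le> norm0 (compression (\<Union>j\<in>{N..}. F j))" for N
    by (rule norm0_nonneg[OF compression_L1inf_pos[OF J]])
  show ?thesis
    unfolding ereal_tendsto_0_iff[OF R] ereal_tendsto_0_iff[OF N0]
  proof (intro iffI allI impI)
    fix e :: real
    assume *: "\<forall>e>0. eventually (\<lambda>N. residue (\<Union>j\<in>{N..}. F j) < ereal e) sequentially" and e: "e > 0"
    \<comment> \<open>\<open>exp 1 * b\<close> is half of \<open>e\<close>, leaving room for a
      strict inequality; \<open>e / 3\<close> plays this role for the factor 2 in the other
      direction.\<close>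
    define b where "b = e / (2 * exp 1)"
    have b: "b > 0" "exp 1 * b < e" using e by (auto simp: b_def)
    from *[rule_format, OF b(1)] show "eventually (\<lambda>N. norm0 (compression (\<Union>j\<in>{N..}. F j)) < ereal e) sequentially"
    proof eventually_elim
      case (elim N)
      have "norm0 (compression (\<Union>j\<in>{N..}. F j)) \<le> ereal (exp 1 * b)"
        unfolding compression_def by (rule norm0_le_residue[OF h g T P X elim])
      also have "\<dots> < ereal e" using b by simp
      finally show ?case .
    qed
  next
    fix e :: real
    assume *: "\<forall>e>0. eventually (\<lambda>N. norm0 (compression (\<Union>j\<in>{N..}. F j)) < ereal e) sequentially" and e: "e > 0"
    have e3: "e / 3 > 0" using e by simp
    from *[rule_format, OF e3] show "eventually (\<lambda>N. residue (\<Union>j\<in>{N..}. F j) < ereal e) sequentially"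
    proof eventually_elim
      case (elim N)
      have "residue (\<Union>j\<in>{N..}. F j) \<le> ereal (2 * (e / 3))"
        by (rule limsup_residue_le[OF h g T P X]) (use elim in \<open>simp add: compression_def\<close>)
      also have "\<dots> < ereal e" using e by simp
      finally show ?case .
    qed
  qed
qed

text \<open>Orthogonality of the projections lets distinct \<open>J i\<close> overlap in null sets
  only, and removing a null set does not change a projection.\<close>

lemma mult_proj_disjointed:
  fixes J :: "nat \<Rightarrow> 'f set"
  assumes J: "\<And>j. J j \<in> sets M" and 0: "\<And>i j. i \<noteq> j \<Longrightarrow> mult_proj M U (J i) \<circ> mult_proj M U (J j) = (\<lambda>_. 0)"
  shows "mult_proj M U (disjointed J j) = mult_proj M U (J j)"
proof
  fix x
  define Z where "Z = J j \<inter> (\<Union>i<j. J i)"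
  have D: "disjointed J j \<in> sets M" using J by (auto simp: disjointed_def)
  have "Z = (\<Union>i<j. J i \<inter> J j)" by (auto simp: Z_def)
  also have "\<dots> \<in> null_sets M"
    by (intro null_sets_UN' mult_proj_orthogonal_null[OF U fin J J 0]) auto
  finally have Z: "Z \<in> null_sets M" .
  have "J j = disjointed J j \<union> Z" "disjointed J j \<inter> Z = {}"
    by (auto simp: disjointed_def Z_def atLeast0LessThan)
  then show "mult_proj M U (disjointed J j) x = mult_proj M U (J j) x"
    using mult_proj_Un[OF U D null_setsD2[OF Z], of x] mult_proj_null[OF U Z, of x] by simp
qed

lemma mult_proj_tail_suminf:
  assumes F: "range F \<subseteq> sets M" "disjoint_family F"
  shows "(\<lambda>x. \<Sum>j. mult_proj M U (F (j + N)) x) = mult_proj M U (\<Union>j\<in>{N::nat..}. F j)"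
proof
  fix x
  have "range (\<lambda>j. F (j + N)) \<subseteq> sets M" using F by auto
  moreover have "disjoint_family (\<lambda>j. F (j + N))"
    using F(2) by (auto simp: disjoint_family_on_def)
  ultimately have "(\<lambda>j. mult_proj M U (F (j + N)) x) sums mult_proj M U (\<Union>j. F (j + N)) x"
    by (rule mult_proj_sums[OF U])
  moreover have "(\<Union>j. F (j + N)) = (\<Union>j\<in>{N..}. F j)"
  proof -
    have "range (\<lambda>j. j + N) = {N..}" by (auto simp: image_iff intro: le_add_diff_inverse2[symmetric])
    then show ?thesis by (metis image_image)
  qed
  ultimately show "(\<Sum>j. mult_proj M U (F (j + N)) x) = mult_proj M U (\<Union>j\<in>{N..}. F j) x"
    by (simp add: sums_iff)
qed

text \<open>Projections in the multiplication algebra come from sets, mutually orthogonal ones from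
  disjoint sets, and the strong sum of a tail is the projection of the tail union.\<close>

lemma projection_tail_condition_iff:
  "projection_tail_condition M U (diag_op h g) \<longleftrightarrow>
    (\<forall>F :: nat \<Rightarrow> 'f set. range F \<subseteq> sets M \<and> disjoint_family F \<longrightarrow>
      (\<lambda>N. norm0 (compression (\<Union>j\<in>{N..}. F j))) \<longlonglongrightarrow> 0)"
proof (intro iffI allI impI)
  fix F :: "nat \<Rightarrow> 'f set"
  assume *: "projection_tail_condition M U (diag_op h g)" and F: "range F \<subseteq> sets M \<and> disjoint_family F"
  have Fj: "F j \<in> sets M" for j using F by auto
  define Q where "Q = (\<lambda>j. mult_proj M U (F j))"
  have Q1: "is_projection (Q j) \<and> Q j \<in> mult_algebra M U" for j
    using mult_proj_projection[OF U Fj] indicator_Linf[OF U Fj]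
    by (auto simp: Q_def mult_algebra_def mult_proj_def[OF U])
  have Q2: "Q i \<circ> Q j = (\<lambda>_. 0)" if "i \<noteq> j" for i j
    using F that by (auto simp: Q_def fun_eq_iff mult_proj_proj[OF U Fj Fj] disjoint_family_on_def mult_proj_empty[OF U])
  have "(\<lambda>N. let P = (\<lambda>x. \<Sum>j. Q (j + N) x) in norm0 (P \<circ> diag_op h g \<circ> P)) \<longlonglongrightarrow> 0"
    using *[unfolded projection_tail_condition_def, rule_format, of Q] Q1 Q2 by blast
  then show "(\<lambda>N. norm0 (compression (\<Union>j\<in>{N..}. F j))) \<longlonglongrightarrow> 0"
    using F by (simp add: Let_def Q_def mult_proj_tail_suminf compression_def)
next
  assume *: "\<forall>F :: nat \<Rightarrow> 'f set. range F \<subseteq> sets M \<and> disjoint_family F \<longrightarrow>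
      (\<lambda>N. norm0 (compression (\<Union>j\<in>{N..}. F j))) \<longlonglongrightarrow> 0"
  show "projection_tail_condition M U (diag_op h g)"
    unfolding projection_tail_condition_def
  proof (intro allI impI)
    fix Q :: "nat \<Rightarrow> 'h \<Rightarrow> 'h"
    assume Q: "(\<forall>j. is_projection (Q j) \<and> Q j \<in> mult_algebra M U) \<and>
        (\<forall>i j. i \<noteq> j \<longrightarrow> Q i \<circ> Q j = (\<lambda>_. 0))"
    have "\<exists>J. J \<in> sets M \<and> Q j = mult_proj M U J" for j
    proof -
      obtain f where f: "f \<in> Linf_fun M" "Q j = mult_op M U f"
      proof -
        have "Q j \<in> mult_op M U ` Linf_fun M" using Q by (simp add: mult_algebra_def)
        then show ?thesis using that by blast
      qed
      have "Q j \<circ> Q j = Q j" using Q by (simp add: is_projection_def)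
      then have "mult_op M U f \<circ> mult_op M U f = mult_op M U f" by (simp add: f(2))
      from projection_mult_op[OF U fin f(1) this] show ?thesis using f(2) by metis
    qed
    then obtain J where J: "\<And>j. J j \<in> sets M" "\<And>j. Q j = mult_proj M U (J j)" by metis
    define F where "F = disjointed J"
    have F: "range F \<subseteq> sets M" "disjoint_family F"
      unfolding F_def using J(1) by (auto simp: disjointed_def) (rule disjoint_family_disjointed)
    have "mult_proj M U (J i) \<circ> mult_proj M U (J j) = (\<lambda>_. 0)" if "i \<noteq> j" for i j
      using Q that J(2) by metis
    then have QF: "Q j = mult_proj M U (F j)" for j
      unfolding F_def J(2) by (intro mult_proj_disjointed[symmetric] J(1)) auto
    have "(\<lambda>N. norm0 (compression (\<Union>j\<in>{N..}. F j))) \<longlonglongrightarrow> 0" using * F by blast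
    then show "(\<lambda>N. let P = (\<lambda>x. \<Sum>j. Q (j + N) x) in norm0 (P \<circ> diag_op h g \<circ> P)) \<longlonglongrightarrow> 0"
      by (simp add: Let_def QF mult_proj_tail_suminf[OF F] compression_def)
  qed
qed

subsection \<open>The measures of the spectral projections\<close>

text \<open>\<open>J \<mapsto> B P\<^sub>J B\<close>, \<open>B\<close> the square root of the operator, is additive in contrast to \<open>J \<mapsto> P\<^sub>J B\<^sup>2 P\<^sub>J\<close>,
  and has the same singular values.\<close>

definition sqrt_compr :: "'f set \<Rightarrow> 'h \<Rightarrow> 'h" where
  "sqrt_compr J = diag_op h (\<lambda>m. sqrt (g m)) \<circ> mult_proj M U J \<circ> diag_op h (\<lambda>m. sqrt (g m))"

lemma sqrt_compr_gamma:
  assumes J: "J \<in> sets M"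
  shows "sqrt_compr J \<in> L1inf_pos" "gamma_seq (sqrt_compr J) = gamma_seq (compression J)"
proof -
  note S = sqrt_compression[OF h g T mult_proj_projection[OF U J], folded sqrt_compr_def compression_def]
  have gt: "gamma_term (sqrt_compr J) k = gamma_term (compression J) k" for k
    by (simp add: gamma_term_def S(3))
  then show "gamma_seq (sqrt_compr J) = gamma_seq (compression J)" by (simp add: gamma_seq_def)
  have "gamma_term (sqrt_compr J) = gamma_term (compression J)" using gt by blast
  then show "sqrt_compr J \<in> L1inf_pos"
    using S(1,2) L1inf_posD(3)[OF compression_L1inf_pos[OF J]] by (simp add: L1inf_pos_def L1inf_def)
qed

lemma dixmier_compression_Un:
  assumes \<omega>: "\<omega> \<in> DL2 TYPE('h)" and JK: "J \<in> sets M" "I \<in> sets M" "J \<inter> I = {}"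
  shows "blinfun_apply \<omega> (gamma_seq (compression (J \<union> I))) =
    blinfun_apply \<omega> (gamma_seq (compression J)) + blinfun_apply \<omega> (gamma_seq (compression I))"
proof -
  note B = sqrt_diag_bounded[OF h g T mult_proj_projection[OF U JK(1)]]
  have "sqrt_compr (J \<union> I) = (\<lambda>x. sqrt_compr J x + sqrt_compr I x)"
    by (simp add: sqrt_compr_def fun_eq_iff mult_proj_Un[OF U JK] bounded_clinear_add[OF B])
  then show ?thesis
    using DL2_gamma_plus[OF \<omega> sqrt_compr_gamma(1)[OF JK(1)] sqrt_compr_gamma(1)[OF JK(2)]] JK
    by (simp add: sqrt_compr_gamma(2)[symmetric])
qed

lemma nu_measure_compression:
  assumes "\<omega> \<in> DL2 TYPE('h)" "J \<in> sets M"
  shows "nu_measure M U (diag_op h g) \<omega> J = complex_of_real (blinfun_apply \<omega> (gamma_seq (compression J)))"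
  unfolding nu_measure_def compress_eq by (rule dixmier_trace_nonneg[OF assms(1) compression_L1inf_pos[OF assms(2)]])

lemma dixmier_compression_nonneg:
  assumes \<omega>: "\<omega> \<in> DL2 TYPE('h)" and J: "J \<in> sets M"
  shows "0 \<le> blinfun_apply \<omega> (gamma_seq (compression J))"
  using gamma_term_nonneg[OF L1inf_posD(1,2)[OF compression_L1inf_pos[OF J]]]
  by (intro DL2D(1)[OF \<omega>]) (simp add: gamma_seq_apply[OF compression_L1inf_pos[OF J]])

lemma dixmier_compression_null:
  assumes \<omega>: "\<omega> \<in> DL2 TYPE('h)" and J: "J \<in> null_sets M"
  shows "blinfun_apply \<omega> (gamma_seq (compression J)) = 0"
proof -
  have Js: "J \<in> sets M" using J by auto
  have "compression J = (\<lambda>_. 0)"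
    using bounded_clinear_zero[OF is_projectionD(1)[OF mult_proj_projection[OF U Js]]]
    by (simp add: compression_def fun_eq_iff mult_proj_null[OF U J])
  then have "gamma_seq (compression J) = 0"
    by (intro bcontfun_eqI) (simp add: gamma_seq_apply[OF L1inf_pos_const0] gamma_term_const0)
  then show ?thesis by (simp add: blinfun.zero_right)
qed

text \<open>A single \<omega> with its measure is enough: the functional attaining
  \<open>norm0\<close> of a tail compression varies with \<open>N\<close>, but measurability gives
  it the same value as \<omega>, namely the measure of a tail that shrinks to the empty set.\<close>

lemma nu_measure_condition_imp:
  assumes nu: "nu_measure_condition M U (diag_op h g)" and F: "range F \<subseteq> sets M" "disjoint_family F"
  shows "(\<lambda>N. norm0 (compression (\<Union>j\<in>{N::nat..}. F j))) \<longlonglongrightarrow> 0"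
proof -
  define J where "J = (\<lambda>N. \<Union>j\<in>{N..}. F j)"
  have J: "J N \<in> sets M" for N unfolding J_def using F by auto
  \<comment> \<open>Serves only to know that a functional in \<open>DL2\<close> exists.\<close>
  obtain \<omega> where \<omega>: "\<omega> \<in> DL2 TYPE('h)" using exists_DL2_ge_norm0[OF T] by (elim bexE)
  from bspec[OF nu[unfolded nu_measure_condition_def] \<omega>]
  obtain \<nu> where \<nu>: "sets \<nu> = sets M" "finite_measure \<nu>"
      "\<And>J. J \<in> sets M \<Longrightarrow> nu_measure M U (diag_op h g) \<omega> J = complex_of_real (measure \<nu> J)"
    by (elim exE conjE) blast
  have "(\<Inter>N. J N) = {}"
  proof (rule equals0I)
    fix t assume t: "t \<in> (\<Inter>N. J N)"
    then obtain j where j: "t \<in> F j" unfolding J_def by blast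
    from t have "t \<in> J (Suc j)" by blast
    then obtain i where "i \<ge> Suc j" "t \<in> F i" unfolding J_def by auto
    then show False using j disjoint_family_onD[OF F(2), of i j] by auto
  qed
  moreover have "decseq J" unfolding J_def decseq_def by force
  moreover have "range J \<subseteq> sets \<nu>" using J \<nu>(1) by auto
  ultimately have lim: "(\<lambda>N. measure \<nu> (J N)) \<longlonglongrightarrow> 0"
    using finite_measure.finite_Lim_measure_decseq[OF \<nu>(2), of J] by simp
  have le: "norm0 (compression (J N)) \<le> ereal (measure \<nu> (J N))" for N
  proof -
    obtain \<omega>' where \<omega>': "\<omega>' \<in> DL2 TYPE('h)"
        "norm0 (compression (J N)) \<le> ereal (blinfun_apply \<omega>' (gamma_seq (compression (J N))))"
      using exists_DL2_ge_norm0[OF compression_L1inf_pos[OF J[of N]]] by (elim bexE)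
    have "dixmier_trace \<omega>' (compression (J N)) = dixmier_trace \<omega> (compression (J N))"
      using meas[unfolded spectrally_measurable_def measurable_op_def compress_eq, THEN bspec, OF J[of N],
          THEN conjunct2, THEN bspec, OF \<omega>'(1), THEN bspec, OF \<omega>] .
    also have "\<dots> = complex_of_real (measure \<nu> (J N))"
      using \<nu>(3)[OF J[of N]] by (simp add: nu_measure_def compress_eq)
    finally have "blinfun_apply \<omega>' (gamma_seq (compression (J N))) = measure \<nu> (J N)"
      by (simp add: dixmier_trace_nonneg[OF \<omega>'(1) compression_L1inf_pos[OF J]])
    then show ?thesis using \<omega>'(2) by simp
  qed
  have nn: "0 \<le> norm0 (compression (J N))" for N by (rule norm0_nonneg[OF compression_L1inf_pos[OF J]])
  have "(\<lambda>N. ereal (measure \<nu> (J N))) \<longlonglongrightarrow> 0"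
    using tendsto_ereal[OF lim] by (simp add: zero_ereal_def)
  then have "(\<lambda>N. norm0 (compression (J N))) \<longlonglongrightarrow> 0"
    by (rule tendsto_sandwich[OF always_eventually[OF allI[OF nn]] always_eventually[OF allI[OF le]] tendsto_const])
  then show ?thesis by (simp add: J_def)
qed

text \<open>A finitely additive finite set function is countably additive as soon as it is
  continuous at the empty set; the bound of \<omega> by \<open>norm0\<close> supplies this
  continuity from the tails.\<close>

lemma nu_measure_conditionI:
  assumes tail: "\<And>F :: nat \<Rightarrow> 'f set. range F \<subseteq> sets M \<Longrightarrow> disjoint_family F \<Longrightarrow>
      (\<lambda>N. norm0 (compression (\<Union>j\<in>{N..}. F j))) \<longlonglongrightarrow> 0"
  shows "nu_measure_condition M U (diag_op h g)"
  unfolding nu_measure_condition_def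
proof
  fix \<omega> assume \<omega>: "\<omega> \<in> DL2 TYPE('h)"
  define m where "m = (\<lambda>J. blinfun_apply \<omega> (gamma_seq (compression J)))"
  have m0: "0 \<le> m J" if "J \<in> sets M" for J
    unfolding m_def by (rule dixmier_compression_nonneg[OF \<omega> that])
  have mnull: "m J = 0" if "J \<in> null_sets M" for J
    unfolding m_def by (rule dixmier_compression_null[OF \<omega> that])
  define \<nu> where "\<nu> = measure_of (space M) (sets M) (\<lambda>J. ennreal (m J))"
  have sets: "sets \<nu> = sets M" "space \<nu> = space M"
    by (simp_all add: \<nu>_def)
  have pos: "positive (sets M) (\<lambda>J. ennreal (m J))"
    by (simp add: positive_def mnull)
  have add: "additive (sets M) (\<lambda>J. ennreal (m J))"
    unfolding additive_def
  proof (intro ballI impI)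
    fix J I assume "J \<in> sets M" "I \<in> sets M" "J \<inter> I = {}"
    then show "ennreal (m (J \<union> I)) = ennreal (m J) + ennreal (m I)"
      using dixmier_compression_Un[OF \<omega>, of J I] m0 by (simp add: m_def ennreal_plus)
  qed
  have ca: "countably_additive (sets M) (\<lambda>J. ennreal (m J))"
  proof (rule sets.empty_continuous_imp_countably_additive[OF pos add])
    fix A :: "nat \<Rightarrow> 'f set"
    assume A: "range A \<subseteq> sets M" "decseq A" "(\<Inter>i. A i) = {}"
    \<comment> \<open>A decreasing sequence with empty intersection is the sequence of tails of its
      successive differences.\<close>
    define F where "F = (\<lambda>j. A j - A (Suc j))"
    have As: "A j \<in> sets M" for j using A(1) by auto
    have F: "range F \<subseteq> sets M" using As by (auto simp: F_def)
    have "F i \<inter> F j = {}" if "i < j" for i j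
      using decseqD[OF A(2), of "Suc i" j] that by (auto simp: F_def)
    then have d: "disjoint_family F"
      unfolding disjoint_family_on_def by (metis Int_commute linorder_neqE_nat)
    have tl: "(\<Union>j\<in>{N..}. F j) = A N" for N
    proof
      show "(\<Union>j\<in>{N..}. F j) \<subseteq> A N" using decseqD[OF A(2)] by (fastforce simp: F_def)
      show "A N \<subseteq> (\<Union>j\<in>{N..}. F j)"
      proof
        fix t assume t: "t \<in> A N"
        obtain i where i: "t \<notin> A i" using A(3) by blast
        \<comment> \<open>\<open>t\<close> leaves the sequence at its first absence
          \<open>k\<close>, so it belongs to the difference one index earlier.\<close>
        define k where "k = (LEAST k. t \<notin> A k)"
        have k: "t \<notin> A k" unfolding k_def using i by (rule LeastI)
        have "N < k" using t k decseqD[OF A(2), of k N] by (meson not_less subsetD)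
        then obtain j where j: "k = Suc j" "N \<le> j" by (cases k) auto
        have "t \<in> A j" using not_less_Least[of j "\<lambda>k. t \<notin> A k"] j(1) by (simp add: k_def[symmetric])
        then show "t \<in> (\<Union>j\<in>{N..}. F j)" using k j by (auto simp: F_def)
      qed
    qed
    have lim: "(\<lambda>N. norm0 (compression (A N))) \<longlonglongrightarrow> 0" using tail[OF F d] by (simp add: tl)
    have le: "ereal (m (A N)) \<le> norm0 (compression (A N))" for N
      unfolding m_def by (rule DL2_le_norm0[OF \<omega> compression_L1inf_pos[OF As]])
    have nn: "0 \<le> ereal (m (A N))" for N using m0[OF As] by simp
    have "(\<lambda>N. ereal (m (A N))) \<longlonglongrightarrow> 0"
      by (rule tendsto_sandwich[OF always_eventually[OF allI[OF nn]] always_eventually[OF allI[OF le]] tendsto_const lim])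
    then have "(\<lambda>N. m (A N)) \<longlonglongrightarrow> 0" by (simp add: zero_ereal_def)
    then show "(\<lambda>N. ennreal (m (A N))) \<longlonglongrightarrow> 0"
      using tendsto_ennrealI[of "\<lambda>N. m (A N)" 0] by simp
  qed simp
  have em: "emeasure \<nu> J = ennreal (m J)" if "J \<in> sets M" for J
    unfolding \<nu>_def by (rule emeasure_measure_of_sigma[OF sets.sigma_algebra_axioms pos ca that])
  show "\<exists>\<nu> :: 'f measure. sets \<nu> = sets M \<and> finite_measure \<nu> \<and>
      (\<forall>J\<in>sets M. nu_measure M U (diag_op h g) \<omega> J = complex_of_real (measure \<nu> J)) \<and>
      absolutely_continuous M \<nu>"
  proof (intro exI[of _ \<nu>] conjI ballI)
    show "sets \<nu> = sets M" by (rule sets)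
    show "finite_measure \<nu>"
      by (rule finite_measureI) (simp add: sets em)
    show "nu_measure M U (diag_op h g) \<omega> J = complex_of_real (measure \<nu> J)" if "J \<in> sets M" for J
      using m0[OF that] by (simp add: nu_measure_compression[OF \<omega> that] measure_def em[OF that] m_def)
    show "absolutely_continuous M \<nu>"
      unfolding absolutely_continuous_def
      using em mnull sets by (auto simp: null_sets_def)
  qed
qed

end

theorem proposition4p14:
  fixes domD :: "'h::chilbert_space set" and D :: "'h \<Rightarrow> 'h"
    and h :: "nat \<Rightarrow> 'h" and lam :: "nat \<Rightarrow> real" and G :: "real \<Rightarrow> real"
    and A :: "'n::finite \<Rightarrow> 'h \<Rightarrow> 'h"
    and M :: "'f::topological_space measure" and U :: "'h \<Rightarrow> 'f \<Rightarrow> complex"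
    and e :: "'f \<Rightarrow> real^'n"
    and GD :: "'h \<Rightarrow> 'h"
  assumes "separable_space (euclidean :: 'h topology)"
    and "selfadjoint_on domD D" and "compact_resolvent domD D"
    and "orthonormal_basis h"
    and "\<forall>m. h m \<in> domD \<and> D (h m) = complex_of_real (lam m) *\<^sub>C h m"
    and "G \<in> borel_measurable borel" and "bounded (range G)" and "\<forall>t. 0 \<le> G t"
    and "GD = borel_calc domD D (\<lambda>t. complex_of_real (G t))"
    and "positive_op GD" and "GD \<in> L1inf"
    and "\<forall>i. selfadjoint_op (A i)" and "\<forall>i j. A i \<circ> A j = A j \<circ> A i"
    and "acts_nondegenerately A"
    and "sets M = sets borel" and "finite_measure M"
    and "joint_spectral_rep A M U e"
    and "spectrally_measurable M U GD"
  shows "(residue_tail_condition M U h lam G \<longleftrightarrow> projection_tail_condition M U GD) \<and>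
         (projection_tail_condition M U GD \<longleftrightarrow> nu_measure_condition M U GD)"
proof -
  note h = assms(4)
  define g where "g = (\<lambda>m. G (lam m))"
  obtain K where K: "\<And>t. norm (G t) \<le> K" using assms(7) unfolding bounded_iff by auto
  have g: "0 \<le> g m" "g m \<le> K" for m
    using assms(8) K[of "lam m"] by (auto simp: g_def)
  \<comment> \<open>Replaces the functional calculus by the explicit diagonal operator to which all
    the tail statements apply.\<close>
  have GD: "GD = diag_op h g"
    unfolding assms(9) g_def by (rule borel_calc_diag[OF h assms(2) _ assms(6,7)]) (use assms(5) in blast)
  have T: "diag_op h g \<in> L1inf_pos"
    using assms(10,11) by (simp add: L1inf_pos_def positive_op_iff GD)
  have U: "unitary_to_L2 M U" using assms(17) by (simp add: joint_spectral_rep_def)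
  have meas: "spectrally_measurable M U (diag_op h g)" using assms(18) by (simp add: GD)
  note ctx = U assms(16) h g T meas
  show ?thesis
    unfolding GD residue_tail_condition_iff[OF ctx, of G lam, OF fun_cong[OF g_def]]
      projection_tail_condition_iff[OF ctx]
  proof
    show "(\<forall>F. range F \<subseteq> sets M \<and> disjoint_family F \<longrightarrow>
        (\<lambda>N. limsup (\<lambda>k. ereal (residue_mean h g (mult_proj M U (\<Union>j\<in>{N..}. F j)) k))) \<longlonglongrightarrow> 0) =
      (\<forall>F. range F \<subseteq> sets M \<and> disjoint_family F \<longrightarrow>
        (\<lambda>N. norm0 (compression M U h g (\<Union>j\<in>{N..}. F j))) \<longlonglongrightarrow> 0)"
      using residue_tail_iff_norm0_tail[OF ctx] by blast
    show "(\<forall>F. range F \<subseteq> sets M \<and> disjoint_family F \<longrightarrow>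
        (\<lambda>N. norm0 (compression M U h g (\<Union>j\<in>{N..}. F j))) \<longlonglongrightarrow> 0) =
      nu_measure_condition M U (diag_op h g)"
      using nu_measure_condition_imp[OF ctx] nu_measure_conditionI[OF ctx] by blast
  qed
qed

end
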